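(* Let $q\geq 2$ be an integer, $z>2$, $\beta>0$, and let $(\mathcal{A}_t)_{t=0,\dots,T}$ be a regular collapsing scheme of $\{1,\dots,q\}$. Consider the generalized fuzzy Potts models with spin partitions $\mathcal{A}_t$, $t=1,\dots,T$. Then: (i) The model is Gibbs for all $t\in\{1,\dots,T\}$ if and only if $\beta<\beta_c(r_*(\mathcal{A}_1,z),z)$. (ii) The model is non-Gibbs for all $t\in\{1,\dots,T-1\}$ if and only if $\beta\geq\beta_c(r_*(\mathcal{A}_{T-1},z),z)$. (iii) For $\beta\in[\beta_c(r_*(\mathcal{A}_1,z),z),\beta_c(r_*(\mathcal{A}_{T-1},z),z))$ there is a transition time $t_G\in\{2,\dots,T-1\}$ such that the model is non-Gibbs for $t\in\{1,\dots,t_G-1\}$ and Gibbs for $t\in\{t_G,\dots,T\}$.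
   Context: Generalized Potts measure $\pi^N_{\beta,q,z}(\xi)=\frac1Z\exp\big(\frac{N\beta}{z}\sum_{i=1}^q(L_N^\xi(i))^z\big)$ on $\{1,\dots,q\}^N$ with $L_N^\xi$ the empirical distribution; $\beta_c(r,z)$ is the critical inverse temperature of the $r$-state generalized Potts model with exponent $z$. For a partition $\mathcal{A}=\{I_1,\dots,I_s\}$ of $\{1,\dots,q\}$, the fuzzy Potts measure on $\{1,\dots,s\}^N$ is the image of $\pi^N_{\beta,q,z}$ under the sitewise map sending spin $k$ to the index $l$ with $k\in I_l$. Its single-site conditional probabilities depend only on the empirical distribution $\bar\eta$ of the other $N-1$ fuzzy spins, $Q^N(k\mid\bar\eta)$; the model is Gibbs if for every $\nu$ the limits $Q^\infty(k\mid\nu)=\lim_N Q^N(k\mid\nu_N)$ exist for all admissible $\nu_N\to\nu$ and $\nu\mapsto Q^\infty(\cdot\mid\nu)$ is continuous; otherwise non-Gibbs. A collapsing scheme is a strictly decreasing (strictly coarsening) sequence of partitions $(\mathcal{A}_t)_{t=0,\dots,T}$ with $\mathcal{A}_0=\{\{1\},\dots,\{q\}\}$ and $\mathcal{A}_T=\{\{1,\dots,q\}\}$. For a partition $\mathcal{A}$, $r_*(\mathcal{A},z)$ is the size of the smallest class $r$ of $\mathcal{A}$ with $(r,z)\in([2,\infty)\times[2,\infty))\setminus(\{2\}\times[2,4])$ (smallest class size $\geq2$ if $z>4$, $\geq3$ if $2<z\leq4$). A collapsing scheme is regular if $T\geq 2$ and $(r_*(\mathcal{A}_t,z))_{t=1,\dots,T-1}$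 is increasing. *)

theory Defs
  imports "HOL-Analysis.Analysis" "HOL-Library.Disjoint_Sets"
begin

definition potts_configs :: "nat \<Rightarrow> nat \<Rightarrow> nat list set" where
  "potts_configs q N = {xi. length xi = N \<and> set xi \<subseteq> {1..q}}"

definition emp :: "'a list \<Rightarrow> 'a \<Rightarrow> real" where
  "emp xs a = real (length (filter (\<lambda>b. b = a) xs)) / real (length xs)"

definition potts_weight :: "real \<Rightarrow> nat \<Rightarrow> real \<Rightarrow> nat list \<Rightarrow> real" where
  "potts_weight beta q z xi =
     exp (real (length xi) * beta / z * (\<Sum>i=1..q. (emp xi i) powr z))"

definition potts_measure :: "real \<Rightarrow> nat \<Rightarrow> real \<Rightarrow> nat \<Rightarrow> nat list \<Rightarrow> real" where
  "potts_measure beta q z N xi =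
     potts_weight beta q z xi / (\<Sum>zeta\<in>potts_configs q N. potts_weight beta q z zeta)"

text \<open>Fuzzy spins are identified with the classes of the partition; a fuzzy
  configuration of N sites is a list of N classes.  The fuzzy measure is the
  image of the Potts measure under the sitewise map k \<mapsto> class containing k.\<close>
definition fuzzy_measure ::
  "real \<Rightarrow> nat \<Rightarrow> real \<Rightarrow> nat set set \<Rightarrow> nat set list \<Rightarrow> real" where
  "fuzzy_measure beta q z P eta =
     (\<Sum>xi\<in>{xi\<in>potts_configs q (length eta). list_all2 (\<lambda>k A. k \<in> A) xi eta}.
        potts_measure beta q z (length eta) xi)"

definition fuzzy_cond :: "real \<Rightarrow> nat \<Rightarrow> real \<Rightarrow> nat set set \<Rightarrow> nat set \<Rightarrow> nat set list \<Rightarrow> real" where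
  "fuzzy_cond beta q z P A eta =
     fuzzy_measure beta q z P (A # eta) / (\<Sum>B\<in>P. fuzzy_measure beta q z P (B # eta))"

definition simplex_on :: "nat set set \<Rightarrow> (nat set \<Rightarrow> real) set" where
  "simplex_on P = {nu. (\<forall>A\<in>P. 0 \<le> nu A) \<and> (\<forall>A. A \<notin> P \<longrightarrow> nu A = 0) \<and> (\<Sum>A\<in>P. nu A) = 1}"

definition fuzzy_gibbs :: "real \<Rightarrow> nat \<Rightarrow> real \<Rightarrow> nat set set \<Rightarrow> bool" where
  "fuzzy_gibbs beta q z P \<longleftrightarrow>
     (\<exists>Qinf :: nat set \<Rightarrow> (nat set \<Rightarrow> real) \<Rightarrow> real.
        (\<forall>nu\<in>simplex_on P. \<forall>etas :: nat \<Rightarrow> nat set list.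
           ((\<forall>N. length (etas N) = N \<and> set (etas N) \<subseteq> P) \<and>
            (\<forall>A\<in>P. (\<lambda>N. emp (etas N) A) \<longlonglongrightarrow> nu A))
           \<longrightarrow> (\<forall>A\<in>P. (\<lambda>N. fuzzy_cond beta q z P A (etas N)) \<longlonglongrightarrow> Qinf A nu))
      \<and> (\<forall>A\<in>P. \<forall>nu\<in>simplex_on P. \<forall>nus :: nat \<Rightarrow> nat set \<Rightarrow> real.
           ((\<forall>n. nus n \<in> simplex_on P) \<and> (\<forall>B\<in>P. (\<lambda>n. nus n B) \<longlonglongrightarrow> nu B))
           \<longrightarrow> (\<lambda>n. Qinf A (nus n)) \<longlonglongrightarrow> Qinf A nu))"

text \<open>Mean-field free-energy (negative rate) functional of the r-state
  generalized Potts model with exponent z, on probability vectors nu on {0..<r}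
  (convention 0 ln 0 = 0).\<close>
definition potts_functional :: "nat \<Rightarrow> real \<Rightarrow> real \<Rightarrow> (nat \<Rightarrow> real) \<Rightarrow> real" where
  "potts_functional r z beta nu =
     beta / z * (\<Sum>i<r. (nu i) powr z) - (\<Sum>i<r. if nu i = 0 then 0 else nu i * ln (nu i))"

definition prob_vectors :: "nat \<Rightarrow> (nat \<Rightarrow> real) set" where
  "prob_vectors r = {nu. (\<forall>i<r. 0 \<le> nu i) \<and> (\<Sum>i<r. nu i) = 1}"

definition beta_c :: "nat \<Rightarrow> real \<Rightarrow> real" where
  "beta_c r z = Sup {beta. 0 \<le> beta \<and>
     (\<forall>nu\<in>prob_vectors r. (\<exists>i<r. nu i \<noteq> 1 / real r) \<longrightarrow>
        potts_functional r z beta nu < potts_functional r z beta (\<lambda>_. 1 / real r))}"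

definition coarser :: "nat set set \<Rightarrow> nat set set \<Rightarrow> bool" where
  "coarser P' P \<longleftrightarrow> (\<forall>A\<in>P. \<exists>B\<in>P'. A \<subseteq> B)"

definition collapsing_scheme :: "nat \<Rightarrow> (nat \<Rightarrow> nat set set) \<Rightarrow> nat \<Rightarrow> bool" where
  "collapsing_scheme q As T \<longleftrightarrow>
     (\<forall>t\<le>T. partition_on {1..q} (As t)) \<and>
     As 0 = (\<lambda>k. {k}) ` {1..q} \<and>
     As T = {{1..q}} \<and>
     (\<forall>t<T. coarser (As (Suc t)) (As t) \<and> As (Suc t) \<noteq> As t)"

definition admissible_rz :: "nat \<Rightarrow> real \<Rightarrow> bool" where
  "admissible_rz r z \<longleftrightarrow> 2 \<le> r \<and> 2 \<le> z \<and> \<not> (r = 2 \<and> z \<le> 4)"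

definition r_star :: "nat set set \<Rightarrow> real \<Rightarrow> nat" where
  "r_star P z = Min {card A | A. A \<in> P \<and> admissible_rz (card A) z}"

definition regular_scheme :: "nat \<Rightarrow> real \<Rightarrow> (nat \<Rightarrow> nat set set) \<Rightarrow> nat \<Rightarrow> bool" where
  "regular_scheme q z As T \<longleftrightarrow>
     collapsing_scheme q As T \<and> 2 \<le> T \<and>
     (\<forall>t\<in>{1..T-1}. \<exists>A\<in>As t. admissible_rz (card A) z) \<and>
     (\<forall>s t. 1 \<le> s \<longrightarrow> s \<le> t \<longrightarrow> t \<le> T - 1 \<longrightarrow> r_star (As s) z \<le> r_star (As t) z)"

end

theory Submission
  imports Defs "HOL-Real_Asymp.Real_Asymp"
begin

text \<open>
  The fuzzy measure factorizes over the classes, so its single-site conditional probabilities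
  are normalised ratios \<open>W(n + 1) / W(n)\<close> of Potts sums on single classes. For a class with \<open>r\<close>
  elements and asymptotic fraction \<open>x\<close> of sites this ratio converges to \<open>\<Sum>i<r. exp (b * m i powr (z - 1))\<close>,
  where \<open>b = beta * x powr (z - 1)\<close> and \<open>m\<close> maximizes the mean-field functional at \<open>b\<close>, as long as
  all maximizers give the same value. If \<open>beta < beta_c r z\<close>, the maximizer is uniform for all fractions \<open>x \<le> 1\<close>;
  for two states and \<open>z \<le> 4\<close> the maximizer is unique up to a swap at every temperature. Otherwise
  the transition is of first order, and the ratio jumps where \<open>b\<close> crosses \<open>beta_c r z\<close>. If
  \<open>beta = beta_c r z\<close>, this value is only reached at \<open>x = 1\<close>, and there the ordered phases keep a
  positive share of the mass. Since \<open>beta_c r z\<close> is increasing in \<open>r\<close>, the smallest admissible class decides.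
\<close>
section \<open>The mean-field functional and its maximizers\<close>

text \<open>No formula for a maximizer or for \<open>beta_c\<close> is used. The mean-field equation
  is replaced by a duality: at a maximizer the logarithm of \<open>field_sum\<close> equals the
  maximal value of the functional plus \<open>b * (1 - 1 / z)\<close> times
  \<open>power_sum\<close>. Both summands grow with \<open>b\<close> whichever maximizers are
  chosen, so field sums can be compared across phases and every jump goes upwards. The transition is
  of first order because, for an admissible pair, the uniform vector is beaten before it stops being
  a local maximizer, so its rivals stay away from it. The delicate case is
  \<open>beta = beta_c\<close>. A class occupying all N conditioning sites has effective inverse
  temperature \<open>beta_c * (N / (N + 1)) powr (z - 1)\<close>, below \<open>beta_c\<close> by
  order 1 / N. This changes weights only by constant factors, so estimates up to polynomial factors
  cannot decide which phase survives: the disordered phase has to be bounded by a constant times its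
  exponential rate.\<close>

locale potts_exponent =
  fixes z :: real
  assumes z_gt_2: "2 < z"
begin

definition site_fn :: "real \<Rightarrow> real \<Rightarrow> real" where
  "site_fn b x = b / z * x powr z - x * ln x"

definition power_sum :: "nat \<Rightarrow> (nat \<Rightarrow> real) \<Rightarrow> real" where
  "power_sum r u = (\<Sum>i<r. u i powr z)"

definition field_sum :: "nat \<Rightarrow> real \<Rightarrow> (nat \<Rightarrow> real) \<Rightarrow> real" where
  "field_sum r b u = (\<Sum>i<r. exp (b * u i powr (z - 1)))"

text \<open>As in \<open>prob_vectors\<close>, values at indices from \<open>r\<close> on are
  arbitrary. Uniqueness is therefore always expressed on the coordinates below \<open>r\<close> or
  through \<open>field_sum\<close>.\<close>

definition maximizers :: "nat \<Rightarrow> real \<Rightarrow> (nat \<Rightarrow> real) set" where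
  "maximizers r b = {m \<in> prob_vectors r. \<forall>u\<in>prob_vectors r.
     potts_functional r z b u \<le> potts_functional r z b m}"

abbreviation F :: "nat \<Rightarrow> real \<Rightarrow> (nat \<Rightarrow> real) \<Rightarrow> real" where
  "F r b u \<equiv> potts_functional r z b u"

definition uniform :: "nat \<Rightarrow> nat \<Rightarrow> real" where
  "uniform r = (\<lambda>_. 1 / real r)"

lemma functional_sum_site: "F r b u = (\<Sum>i<r. site_fn b (u i))"
proof -
  have "(if x = 0 then 0 else x * ln x) = x * ln x" for x :: real by simp
  then show ?thesis
    unfolding potts_functional_def site_fn_def
    by (simp add: sum_subtractf sum_distrib_left)
qed

lemma functional_eq: "F r b u = b / z * power_sum r u - (\<Sum>i<r. u i * ln (u i))"
  by (simp add: functional_sum_site site_fn_def sum_subtractf sum_distrib_left power_sum_def)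

lemma prob_vectorsD:
  assumes "u \<in> prob_vectors r"
  shows "\<And>i. i < r \<Longrightarrow> 0 \<le> u i" "(\<Sum>i<r. u i) = 1" "\<And>i. i < r \<Longrightarrow> u i \<le> 1" "r > 0"
proof -
  show a: "0 \<le> u i" if "i < r" for i using assms that by (simp add: prob_vectors_def)
  show b: "(\<Sum>i<r. u i) = 1" using assms by (simp add: prob_vectors_def)
  show "u i \<le> 1" if "i < r" for i
    using member_le_sum[of i "{..<r}" u] a b that by simp
  show "r > 0" using b by (cases r) auto
qed

lemma uniform_prob: "r > 0 \<Longrightarrow> uniform r \<in> prob_vectors r"
  by (simp add: prob_vectors_def uniform_def)

section \<open>Continuity, compactness and existence of maximizers\<close>

lemma continuous_x_ln_x: "continuous_on {0..} (\<lambda>x::real. x * ln x)"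
proof -
  have "continuous (at x within {0..}) (\<lambda>x::real. x * ln x)" if "x \<ge> 0" for x :: real
  proof (cases "x = 0")
    case True
    have "((\<lambda>x::real. x * ln x) \<longlongrightarrow> 0) (at_right 0)" by real_asymp
    then have "((\<lambda>x::real. x * ln x) \<longlongrightarrow> 0) (at 0 within {0..})"
      by (simp add: at_within_Ici_at_right)
    then show ?thesis using True by (simp add: continuous_within)
  next
    case False
    then show ?thesis using that by (intro continuous_intros) auto
  qed
  then show ?thesis by (simp add: continuous_on_eq_continuous_within)
qed


lemma continuous_site_fn: "continuous_on {0..} (site_fn b)"
  unfolding site_fn_def [abs_def] using z_gt_2
  by (intro continuous_intros continuous_on_powr' continuous_x_ln_x) auto

lemma tendsto_x_ln_x:
  assumes "(f \<longlongrightarrow> (l::real)) G" "0 \<le> l" "eventually (\<lambda>x. 0 \<le> f x) G"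
  shows "((\<lambda>x. f x * ln (f x)) \<longlongrightarrow> l * ln l) G"
  using continuous_on_tendsto_compose[OF continuous_x_ln_x assms(1)] assms(2,3)
  by auto

lemma tendsto_functional:
  assumes "\<And>i. i < r \<Longrightarrow> (\<lambda>n. v n i) \<longlonglongrightarrow> u i" "bs \<longlonglongrightarrow> b"
    and v: "\<And>n. v n \<in> prob_vectors r"
  shows "(\<lambda>n. F r (bs n) (v n)) \<longlonglongrightarrow> F r b u"
proof -
  have nn: "0 \<le> v n i" if "i < r" for n i using prob_vectorsD(1)[OF v that] .
  then have "0 \<le> u i" if "i < r" for i using LIMSEQ_le_const assms(1)[OF that] that by blast
  then show ?thesis
    unfolding functional_sum_site site_fn_def
    using assms nn z_gt_2
    by (intro tendsto_intros tendsto_x_ln_x) auto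
qed

lemma tendsto_field_sum:
  assumes "\<And>i. i < r \<Longrightarrow> (\<lambda>n. v n i) \<longlonglongrightarrow> u i" "bs \<longlonglongrightarrow> b"
    and v: "\<And>n. v n \<in> prob_vectors r"
  shows "(\<lambda>n. field_sum r (bs n) (v n)) \<longlonglongrightarrow> field_sum r b u"
proof -
  have nn: "0 \<le> v n i" if "i < r" for n i using prob_vectorsD(1)[OF v that] .
  then show ?thesis
    unfolding field_sum_def using assms z_gt_2
    by (intro tendsto_intros) auto
qed

lemma prob_vectors_limit:
  assumes "\<And>i. i < r \<Longrightarrow> (\<lambda>n. v n i) \<longlonglongrightarrow> u i" "\<And>n. v n \<in> prob_vectors r"
  shows "u \<in> prob_vectors r"
proof -
  have "0 \<le> u i" if "i < r" for i
    using LIMSEQ_le_const assms(1)[OF that] prob_vectorsD(1)[OF assms(2) that] by blast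
  moreover have "(\<lambda>n. \<Sum>i<r. v n i) \<longlonglongrightarrow> (\<Sum>i<r. u i)"
    by (intro tendsto_intros) (use assms in auto)
  then have "(\<Sum>i<r. u i) = 1"
    using prob_vectorsD(2)[OF assms(2)] by (simp add: LIMSEQ_const_iff)
  ultimately show ?thesis by (simp add: prob_vectors_def)
qed

text \<open>Bolzano-Weierstrass one coordinate at a time: each induction step refines the previous
  subsequence.\<close>

lemma bounded_vectors_subseq:
  fixes v :: "nat \<Rightarrow> nat \<Rightarrow> real"
  assumes "\<And>n i. i < r \<Longrightarrow> 0 \<le> v n i \<and> v n i \<le> 1"
  shows "\<exists>s u. strict_mono (s::nat\<Rightarrow>nat) \<and> (\<forall>i<r. (\<lambda>n. v (s n) i) \<longlonglongrightarrow> u i)"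
  using assms
proof (induction r)
  case 0
  show ?case by (rule exI[of _ id]) (simp add: strict_mono_def)
next
  case (Suc r)
  then obtain s u where s: "strict_mono (s::nat\<Rightarrow>nat)" "\<forall>i<r. (\<lambda>n. v (s n) i) \<longlonglongrightarrow> u i"
    by (metis less_SucI)
  have "\<forall>n. v (s n) r \<in> {0..1}" using Suc.prems by auto
  then obtain l s' where s': "strict_mono s'" "((\<lambda>n. v (s n) r) \<circ> s') \<longlonglongrightarrow> l"
    using compact_Icc[of 0 "1::real"] unfolding compact_def by metis
  show ?case
  proof (intro exI conjI allI impI)
    show "strict_mono (s \<circ> s')" using s(1) s'(1) by (simp add: strict_mono_o)
    fix i assume "i < Suc r"
    show "(\<lambda>n. v ((s \<circ> s') n) i) \<longlonglongrightarrow> (u(r := l)) i"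
    proof (cases "i = r")
      case True
      then show ?thesis using s'(2) by (simp add: o_def)
    next
      case False
      then have "(\<lambda>n. v (s n) i) \<longlonglongrightarrow> u i" using s(2) \<open>i < Suc r\<close> by simp
      from LIMSEQ_subseq_LIMSEQ[OF this s'(1)] False show ?thesis by (simp add: o_def)
    qed
  qed
qed

lemma prob_vectors_subseq:
  assumes "\<And>n. v n \<in> prob_vectors r"
  obtains s u where "strict_mono (s::nat\<Rightarrow>nat)" "\<And>i. i < r \<Longrightarrow> (\<lambda>n. v (s n) i) \<longlonglongrightarrow> u i"
    "u \<in> prob_vectors r"
proof -
  obtain s u where s: "strict_mono (s::nat\<Rightarrow>nat)" "\<forall>i<r. (\<lambda>n. v (s n) i) \<longlonglongrightarrow> u i"
    using bounded_vectors_subseq[of r v] prob_vectorsD[OF assms] by metis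
  moreover from this have "u \<in> prob_vectors r"
    using prob_vectors_limit[of r "\<lambda>n. v (s n)" u] assms by blast
  ultimately show ?thesis using that by blast
qed

text \<open>Sequential closedness of \<open>E\<close> is used instead of a topology on the vectors, since only
  the coordinates below \<open>r\<close> matter.\<close>
definition seq_closed :: "nat \<Rightarrow> (nat \<Rightarrow> real) set \<Rightarrow> bool" where
  "seq_closed r E \<longleftrightarrow> (\<forall>v u. (\<forall>n. v n \<in> prob_vectors r \<and> v n \<in> E) \<longrightarrow>
     (\<forall>i<r. (\<lambda>n. v n i) \<longlonglongrightarrow> u i) \<longrightarrow> u \<in> E)"

text \<open>A maximizing sequence has a convergent subsequence, and its limit stays in
  \<open>E\<close>. The version relative to \<open>E\<close> is what later yields a strictly
  positive gap between \<open>E\<close> and the maximizers.\<close>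

lemma functional_attains_max:
  assumes "seq_closed r E" "E \<inter> prob_vectors r \<noteq> {}"
  shows "\<exists>m\<in>E \<inter> prob_vectors r. \<forall>u\<in>E \<inter> prob_vectors r. F r b u \<le> F r b m"
proof -
  let ?D = "E \<inter> prob_vectors r"
  let ?S = "F r b ` ?D"
  have bdd: "bdd_above ?S"
  proof (rule ccontr)
    assume "\<not> ?thesis"
    then have "\<exists>u\<in>?D. F r b u > real n" for n
      unfolding bdd_above_def by (metis (no_types, lifting) imageE linorder_le_cases not_le)
    then obtain v where v: "\<And>n. v n \<in> ?D \<and> F r b (v n) > real n" by metis
    then obtain s u where s: "strict_mono s" "\<And>i. i < r \<Longrightarrow> (\<lambda>n. v (s n) i) \<longlonglongrightarrow> u i"
      using prob_vectors_subseq[of v r] by blast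
    have "(\<lambda>n. F r b (v (s n))) \<longlonglongrightarrow> F r b u"
      using tendsto_functional[of r "\<lambda>n. v (s n)" u "\<lambda>_. b" b] s v by auto
    then have "Bseq (\<lambda>n. F r b (v (s n)))" by (simp add: convergent_imp_Bseq convergentI)
    then obtain K where K: "\<And>n. \<bar>F r b (v (s n))\<bar> \<le> K" by (auto simp: Bseq_def)
    obtain n where n: "real n > K" using reals_Archimedean2 by blast
    have "real n \<le> real (s n)" using seq_suble[OF s(1)] by simp
    then show False using K[of n] v[of "s n"] n by linarith
  qed
  have ne: "?S \<noteq> {}" using assms(2) by blast
  have "\<exists>u\<in>?D. F r b u > Sup ?S - inverse (real (Suc n))" for n
    using less_cSup_iff[OF ne bdd, of "Sup ?S - inverse (real (Suc n))"] by auto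
  then obtain v where v: "\<And>n. v n \<in> ?D" "\<And>n. F r b (v n) > Sup ?S - inverse (real (Suc n))"
    by metis
  then obtain s u where s: "strict_mono s" "\<And>i. i < r \<Longrightarrow> (\<lambda>n. v (s n) i) \<longlonglongrightarrow> u i"
      "u \<in> prob_vectors r"
    using prob_vectors_subseq[of v r] by blast
  have uE: "u \<in> E"
    using assms(1) v(1) s(2) unfolding seq_closed_def by (metis IntE)
  have lim: "(\<lambda>n. F r b (v (s n))) \<longlonglongrightarrow> F r b u"
    using tendsto_functional[of r "\<lambda>n. v (s n)" u "\<lambda>_. b" b] s v by auto
  have "(\<lambda>n. Sup ?S - inverse (real (Suc n))) \<longlonglongrightarrow> Sup ?S - 0"
    by (intro tendsto_intros LIMSEQ_inverse_real_of_nat)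
  from LIMSEQ_subseq_LIMSEQ[OF this s(1)]
  have "Sup ?S - 0 \<le> F r b u"
    using lim v(2) by (intro LIMSEQ_le[OF _ lim]) (auto simp: o_def intro!: exI[of _ 0] less_imp_le)
  then show ?thesis
    using uE s(3) cSup_upper[OF _ bdd] by (intro bexI[of _ u]) fastforce+
qed

lemma maximizers_nonempty:
  assumes "r > 0"
  obtains m where "m \<in> maximizers r b"
  using functional_attains_max[of r UNIV b] uniform_prob[OF assms]
  unfolding maximizers_def seq_closed_def by auto

lemma maximizersD:
  assumes "m \<in> maximizers r b"
  shows "m \<in> prob_vectors r" "\<And>u. u \<in> prob_vectors r \<Longrightarrow> F r b u \<le> F r b m"
  using assms by (auto simp: maximizers_def)

text \<open>Closed graph property: optimality against a fixed competitor \<open>w\<close> passes to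
  the limit because the functional is jointly continuous in \<open>b\<close> and the vector.\<close>

lemma maximizers_limit:
  assumes m: "\<And>n. m n \<in> maximizers r (bs n)" and bs: "bs \<longlonglongrightarrow> b"
    and lim: "\<And>i. i < r \<Longrightarrow> (\<lambda>n. m n i) \<longlonglongrightarrow> u i"
  shows "u \<in> maximizers r b"
proof -
  have pv: "m n \<in> prob_vectors r" for n using maximizersD(1)[OF m] .
  have "F r b w \<le> F r b u" if w: "w \<in> prob_vectors r" for w
  proof (rule LIMSEQ_le)
    show "(\<lambda>n. F r (bs n) w) \<longlonglongrightarrow> F r b w"
      by (rule tendsto_functional) (use w bs in auto)
    show "(\<lambda>n. F r (bs n) (m n)) \<longlonglongrightarrow> F r b u"
      by (rule tendsto_functional) (use pv bs lim in auto)
    show "\<exists>N. \<forall>n\<ge>N. F r (bs n) w \<le> F r (bs n) (m n)" using maximizersD(2)[OF m w] by blast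
  qed
  then show ?thesis using prob_vectors_limit[OF lim pv] by (simp add: maximizers_def)
qed

section \<open>Gibbs variational inequality and duality at maximizers\<close>

lemma entropy_plus_mean_le:
  assumes "m \<in> prob_vectors r"
  shows "(\<Sum>i<r. m i * t i) - (\<Sum>i<r. m i * ln (m i)) \<le> ln (\<Sum>i<r. exp (t i))"
proof -
  let ?S = "\<Sum>i<r. exp (t i)"
  have S: "?S > 0" using prob_vectorsD(4)[OF assms] by (intro sum_pos) auto
  have "m i * (t i - ln (m i) - ln ?S) \<le> exp (t i) / ?S - m i" if "i < r" for i
  proof (cases "m i = 0")
    case False
    then have mi: "m i > 0" using prob_vectorsD(1)[OF assms that] by simp
    have "t i - ln (m i) - ln ?S = ln (exp (t i) / (m i * ?S))"
      using mi S by (simp add: ln_div ln_mult)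
    also have "\<dots> \<le> exp (t i) / (m i * ?S) - 1"
      using mi S by (intro ln_le_minus_one) auto
    finally have "m i * (t i - ln (m i) - ln ?S) \<le> m i * (exp (t i) / (m i * ?S) - 1)"
      using mi by (intro mult_left_mono) auto
    also have "\<dots> = exp (t i) / ?S - m i" using mi by (simp add: field_simps)
    finally show ?thesis .
  qed (use S in auto)
  then have "(\<Sum>i<r. m i * (t i - ln (m i) - ln ?S)) \<le> (\<Sum>i<r. exp (t i) / ?S - m i)"
    by (intro sum_mono) auto
  also have "\<dots> = 0"
    using S prob_vectorsD(2)[OF assms] by (simp add: sum_subtractf sum_divide_distrib[symmetric])
  also have "(\<Sum>i<r. m i * (t i - ln (m i) - ln ?S))
      = (\<Sum>i<r. m i * t i) - (\<Sum>i<r. m i * ln (m i)) - ln ?S"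
    using prob_vectorsD(2)[OF assms]
    by (simp add: right_diff_distrib sum_subtractf flip: sum_distrib_right)
  finally show ?thesis by simp
qed

lemma powr_split: "0 \<le> x \<Longrightarrow> x powr z = x powr (z - 1) * (x::real)"
  using powr_add[of x "z-1" 1] by (cases "x = 0") auto

text \<open>Young's inequality with the conjugate exponents \<open>z\<close> and
  \<open>z / (z - 1)\<close>; this treats the boundary point 0 together with the interior.\<close>

lemma powr_tangent:
  assumes "0 \<le> x" "0 \<le> y"
  shows "x powr z + z * x powr (z - 1) * (y - x) \<le> y powr z"
proof -
  have "y * x powr (z - 1) \<le> y powr z / z + (x powr (z - 1)) powr (z / (z - 1)) / (z / (z - 1))"
    using z_gt_2 assms by (intro Youngs_inequality) (auto simp: field_simps)
  also have "(x powr (z - 1)) powr (z / (z - 1)) = x powr z"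
    using z_gt_2 by (simp add: powr_powr)
  finally have "z * (y * x powr (z - 1)) \<le> z * (y powr z / z + x powr z / (z / (z - 1)))"
    using z_gt_2 by (intro mult_left_mono) auto
  also have "\<dots> = y powr z + (z - 1) * x powr z" using z_gt_2 by (simp add: field_simps)
  finally show ?thesis using powr_split[OF assms(1)] by (simp add: algebra_simps)
qed

text \<open>Two tangent steps, from \<open>x\<close> to the midpoint and on to \<open>y\<close>;
  strictness comes from the larger slope on the second half.\<close>

lemma powr_tangent_strict:
  assumes "0 < x" "x < y"
  shows "x powr z + z * x powr (z - 1) * (y - x) < y powr z"
proof -
  define w where "w = (x + y) / 2"
  have w: "x < w" "w < y" using assms by (auto simp: w_def)
  have "x powr z + z * x powr (z - 1) * (w - x) \<le> w powr z"
    "w powr z + z * w powr (z - 1) * (y - w) \<le> y powr z"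
    using w assms by (auto intro!: powr_tangent)
  moreover have "z * x powr (z - 1) * (y - w) < z * w powr (z - 1) * (y - w)"
    using w assms z_gt_2 by (intro mult_strict_right_mono mult_strict_left_mono powr_less_mono2) auto
  ultimately show ?thesis by (simp add: algebra_simps)
qed

text \<open>Replace the power sum in the functional by its tangent at \<open>u\<close>; the supremum
  over probability vectors of the result is this expression. It lies between the functional at
  \<open>u\<close> and the maximum of the functional.\<close>

definition gibbs_bound :: "nat \<Rightarrow> real \<Rightarrow> (nat \<Rightarrow> real) \<Rightarrow> real" where
  "gibbs_bound r b u = ln (field_sum r b u) - b * (1 - 1 / z) * power_sum r u"

lemma power_sum_weight: "u \<in> prob_vectors r \<Longrightarrow>
    (\<Sum>i<r. u i * (b * u i powr (z - 1))) = b * power_sum r u"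
  using prob_vectorsD(1)[of u r]
  by (simp add: power_sum_def sum_distrib_left powr_split mult_ac)

lemma functional_le_gibbs_bound:
  assumes "m \<in> prob_vectors r"
  shows "F r b m \<le> gibbs_bound r b m"
  using entropy_plus_mean_le[OF assms, of "\<lambda>i. b * m i powr (z - 1)"]
  unfolding power_sum_weight[OF assms]
  by (simp add: functional_eq gibbs_bound_def field_sum_def algebra_simps)

lemma field_sum_pos: "r > 0 \<Longrightarrow> field_sum r b u > 0"
  unfolding field_sum_def by (intro sum_pos) auto

lemma power_sum_tangent:
  assumes "m \<in> prob_vectors r" "u \<in> prob_vectors r"
  shows "z * (\<Sum>i<r. u i * m i powr (z - 1)) - (z - 1) * power_sum r m \<le> power_sum r u"
proof -
  have "(\<Sum>i<r. m i powr z + z * m i powr (z - 1) * (u i - m i)) \<le> power_sum r u"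
    unfolding power_sum_def using prob_vectorsD(1)[OF assms(1)] prob_vectorsD(1)[OF assms(2)]
    by (intro sum_mono powr_tangent) auto
  moreover have "(\<Sum>i<r. m i powr z + z * m i powr (z - 1) * (u i - m i))
      = z * (\<Sum>i<r. u i * m i powr (z - 1)) - (z - 1) * power_sum r m"
    using prob_vectorsD(1)[OF assms(1)]
    by (simp add: power_sum_def sum_distrib_left sum_subtractf[symmetric] powr_split algebra_simps
        sum.distrib[symmetric])
  ultimately show ?thesis by simp
qed

text \<open>The probability vector proportional to \<open>exp (b * m i powr (z - 1))\<close> does at least as
  well as \<open>m\<close>, by convexity of \<open>x powr z\<close>.\<close>
lemma gibbs_bound_le_functional:
  assumes m: "m \<in> prob_vectors r" and b: "0 \<le> b"
  shows "\<exists>p\<in>prob_vectors r. gibbs_bound r b m \<le> F r b p"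
proof -
  let ?S = "field_sum r b m"
  have S: "?S > 0" using field_sum_pos prob_vectorsD(4)[OF m] .
  define p where "p i = exp (b * m i powr (z - 1)) / ?S" for i
  have p: "p \<in> prob_vectors r"
    using S by (auto simp: prob_vectors_def p_def sum_divide_distrib[symmetric] field_sum_def)
  have lnp: "ln (p i) = b * m i powr (z - 1) - ln ?S" for i
    using S by (simp add: p_def ln_div)
  have "z * (\<Sum>i<r. p i * m i powr (z - 1)) - (z - 1) * power_sum r m \<le> power_sum r p"
    by (rule power_sum_tangent[OF m p])
  then have "b / z * (z * (\<Sum>i<r. p i * m i powr (z - 1)) - (z - 1) * power_sum r m)
      \<le> b / z * power_sum r p"
    using b z_gt_2 by (intro mult_left_mono) auto
  moreover have "(\<Sum>i<r. p i * ln (p i)) = b * (\<Sum>i<r. p i * m i powr (z - 1)) - ln ?S"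
    using prob_vectorsD(2)[OF p]
    by (simp add: lnp right_diff_distrib sum_subtractf sum_distrib_left flip: sum_distrib_right)
       (simp add: mult_ac)
  moreover have "b / z * (z * A - (z - 1) * B) = b * A - b * (1 - 1 / z) * B" for A B
    using z_gt_2 by (simp add: field_simps)
  ultimately show ?thesis
    by (intro bexI[OF _ p]) (simp add: functional_eq gibbs_bound_def)
qed

text \<open>At a maximizer the chain from \<open>F r b m\<close> to \<open>gibbs_bound r b m\<close>
  to \<open>F r b p\<close> closes up, so all terms agree. This does the work of the Euler-Lagrange
  equation.\<close>

lemma maximizer_field_sum:
  assumes "m \<in> maximizers r b" "0 \<le> b"
  shows "field_sum r b m = exp (F r b m + b * (1 - 1 / z) * power_sum r m)"
proof -
  have m: "m \<in> prob_vectors r" using maximizersD(1)[OF assms(1)] .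
  have "gibbs_bound r b m = F r b m"
    using functional_le_gibbs_bound[OF m, of b] gibbs_bound_le_functional[OF m assms(2)]
      maximizersD(2)[OF assms(1)] by force
  then have "ln (field_sum r b m) = F r b m + b * (1 - 1 / z) * power_sum r m"
    by (simp add: gibbs_bound_def)
  then show ?thesis using field_sum_pos prob_vectorsD(4)[OF m] by (metis exp_ln)
qed

section \<open>Monotonicity in the inverse temperature\<close>

lemma power_sum_nonneg: "0 \<le> power_sum r u"
  by (simp add: power_sum_def sum_nonneg)

lemma power_sum_le_1:
  assumes "u \<in> prob_vectors r"
  shows "power_sum r u \<le> 1"
proof -
  have "u i powr z \<le> u i" if "i < r" for i
  proof -
    have "u i powr z \<le> u i powr 1"
      using prob_vectorsD(1,3)[OF assms that] z_gt_2 by (intro powr_mono') auto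
    then show ?thesis using prob_vectorsD(1)[OF assms that] by simp
  qed
  then have "power_sum r u \<le> (\<Sum>i<r. u i)" unfolding power_sum_def by (intro sum_mono) auto
  then show ?thesis using prob_vectorsD(2)[OF assms] by simp
qed

lemma functional_shift: "F r b' u = F r b u + (b' - b) / z * power_sum r u"
  by (simp add: functional_eq diff_divide_distrib algebra_simps)

text \<open>Add the optimality of \<open>m\<close> at \<open>b\<close> to that of \<open>m'\<close>
  at \<open>b'\<close>: the functional is affine in \<open>b\<close> with slope
  \<open>power_sum / z\<close>. No continuity of the maximizers in \<open>b\<close> enters.\<close>

lemma maximizers_power_sum_mono:
  assumes "b < b'" "m \<in> maximizers r b" "m' \<in> maximizers r b'"
  shows "power_sum r m \<le> power_sum r m'"
proof -
  have "F r b m' \<le> F r b m" "F r b' m \<le> F r b' m'"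
    using assms maximizersD by blast+
  then have "(b' - b) / z * power_sum r m \<le> (b' - b) / z * power_sum r m'"
    using functional_shift[of r b' m b] functional_shift[of r b' m' b] by linarith
  moreover have "(b' - b) / z > 0" using assms(1) z_gt_2 by auto
  ultimately show ?thesis using mult_le_cancel_left_pos by blast
qed

lemma maximizers_value_mono:
  assumes "b \<le> b'" "m \<in> maximizers r b" "m' \<in> maximizers r b'"
  shows "F r b m \<le> F r b' m'"
proof -
  have "F r b m \<le> F r b' m"
    using functional_shift[of r b' m b] power_sum_nonneg[of r m] assms(1) z_gt_2 by simp
  then show ?thesis using maximizersD(2)[OF assms(3) maximizersD(1)[OF assms(2)]] by simp
qed

text \<open>Both terms in the exponent of \<open>maximizer_field_sum\<close> are monotone. The order
  holds for every choice of maximizers, in particular across coexisting phases.\<close>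

lemma maximizers_field_sum_mono:
  assumes "0 \<le> b" "b < b'" "m \<in> maximizers r b" "m' \<in> maximizers r b'"
  shows "field_sum r b m \<le> field_sum r b' m'"
proof -
  have "b * (1 - 1 / z) * power_sum r m \<le> b' * (1 - 1 / z) * power_sum r m'"
    using assms z_gt_2 maximizers_power_sum_mono[OF assms(2-4)] power_sum_nonneg[of r m]
    by (intro mult_mono) auto
  then show ?thesis
    using maximizer_field_sum[OF assms(3)] maximizer_field_sum[OF assms(4)]
      maximizers_value_mono[of b b' m r m'] assms by simp
qed

text \<open>Tangents at \<open>1 / r\<close> sum to the uniform value since their linear parts
  cancel; coordinate \<open>i\<close> adds its convexity gap. The gap is stated at \<open>x\<close>
  rather than at \<open>u i\<close> so that one constant serves all vectors with a coordinate above
  \<open>x\<close>.\<close>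

lemma power_sum_gap:
  assumes u: "u \<in> prob_vectors r" and i: "i < r" "x \<le> u i" and x: "1 / r < x"
  shows "power_sum r (uniform r) + (x powr z - (1 / r) powr z - z * (1 / r) powr (z - 1) * (x - 1 / r))
    \<le> power_sum r u"
proof -
  have r: "r > 0" using prob_vectorsD(4)[OF u] .
  let ?m = "1 / real r"
  let ?g = "x powr z - ?m powr z - z * ?m powr (z - 1) * (x - ?m)"
  have "(\<Sum>j<r. ?m powr z + z * ?m powr (z - 1) * (u j - ?m) + (if i = j then ?g else 0)) \<le> power_sum r u"
    unfolding power_sum_def
  proof (rule sum_mono)
    fix j assume "j \<in> {..<r}"
    then have j: "0 \<le> u j" using prob_vectorsD(1)[OF u] by simp
    show "?m powr z + z * ?m powr (z - 1) * (u j - ?m) + (if i = j then ?g else 0) \<le> u j powr z"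
    proof (cases "i = j")
      case True
      \<comment> \<open>The slope at \<open>x\<close> dominates the slope at \<open>1 / r\<close>,
        so moving from \<open>x\<close> up to \<open>u j\<close> can only enlarge the gap.\<close>
      have "z * ?m powr (z - 1) * (u j - x) \<le> z * x powr (z - 1) * (u j - x)"
        using True i x z_gt_2 by (intro mult_right_mono mult_left_mono powr_mono2) auto
      moreover have "x powr z + z * x powr (z - 1) * (u j - x) \<le> u j powr z"
        using x j by (intro powr_tangent) (auto intro: order_trans[of 0 "1 / real r"])
      ultimately show ?thesis using True by (simp add: algebra_simps)
    qed (use powr_tangent[of ?m "u j"] j in simp)
  qed
  moreover have "(\<Sum>j<r. z * ?m powr (z - 1) * (u j - ?m)) = 0"
    using prob_vectorsD(2)[OF u] r by (simp add: sum_distrib_left[symmetric] sum_subtractf)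
  ultimately show ?thesis
    using i by (simp add: sum.distrib power_sum_def uniform_def)
qed

lemma power_sum_uniform_less:
  assumes u: "u \<in> prob_vectors r" and i: "i < r" "u i > 1 / r"
  shows "power_sum r (uniform r) < power_sum r u"
  using power_sum_gap[OF u i(1) order_refl i(2)] powr_tangent_strict[of "1 / r" "u i"]
    prob_vectorsD(4)[OF u] i(2) by simp

lemma exists_above_uniform:
  assumes u: "u \<in> prob_vectors r" and ne: "\<exists>i<r. u i \<noteq> 1 / r"
  shows "\<exists>i<r. u i > 1 / r"
proof (rule ccontr)
  assume "\<not> ?thesis"
  then have le: "\<forall>i\<in>{..<r}. u i \<le> 1 / r" by (metis lessThan_iff not_less)
  moreover obtain i where "i < r" "u i < 1 / r" using ne le by (metis lessThan_iff order_le_less)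
  ultimately have "(\<Sum>i<r. u i) < (\<Sum>i<r. 1 / r)" by (intro sum_strict_mono_ex1) auto
  then show False using prob_vectorsD[OF u] by simp
qed

lemma power_sum_uniform_le:
  assumes "u \<in> prob_vectors r"
  shows "power_sum r (uniform r) \<le> power_sum r u"
proof (cases "\<exists>i<r. u i \<noteq> 1 / r")
  case True
  then show ?thesis
    using exists_above_uniform[OF assms] power_sum_uniform_less[OF assms] by fastforce
next
  case False
  then show ?thesis by (auto simp: power_sum_def uniform_def intro!: eq_refl sum.cong)
qed

lemma functional_uniform: "r > 0 \<Longrightarrow> F r b (uniform r) = b / z * (1 / r) powr (z - 1) + ln r"
  using powr_split[of "1/real r"]
  by (simp add: functional_sum_site site_fn_def uniform_def ln_div field_simps)

text \<open>Below \<open>x0\<close> with \<open>b * (z - 1) * x0 powr (z - 1) = 1\<close> the site function is strictly concave.\<close>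
lemma site_fn_tangent_strict:
  assumes m: "0 < m" "m \<le> x0" and x: "0 \<le> x" "x \<le> x0" "x \<noteq> m"
    and b: "0 \<le> b" "b * (z - 1) * x0 powr (z - 1) \<le> 1"
  shows "site_fn b x < site_fn b m + (b * m powr (z - 1) - ln m - 1) * (x - m)"
proof -
  define g' where "g' x = b * x powr (z - 1) - ln x - 1" for x
  have der: "(site_fn b has_real_derivative g' y) (at y)" if "y > 0" for y
    unfolding site_fn_def [abs_def] g'_def using that z_gt_2
    by (auto intro!: derivative_eq_intros)
  have der': "(g' has_real_derivative (b * (z - 1) * y powr (z - 2) - 1 / y)) (at y)" if "y > 0" for y
    unfolding g'_def [abs_def] using that
    by (auto intro!: derivative_eq_intros)
  have neg: "b * (z - 1) * y powr (z - 2) - 1 / y < 0" if "0 < y" "y < x0" for y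
  proof (cases "b = 0")
    case False
    \<comment> \<open>Multiplied by \<open>y\<close>, the convex part of the second derivative is
      increasing, so the bound at \<open>x0\<close> controls all smaller arguments.\<close>
    have "b * (z - 1) * y powr (z - 2) * y = b * (z - 1) * y powr (z - 1)"
      using that powr_add[of y "z - 2" 1] by simp
    also have "\<dots> < b * (z - 1) * x0 powr (z - 1)"
      using that z_gt_2 b False by (intro mult_strict_left_mono powr_less_mono2) auto
    finally show ?thesis using b that by (simp add: field_simps)
  qed (use that in auto)
  have dec: "g' y < g' w" if "0 < w" "w < y" "y \<le> x0" for w y
  proof (rule DERIV_neg_imp_decreasing_open[OF that(2)])
    show "\<exists>d. (g' has_real_derivative d) (at x) \<and> d < 0" if "w < x" "x < y" for x
      using der'[of x] neg[of x] that \<open>0 < w\<close> \<open>y \<le> x0\<close> by force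
    show "continuous_on {w..y} g'"
      using \<open>0 < w\<close> by (intro continuous_at_imp_continuous_on ballI DERIV_isCont[OF der']) auto
  qed
  have cont: "continuous_on {a..c} (site_fn b)" if "0 \<le> a" for a c
    by (rule continuous_on_subset[OF continuous_site_fn]) (use that in auto)
  have mvt: "\<exists>y. a < y \<and> y < c \<and> site_fn b c - site_fn b a = (c - a) * g' y"
    if "0 \<le> a" "a < c" for a c
  proof -
    have "\<exists>l y. a < y \<and> y < c \<and> (site_fn b has_real_derivative l) (at y)
        \<and> site_fn b c - site_fn b a = (c - a) * l"
      using that der cont by (intro MVT) (auto simp: real_differentiable_def intro!: exI der)
    then show ?thesis using der that DERIV_unique by (metis order_le_less_trans)
  qed
  show ?thesis
  proof (cases "x < m")
    case True
    then obtain y where y: "x < y" "y < m" "site_fn b m - site_fn b x = (m - x) * g' y"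
      using mvt x by blast
    then have "(m - x) * g' m < (m - x) * g' y"
      using True x m dec[of y m] by (intro mult_strict_left_mono) auto
    then show ?thesis using y(3) by (simp add: g'_def algebra_simps)
  next
    case False
    then obtain y where y: "m < y" "y < x" "site_fn b x - site_fn b m = (x - m) * g' y"
      using mvt[of m x] x m by auto
    then have "(x - m) * g' y < (x - m) * g' m"
      using False x m dec[of m y] by (intro mult_strict_left_mono) auto
    then show ?thesis using y(3) by (simp add: g'_def algebra_simps)
  qed
qed

text \<open>Sum the tangents at \<open>1 / r\<close>; the linear terms cancel. Read
  contrapositively, a vector that matches or beats the uniform one must have a coordinate above
  \<open>x0\<close>.\<close>

lemma functional_less_uniform:
  assumes u: "u \<in> prob_vectors r" and ne: "\<exists>i<r. u i \<noteq> 1 / r"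
    and le: "\<And>i. i < r \<Longrightarrow> u i \<le> x0" and x0: "1 / r \<le> x0"
    and b: "0 \<le> b" "b * (z - 1) * x0 powr (z - 1) \<le> 1"
  shows "F r b u < F r b (uniform r)"
proof -
  have r: "r > 0" using prob_vectorsD(4)[OF u] .
  let ?m = "1 / real r" let ?c = "b * ?m powr (z - 1) - ln ?m - 1"
  have *: "site_fn b (u i) < site_fn b ?m + ?c * (u i - ?m)" if "i < r" "u i \<noteq> ?m" for i
    using site_fn_tangent_strict[of ?m x0 "u i" b] r that x0 b le prob_vectorsD(1)[OF u] by auto
  have "(\<Sum>i<r. site_fn b (u i)) < (\<Sum>i<r. site_fn b ?m + ?c * (u i - ?m))"
  proof (rule sum_strict_mono_ex1)
    show "\<forall>i\<in>{..<r}. site_fn b (u i) \<le> site_fn b ?m + ?c * (u i - ?m)"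
    proof
      fix i assume "i \<in> {..<r}"
      then show "site_fn b (u i) \<le> site_fn b ?m + ?c * (u i - ?m)"
        using *[of i] by (cases "u i = ?m") (simp_all add: less_imp_le)
    qed
    show "\<exists>i\<in>{..<r}. site_fn b (u i) < site_fn b ?m + ?c * (u i - ?m)" using * ne by blast
  qed auto
  also have "(\<Sum>i<r. site_fn b ?m + ?c * (u i - ?m)) = (\<Sum>i<r. site_fn b ?m) + ?c * (\<Sum>i<r. u i - ?m)"
    by (simp add: sum.distrib sum_distrib_left)
  also have "(\<Sum>i<r. u i - ?m) = 0" using prob_vectorsD(2)[OF u] r by (simp add: sum_subtractf)
  finally show ?thesis by (simp add: functional_sum_site uniform_def)
qed

lemma functional_less_uniform_0:
  assumes "u \<in> prob_vectors r" "\<exists>i<r. u i \<noteq> 1 / r"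
  shows "F r 0 u < F r 0 (uniform r)"
  using prob_vectorsD(3,4)[OF assms(1)] by (intro functional_less_uniform[OF assms, of 1]) auto

end

section \<open>The critical inverse temperature\<close>

context potts_exponent begin

definition disordered :: "nat \<Rightarrow> real \<Rightarrow> bool" where
  "disordered r b \<longleftrightarrow> (\<forall>u\<in>prob_vectors r. (\<exists>i<r. u i \<noteq> 1 / r) \<longrightarrow> F r b u < F r b (uniform r))"

lemma beta_c_eq: "beta_c r z = Sup {b. 0 \<le> b \<and> disordered r b}"
  by (simp add: beta_c_def disordered_def uniform_def)

text \<open>Lowering \<open>b\<close> subtracts a multiple of \<open>power_sum\<close>, which is
  smallest at the uniform vector.\<close>

lemma disordered_downward:
  assumes "disordered r b'" "b \<le> b'"
  shows "disordered r b"
  unfolding disordered_def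
proof (intro ballI impI)
  fix u assume u: "u \<in> prob_vectors r" and ne: "\<exists>i<r. u i \<noteq> 1 / r"
  have "F r b' u < F r b' (uniform r)" using assms(1) u ne by (auto simp: disordered_def)
  moreover have "(b - b') / z * power_sum r u \<le> (b - b') / z * power_sum r (uniform r)"
    using power_sum_uniform_le[OF u] assms(2) z_gt_2
    by (intro mult_left_mono_neg) (auto simp: divide_nonpos_pos)
  ultimately show "F r b u < F r b (uniform r)"
    using functional_shift[of r b _ b'] by (metis add_less_le_mono)
qed

lemma disordered_0: "disordered r 0"
  using functional_less_uniform_0 by (auto simp: disordered_def)

text \<open>A point mass has value \<open>b / z\<close>, the uniform vector
  \<open>b / z * (1 / r) powr (z - 1) + ln r\<close>. The first has the larger slope in
  \<open>b\<close> and wins eventually, so the supremum defining \<open>beta_c\<close> is over a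
  bounded set.\<close>

lemma disordered_bdd:
  assumes "2 \<le> r"
  shows "bdd_above {b. 0 \<le> b \<and> disordered r b}"
proof -
  let ?c = "(1 / real r) powr (z - 1)"
  have "?c < 1 powr (z - 1)" using assms z_gt_2 by (intro powr_less_mono2) auto
  then have c: "?c < 1" by simp
  have "b \<le> z * ln r / (1 - ?c)" if "disordered r b" for b
  proof -
    define u where "u i = (if i = (0::nat) then 1 else 0 :: real)" for i
    have s: "(\<Sum>i<r. f (u i)) = f 1" if "f 0 = 0" for f :: "real \<Rightarrow> real"
    proof -
      have "(\<Sum>i<r. f (u i)) = (\<Sum>i<r. if i = 0 then f 1 else 0)"
        using that by (intro sum.cong) (auto simp: u_def)
      then show ?thesis using assms by (simp add: sum.delta)
    qed
    have "u \<in> prob_vectors r" using s[of "\<lambda>x. x"] by (auto simp: prob_vectors_def u_def)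
    moreover have "\<exists>i<r. u i \<noteq> 1 / r" using assms by (intro exI[of _ 0]) (auto simp: u_def)
    ultimately have "F r b u < F r b (uniform r)" using that by (simp add: disordered_def)
    moreover have "F r b u = b / z" using s[of "site_fn b"] by (simp add: functional_sum_site site_fn_def)
    ultimately have "b / z < b / z * ?c + ln r" using functional_uniform[of r b] assms by simp
    then have "b / z * (1 - ?c) < ln r" by (simp add: algebra_simps)
    then have "b * (1 - ?c) < z * ln r" using z_gt_2 by (simp add: field_simps)
    then show ?thesis using c by (simp add: pos_le_divide_eq)
  qed
  then show ?thesis by (auto simp: bdd_above_def)
qed

lemma beta_c_nonneg: "2 \<le> r \<Longrightarrow> 0 \<le> beta_c r z"
  unfolding beta_c_eq by (intro cSup_upper disordered_bdd) (simp_all add: disordered_0)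

lemma disordered_below_beta_c:
  assumes "2 \<le> r" "b < beta_c r z"
  shows "disordered r b"
proof -
  have "\<exists>b'\<in>{b. 0 \<le> b \<and> disordered r b}. b < b'"
    using assms disordered_0 disordered_bdd unfolding beta_c_eq by (intro less_cSupD) auto
  then show ?thesis using disordered_downward by auto
qed

lemma not_disordered_above_beta_c:
  assumes "2 \<le> r" "beta_c r z < b"
  shows "\<not> disordered r b"
proof
  assume "disordered r b"
  then have "b \<le> beta_c r z"
    unfolding beta_c_eq using assms beta_c_nonneg[of r]
    by (intro cSup_upper disordered_bdd) auto
  then show False using assms by simp
qed

text \<open>Homogeneity: total mass \<open>s\<close> turns \<open>b\<close> into
  \<open>b * s powr (z - 1)\<close>, and the remaining term is linear, hence sees only the total
  mass.\<close>

lemma site_fn_scale: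
  assumes "0 \<le> x" "0 < s"
  shows "site_fn b (s * x) = s * site_fn (b * s powr (z - 1)) x - ln s * (s * x)"
proof (cases "x = 0")
  case False
  then have "ln (s * x) = ln s + ln x" using assms by (simp add: ln_mult)
  moreover have "(s * x) powr z = s * s powr (z - 1) * x powr z"
    using assms by (simp add: powr_mult powr_split)
  ultimately show ?thesis by (simp add: site_fn_def algebra_simps)
qed (simp add: site_fn_def)

text \<open>Averaging a maximizer over any \<open>r\<close> of its coordinates amounts to an \<open>r\<close>-state problem at a
  lower inverse temperature, hence cannot decrease the functional.\<close>
lemma maximizer_locally_constant:
  assumes dis: "disordered r b" and b: "0 \<le> b"
    and m: "m \<in> maximizers r' b" and I: "I \<subseteq> {..<r'}" "card I = r" and ij: "i \<in> I" "j \<in> I"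
  shows "m i = m j"
proof -
  have mp: "m \<in> prob_vectors r'" using maximizersD(1)[OF m] .
  have fin: "finite I" using I(1) finite_subset by blast
  have r: "r > 0" using I(2) ij(1) fin card_gt_0_iff by blast
  have nn: "0 \<le> m k" if "k \<in> I" for k using prob_vectorsD(1)[OF mp] I(1) that by auto
  define s where "s = sum m I"
  have s0: "0 \<le> s" using nn by (auto simp: s_def intro: sum_nonneg)
  show ?thesis
  proof (cases "s = 0")
    case True
    then show ?thesis using sum_nonneg_eq_0_iff[OF fin] nn ij unfolding s_def by metis
  next
    case False
    then have s: "s > 0" using s0 by simp
    have "s \<le> (\<Sum>k<r'. m k)"
      unfolding s_def using I(1) prob_vectorsD(1)[OF mp] by (intro sum_mono2) auto
    then have s1: "s \<le> 1" using prob_vectorsD(2)[OF mp] by simp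
    let ?b = "b * s powr (z - 1)"
    have "s powr (z - 1) \<le> 1 powr (z - 1)" using s s1 z_gt_2 by (intro powr_mono2) auto
    then have "?b \<le> b" using b by (simp add: mult_left_le)
    then have dis': "disordered r ?b" using dis disordered_downward by blast
    obtain h where h: "bij_betw h {..<r} I"
      using I(2) fin ex_bij_betw_nat_finite[OF fin] by (auto simp: atLeast0LessThan)
    define w where "w k = m (h k) / s" for k
    have hI: "h k \<in> I" if "k < r" for k using h that by (auto simp: bij_betw_def)
    have reidx: "(\<Sum>k\<in>I. f k) = (\<Sum>k<r. f (h k))" for f :: "nat \<Rightarrow> real"
      using sum.reindex_bij_betw[OF h, of f] by simp
    have w: "w \<in> prob_vectors r"
      using s nn hI reidx[of m] by (auto simp: prob_vectors_def w_def s_def sum_divide_distrib[symmetric])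
    define m' where "m' k = (if k \<in> I then s / r else m k)" for k
    have split: "(\<Sum>k<r'. f k) = (\<Sum>k\<in>I. f k) + (\<Sum>k\<in>{..<r'} - I. f k)" for f :: "nat \<Rightarrow> real"
      using I(1) sum.subset_diff[of I "{..<r'}" f] by simp
    have m': "m' \<in> prob_vectors r'"
    proof -
      have "(\<Sum>k\<in>I. m' k) = (\<Sum>k\<in>I. s / r)" by (intro sum.cong) (auto simp: m'_def)
      then have "(\<Sum>k\<in>I. m' k) = s" using I(2) r by simp
      moreover have "(\<Sum>k\<in>{..<r'} - I. m' k) = (\<Sum>k\<in>{..<r'} - I. m k)"
        by (intro sum.cong) (auto simp: m'_def)
      ultimately have "(\<Sum>k<r'. m' k) = 1"
        using prob_vectorsD(2)[OF mp] unfolding split s_def by simp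
      moreover have "0 \<le> m' k" if "k < r'" for k
        using prob_vectorsD(1)[OF mp that] s by (simp add: m'_def)
      ultimately show ?thesis by (simp add: prob_vectors_def)
    qed
    have F1: "(\<Sum>k\<in>I. site_fn b (m k)) = s * F r ?b w - ln s * s"
    proof -
      have "(\<Sum>k\<in>I. site_fn b (m k)) = (\<Sum>k<r. site_fn b (s * w k))"
        using s by (simp add: reidx w_def)
      also have "\<dots> = (\<Sum>k<r. s * site_fn ?b (w k) - ln s * (s * w k))"
        using s prob_vectorsD(1)[OF w] by (intro sum.cong refl site_fn_scale) auto
      also have "\<dots> = s * F r ?b w - ln s * (s * (\<Sum>k<r. w k))"
        by (simp add: functional_sum_site sum_subtractf sum_distrib_left)
      finally show ?thesis using prob_vectorsD(2)[OF w] by simp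
    qed
    have F2: "(\<Sum>k\<in>I. site_fn b (m' k)) = s * F r ?b (uniform r) - ln s * s"
    proof -
      have "(\<Sum>k\<in>I. site_fn b (m' k)) = (\<Sum>k<r. site_fn b (s * uniform r k))"
        using I(2) by (simp add: m'_def uniform_def)
      also have "\<dots> = (\<Sum>k<r. s * site_fn ?b (uniform r k) - ln s * (s * uniform r k))"
        using s by (intro sum.cong refl site_fn_scale) (auto simp: uniform_def)
      also have "\<dots> = s * F r ?b (uniform r) - ln s * (s * (\<Sum>k<r. uniform r k))"
        by (simp add: functional_sum_site sum_subtractf sum_distrib_left)
      finally show ?thesis using prob_vectorsD(2)[OF uniform_prob[OF r]] by simp
    qed
    have "F r' b m' \<le> F r' b m" using maximizersD(2)[OF m m'] .
    moreover have "(\<Sum>k\<in>{..<r'} - I. site_fn b (m' k)) = (\<Sum>k\<in>{..<r'} - I. site_fn b (m k))"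
      by (intro sum.cong) (auto simp: m'_def)
    ultimately have "s * F r ?b (uniform r) \<le> s * F r ?b w"
      unfolding functional_sum_site[of r'] split using F1 F2 by linarith
    then have "F r ?b (uniform r) \<le> F r ?b w" using s mult_le_cancel_left_pos by blast
    then have wu: "w k = 1 / r" if "k < r" for k
      using dis' w that unfolding disordered_def by (meson not_le)
    have "m k = s / r" if kI: "k \<in> I" for k
    proof -
      obtain k' where "k' < r" "k = h k'" using bij_betw_imp_surj_on[OF h] kI by auto
      then show ?thesis using wu[of k'] s by (simp add: w_def field_simps)
    qed
    then show ?thesis using ij by simp
  qed
qed

text \<open>Any two coordinates lie in a common set of \<open>r\<close> coordinates, since
  \<open>2 \<le> r\<close>. So every maximizer is constant, and existence of a maximizer makes the
  uniform vector the strict winner.\<close>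

lemma disordered_mono:
  assumes "2 \<le> r" "r \<le> r'" "0 \<le> b" "disordered r b"
  shows "disordered r' b"
proof -
  have unif: "m k = 1 / r'" if m: "m \<in> maximizers r' b" and k: "k < r'" for m k
  proof -
    have mp: "m \<in> prob_vectors r'" using maximizersD(1)[OF m] .
    have "m i = m k" if i: "i < r'" for i
    proof -
      have "\<exists>I. {i, k} \<subseteq> I \<and> I \<subseteq> {..<r'} \<and> card I = r"
        using assms i k by (intro exists_subset_between) (auto simp: card_insert_if)
      then show ?thesis using maximizer_locally_constant[OF assms(4,3) m] by blast
    qed
    then have "(\<Sum>i<r'. m i) = (\<Sum>i<r'. m k)" by (intro sum.cong) auto
    then show ?thesis using prob_vectorsD(2,4)[OF mp] by (simp add: field_simps)
  qed
  have r': "r' > 0" using assms by simp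
  obtain m where m: "m \<in> maximizers r' b" using maximizers_nonempty[OF r'] .
  have "F r' b m = F r' b (uniform r')"
    using unif[OF m] by (simp add: functional_sum_site uniform_def)
  show ?thesis unfolding disordered_def
  proof (intro ballI impI)
    fix u assume u: "u \<in> prob_vectors r'" and ne: "\<exists>i<r'. u i \<noteq> 1 / r'"
    have "u \<notin> maximizers r' b" using unif ne by blast
    then obtain w where "w \<in> prob_vectors r'" "F r' b u < F r' b w"
      using u by (auto simp: maximizers_def not_le)
    then show "F r' b u < F r' b (uniform r')"
      using maximizersD(2)[OF m] \<open>F r' b m = F r' b (uniform r')\<close> by fastforce
  qed
qed

lemma beta_c_mono:
  assumes "2 \<le> r" "r \<le> r'"
  shows "beta_c r z \<le> beta_c r' z"
  unfolding beta_c_eq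
  using assms disordered_mono[OF assms] disordered_0
  by (intro cSup_subset_mono disordered_bdd) auto

lemma maximizers_disordered:
  assumes "disordered r b" "m \<in> maximizers r b" "i < r"
  shows "m i = 1 / r"
proof (rule ccontr)
  assume "m i \<noteq> 1 / r"
  then have "F r b m < F r b (uniform r)"
    using assms maximizersD(1) unfolding disordered_def by blast
  moreover have "r > 0" using assms(3) by simp
  ultimately show False using maximizersD(2)[OF assms(2) uniform_prob] by fastforce
qed

text \<open>For each fixed competitor the weak inequality is a closed condition on \<open>b\<close>,
  so it passes to the supremum. The uniform vector may share the maximum there.\<close>

lemma uniform_maximizer_beta_c:
  assumes "2 \<le> r"
  shows "uniform r \<in> maximizers r (beta_c r z)"
proof -
  have "F r (beta_c r z) u \<le> F r (beta_c r z) (uniform r)" if u: "u \<in> prob_vectors r" for u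
  proof -
    let ?A = "{b. F r b u \<le> F r b (uniform r)}"
    have "closed ?A"
      unfolding functional_eq by (intro closed_Collect_le continuous_intros) (use z_gt_2 in auto)
    moreover have "{b. 0 \<le> b \<and> disordered r b} \<subseteq> ?A"
    proof
      fix b assume "b \<in> {b. 0 \<le> b \<and> disordered r b}"
      then have d: "disordered r b" by simp
      show "b \<in> ?A"
      proof (cases "\<exists>i<r. u i \<noteq> 1 / r")
        case True
        then show ?thesis using d u by (auto simp: disordered_def)
      next
        case False
        then show ?thesis by (auto simp: functional_sum_site uniform_def intro!: eq_refl sum.cong)
      qed
    qed
    ultimately have "beta_c r z \<in> ?A"
      unfolding beta_c_eq using disordered_bdd[OF assms] disordered_0
      by (intro closed_subset_contains_Sup) auto
    then show ?thesis by simp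
  qed
  then show ?thesis using uniform_prob assms by (simp add: maximizers_def)
qed

end

text \<open>Iterated over successive derivatives that vanish at 0, this turns a sign of the highest
  one into strict growth of \<open>f\<close>, in place of a Taylor expansion with remainder.\<close>

lemma increasing_from_0:
  fixes f f' :: "real \<Rightarrow> real"
  assumes "\<And>x. 0 \<le> x \<Longrightarrow> x < e \<Longrightarrow> (f has_real_derivative f' x) (at x)"
    and "\<And>x. 0 < x \<Longrightarrow> x < e \<Longrightarrow> 0 < f' x" and "0 < h" "h < e"
  shows "f 0 < f h"
proof (rule DERIV_pos_imp_increasing_open[OF assms(3)])
  show "\<exists>y. (f has_real_derivative y) (at x) \<and> 0 < y" if "0 < x" "x < h" for x
    using assms that by (intro exI[of _ "f' x"]) auto
  show "continuous_on {0..h} f"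
  proof (intro continuous_at_imp_continuous_on ballI)
    fix x assume "x \<in> {0..h}"
    then have "(f has_real_derivative f' x) (at x)" using assms(1,4) by auto
    then show "isCont f x" by (rule DERIV_isCont)
  qed
qed

section \<open>Instability of the uniform vector and the first-order transition\<close>

context potts_exponent begin

text \<open>The value of \<open>b\<close> at which the uniform vector stops being a local maximizer.\<close>
definition spinodal :: "nat \<Rightarrow> real" where
  "spinodal r = real r powr (z - 1) / (z - 1)"

text \<open>At the spinodal the second derivative of the site function vanishes at
  \<open>1 / r\<close>, so the next nonzero order decides. For \<open>r \<ge> 3\<close> it is the
  cubic one, positive in the direction (2, -1, -1). For \<open>r = 2\<close> the odd orders cancel
  by symmetry and the quartic one is positive when \<open>z > 4\<close>; this is where admissibility
  comes from.\<close>

lemma spinodal_exceeds: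
  assumes "admissible_rz r z"
  shows "\<exists>u\<in>prob_vectors r. F r (spinodal r) (uniform r) < F r (spinodal r) u"
proof -
  let ?b = "spinodal r"
  define m where "m = 1 / real r"
  have r: "r \<ge> 2" using assms by (simp add: admissible_rz_def)
  have m: "m > 0" using r by (simp add: m_def)
  define g where "g = site_fn ?b"
  define g1 where "g1 x = ?b * x powr (z - 1) - ln x - 1" for x
  define g2 where "g2 x = ?b * (z - 1) * x powr (z - 2) - 1 / x" for x
  define g3 where "g3 x = ?b * (z - 1) * (z - 2) * x powr (z - 3) + 1 / x^2" for x
  define g4 where "g4 x = ?b * (z - 1) * (z - 2) * (z - 3) * x powr (z - 4) - 2 / x^3" for x
  have d1: "(g has_real_derivative g1 x) (at x)" if "x > 0" for x
    unfolding g_def g1_def site_fn_def [abs_def] using that z_gt_2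
    by (auto intro!: derivative_eq_intros)
  have d2: "(g1 has_real_derivative g2 x) (at x)" if "x > 0" for x
    unfolding g1_def [abs_def] g2_def using that by (auto intro!: derivative_eq_intros)
  have d3: "(g2 has_real_derivative g3 x) (at x)" if "x > 0" for x
    unfolding g2_def [abs_def] g3_def using that
    by (auto intro!: derivative_eq_intros simp: power2_eq_square)
  have d4: "(g3 has_real_derivative g4 x) (at x)" if "x > 0" for x
  proof -
    have "((\<lambda>x. 1 / x^2) has_real_derivative - (2 / x^3)) (at x)"
      using that by (auto intro!: derivative_eq_intros simp: field_simps eval_nat_numeral)
    moreover have "((\<lambda>x. ?b * (z - 1) * (z - 2) * x powr (z - 3)) has_real_derivative
        ?b * (z - 1) * (z - 2) * (z - 3) * x powr (z - 4)) (at x)"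
      using that by (auto intro!: derivative_eq_intros)
    ultimately show ?thesis
      unfolding g3_def [abs_def] g4_def by (auto dest: DERIV_add)
  qed
  have sh: "((\<lambda>h. f (m + c * h)) has_real_derivative c * f' (m + c * x)) (at x)"
    if "(f has_real_derivative f' (m + c * x)) (at (m + c * x))" for f f' c x
  proof -
    have "((\<lambda>h. m + c * h) has_real_derivative c) (at x)"
      by (auto intro!: derivative_eq_intros)
    from DERIV_chain2[OF that this] show ?thesis by (simp add: mult.commute)
  qed
  have mm: "?b * (z - 1) * m powr (z - 1) = 1"
    using z_gt_2 r by (simp add: spinodal_def m_def powr_divide)
  have pw: "m powr (z - 1) = m powr (z - 2) * m" "m powr (z - 1) = m powr (z - 4) * m ^ 3"
    using m powr_add[of m "z - 2" 1] powr_add[of m "z - 4" 3] powr_realpow[of m 3] by simp_all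
  have g2m: "g2 m = 0" using mm m unfolding pw(1) by (simp add: g2_def field_simps)
  have b0: "?b > 0" using z_gt_2 r by (simp add: spinodal_def)
  have g3m: "g3 m > 0" using b0 z_gt_2 m unfolding g3_def by (intro add_nonneg_pos) auto
  consider "r \<ge> 3" | "r = 2" "z > 4" using assms r by (force simp: admissible_rz_def)
  then show ?thesis
  proof cases
    case 1
    \<comment> \<open>The second derivative of \<open>f\<close> below; its own derivative at 0 is
      \<open>8 * g3 m - 2 * g3 m\<close>, which is positive.\<close>
    define f2 where "f2 h = 4 * g2 (m + 2 * h) + 2 * g2 (m + (-1) * h)" for h
    have "(f2 has_real_derivative (4 * (2 * g3 (m + 2 * 0)) + 2 * ((-1) * g3 (m + (-1) * 0)))) (at 0)"
      unfolding f2_def [abs_def] by (intro DERIV_add DERIV_cmult sh d3) (use m in auto)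
    then have "\<exists>d>0. \<forall>h>0. h < d \<longrightarrow> f2 0 < f2 (0 + h)"
      by (rule DERIV_pos_inc_right) (use g3m in simp)
    then obtain d where d: "d > 0" "\<And>h. 0 < h \<Longrightarrow> h < d \<Longrightarrow> f2 h > 0"
      using g2m by (auto simp: f2_def)
    define e where "e = min d m"
    define f1 where "f1 h = 2 * g1 (m + 2 * h) + (-2) * g1 (m + (-1) * h)" for h
    define f where "f h = g (m + 2 * h) + 2 * g (m + (-1) * h)" for h
    have D1: "(f1 has_real_derivative f2 x) (at x)" if "0 \<le> x" "x < e" for x
    proof -
      have "(f1 has_real_derivative (2 * (2 * g2 (m + 2 * x)) + (-2) * ((-1) * g2 (m + (-1) * x)))) (at x)"
        unfolding f1_def [abs_def] by (intro DERIV_add DERIV_cmult sh d2) (use that m in \<open>auto simp: e_def\<close>)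
      then show ?thesis by (simp add: f2_def)
    qed
    have D0: "(f has_real_derivative f1 x) (at x)" if "0 \<le> x" "x < e" for x
    proof -
      have "(f has_real_derivative (2 * g1 (m + 2 * x) + 2 * ((-1) * g1 (m + (-1) * x)))) (at x)"
        unfolding f_def [abs_def] by (intro DERIV_add DERIV_cmult sh d1) (use that m in \<open>auto simp: e_def\<close>)
      then show ?thesis by (simp add: f1_def)
    qed
    have f1pos: "0 < f1 x" if "0 < x" "x < e" for x
    proof -
      have "f1 0 < f1 x"
        by (rule increasing_from_0[where f' = f2 and e = e]) (use D1 d(2) that in \<open>auto simp: e_def\<close>)
      then show ?thesis by (simp add: f1_def)
    qed
    define h where "h = e / 2"
    have h: "0 < h" "h < e" "h < m" using d(1) m by (auto simp: h_def e_def)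
    have fh: "f 0 < f h"
      by (rule increasing_from_0[where f' = f1 and e = e]) (use D0 f1pos h in auto)
    define u where "u i = (if i = 0 then m + 2 * h else if i < 3 then m - h else m)" for i :: nat
    have split: "(\<Sum>i<r. k (u i)) = k (m + 2 * h) + 2 * k (m - h) + (real r - 3) * k m" for k :: "real \<Rightarrow> real"
    proof -
      have "{..<r} = {0,1,2} \<union> {3..<r}" using 1 by auto
      then have "(\<Sum>i<r. k (u i)) = (\<Sum>i\<in>{0,1,2}. k (u i)) + (\<Sum>i\<in>{3..<r}. k (u i))"
        by (simp only:, intro sum.union_disjoint) auto
      also have "(\<Sum>i\<in>{3..<r}. k (u i)) = (\<Sum>i\<in>{3..<r}. k m)" by (intro sum.cong) (auto simp: u_def)
      finally show ?thesis using 1 by (simp add: u_def of_nat_diff)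
    qed
    have "u \<in> prob_vectors r"
    proof -
      have "(\<Sum>i<r. u i) = real r * m" using split[of "\<lambda>x. x"] by (simp add: algebra_simps)
      moreover have "real r * m = 1" using r by (simp add: m_def)
      moreover have "0 \<le> u i" for i using h m by (simp add: u_def)
      ultimately show ?thesis by (simp add: prob_vectors_def)
    qed
    moreover have "F r ?b (uniform r) < F r ?b u"
    proof -
      have "F r ?b (uniform r) = real r * g m" by (simp add: functional_sum_site g_def uniform_def m_def)
      moreover have "F r ?b u = f h + (real r - 3) * g m"
        using split[of g] by (simp add: functional_sum_site g_def f_def)
      moreover have "f 0 = 3 * g m" by (simp add: f_def)
      ultimately show ?thesis using fh by (simp add: algebra_simps)
    qed
    ultimately show ?thesis by blast
  next
    case 2
    define f3 where "f3 h = g3 (m + 1 * h) + (-1) * g3 (m + (-1) * h)" for h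
    \<comment> \<open>By \<open>mm\<close>, \<open>g4 m * m ^ 3\<close> equals
      \<open>(z - 2) * (z - 3) - 2\<close>, which changes sign at \<open>z = 4\<close>.\<close>
    have "(z - 2) * (z - 3) > 2 * 1" using 2 by (intro mult_strict_mono) auto
    then have "(z - 2) * (z - 3) * (?b * (z - 1) * (m powr (z - 4) * m ^ 3)) - 2 > 0"
      using mm unfolding pw(2) by simp
    moreover have "g4 m * m ^ 3 = (z - 2) * (z - 3) * (?b * (z - 1) * (m powr (z - 4) * m ^ 3)) - 2"
      unfolding g4_def using m by (subst left_diff_distrib) (simp add: mult_ac)
    ultimately have "g4 m * m ^ 3 > 0" by simp
    then have g4m: "g4 m > 0" using m by (simp add: zero_less_mult_iff)
    have "(f3 has_real_derivative (1 * g4 (m + 1 * 0) + (-1) * ((-1) * g4 (m + (-1) * 0)))) (at 0)"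
      unfolding f3_def [abs_def] by (intro DERIV_add DERIV_cmult sh d4) (use m in auto)
    then have "\<exists>d>0. \<forall>h>0. h < d \<longrightarrow> f3 0 < f3 (0 + h)"
      by (rule DERIV_pos_inc_right) (use g4m in simp)
    then obtain d where d: "d > 0" "\<And>h. 0 < h \<Longrightarrow> h < d \<Longrightarrow> f3 h > 0"
      by (auto simp: f3_def)
    define e where "e = min d m"
    define f2 where "f2 h = g2 (m + 1 * h) + g2 (m + (-1) * h)" for h
    define f1 where "f1 h = g1 (m + 1 * h) + (-1) * g1 (m + (-1) * h)" for h
    define f where "f h = g (m + 1 * h) + g (m + (-1) * h)" for h
    have D2: "(f2 has_real_derivative f3 x) (at x)" if "0 \<le> x" "x < e" for x
    proof -
      have "(f2 has_real_derivative (1 * g3 (m + 1 * x) + (-1) * g3 (m + (-1) * x))) (at x)"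
        unfolding f2_def [abs_def] by (intro DERIV_add DERIV_cmult sh d3) (use that m in \<open>auto simp: e_def\<close>)
      then show ?thesis by (simp add: f3_def)
    qed
    have D1: "(f1 has_real_derivative f2 x) (at x)" if "0 \<le> x" "x < e" for x
    proof -
      have "(f1 has_real_derivative (1 * g2 (m + 1 * x) + (-1) * ((-1) * g2 (m + (-1) * x)))) (at x)"
        unfolding f1_def [abs_def] by (intro DERIV_add DERIV_cmult sh d2) (use that m in \<open>auto simp: e_def\<close>)
      then show ?thesis by (simp add: f2_def)
    qed
    have D0: "(f has_real_derivative f1 x) (at x)" if "0 \<le> x" "x < e" for x
    proof -
      have "(f has_real_derivative (1 * g1 (m + 1 * x) + (-1) * g1 (m + (-1) * x))) (at x)"
        unfolding f_def [abs_def] by (intro DERIV_add DERIV_cmult sh d1) (use that m in \<open>auto simp: e_def\<close>)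
      then show ?thesis by (simp add: f1_def)
    qed
    have f2pos: "0 < f2 x" if "0 < x" "x < e" for x
    proof -
      have "f2 0 < f2 x"
        by (rule increasing_from_0[where f' = f3 and e = e]) (use D2 d(2) that in \<open>auto simp: e_def\<close>)
      then show ?thesis using g2m by (simp add: f2_def)
    qed
    have f1pos: "0 < f1 x" if "0 < x" "x < e" for x
    proof -
      have "f1 0 < f1 x"
        by (rule increasing_from_0[where f' = f2 and e = e]) (use D1 f2pos that in auto)
      then show ?thesis by (simp add: f1_def)
    qed
    define h where "h = e / 2"
    have h: "0 < h" "h < e" "h < m" using d(1) m by (auto simp: h_def e_def)
    have fh: "f 0 < f h"
      by (rule increasing_from_0[where f' = f1 and e = e]) (use D0 f1pos h in auto)
    define u where "u i = (if i = 0 then m + h else m - h)" for i :: nat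
    have split: "(\<Sum>i<r. k (u i)) = k (m + h) + k (m - h)" for k :: "real \<Rightarrow> real"
      using 2 by (simp add: u_def numeral_2_eq_2)
    have "u \<in> prob_vectors r"
    proof -
      have "(\<Sum>i<r. u i) = 1" using split[of "\<lambda>x. x"] 2 by (simp add: m_def)
      moreover have "0 \<le> u i" for i using h m by (simp add: u_def)
      ultimately show ?thesis by (simp add: prob_vectors_def)
    qed
    moreover have "F r ?b (uniform r) < F r ?b u"
    proof -
      have "F r ?b (uniform r) = f 0" using 2 by (simp add: functional_sum_site g_def uniform_def m_def f_def)
      moreover have "F r ?b u = f h"
        using split[of g] by (simp add: functional_sum_site g_def f_def)
      ultimately show ?thesis using fh by simp
    qed
    ultimately show ?thesis by blast
  qed
qed

text \<open>The vector that wins strictly at the spinodal still wins slightly below it, by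
  continuity in \<open>b\<close>; hence the strict inequality.\<close>

lemma beta_c_less_spinodal:
  assumes "admissible_rz r z"
  shows "beta_c r z < spinodal r"
proof -
  have r: "r \<ge> 2" using assms by (simp add: admissible_rz_def)
  obtain u where u: "u \<in> prob_vectors r" "F r (spinodal r) (uniform r) < F r (spinodal r) u"
    using spinodal_exceeds[OF assms] by blast
  let ?D = "\<lambda>b. F r b u - F r b (uniform r)"
  have "continuous (at_left (spinodal r)) ?D"
    unfolding functional_eq by (intro continuous_intros) (use z_gt_2 in auto)
  then have "eventually (\<lambda>b. ?D b > 0) (at_left (spinodal r))"
    using u(2) by (intro order_tendstoD(1)[where y = "?D (spinodal r)"]) (auto simp: continuous_within)
  then obtain b where b: "b < spinodal r" "?D b > 0"
    by (auto simp: eventually_at_left_field dest: dense)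
  have "\<exists>i<r. u i \<noteq> 1 / r"
  proof (rule ccontr)
    assume "\<not> ?thesis"
    then have "F r b u = F r b (uniform r)"
      by (auto simp: functional_sum_site uniform_def intro!: sum.cong)
    then show False using b(2) by simp
  qed
  then have "\<not> disordered r b" using u(1) b(2) by (auto simp: disordered_def not_less)
  then show ?thesis using disordered_below_beta_c[OF r, of b] b(1) by (meson linorder_not_less order.strict_trans1)
qed

lemma seq_closedD:
  assumes "seq_closed r E" "\<And>n. v n \<in> prob_vectors r" "\<And>n. v n \<in> E"
    "\<And>i. i < r \<Longrightarrow> (\<lambda>n. v n i) \<longlonglongrightarrow> u i"
  shows "u \<in> E"
  using assms unfolding seq_closed_def by blast

lemma seq_closed_above: "seq_closed r {u. \<exists>i<r. c \<le> u i}"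
  unfolding seq_closed_def
proof (intro allI impI)
  fix v u assume v: "\<forall>n. v n \<in> prob_vectors r \<and> v n \<in> {u. \<exists>i<r. c \<le> u i}"
    and lim: "\<forall>i<r. (\<lambda>n. v n i) \<longlonglongrightarrow> u i"
  show "u \<in> {u. \<exists>i<r. c \<le> u i}"
  proof (rule ccontr)
    assume "\<not> ?thesis"
    then have c: "u i < c" if "i < r" for i using that by (simp add: not_le)
    have "\<forall>i\<in>{..<r}. eventually (\<lambda>n. v n i < c) sequentially"
    proof
      fix i assume "i \<in> {..<r}"
      then have i: "i < r" by simp
      show "eventually (\<lambda>n. v n i < c) sequentially"
        using order_tendstoD(2)[OF lim[rule_format, OF i] c[OF i]] .
    qed
    then have "eventually (\<lambda>n. \<forall>i\<in>{..<r}. v n i < c) sequentially"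
      by (rule eventually_ball_finite[OF finite_lessThan])
    then obtain n where "\<forall>i\<in>{..<r}. v n i < c" by (auto simp: eventually_sequentially)
    moreover obtain i where "i < r" "c \<le> v n i" using v by blast
    ultimately show False by (metis lessThan_iff not_le)
  qed
qed

text \<open>For \<open>b\<close> slightly above \<open>beta_c\<close> some vector matches or beats
  the uniform one, and by concavity it has a coordinate above a fixed \<open>x0\<close>. Compactness
  as \<open>b\<close> decreases to \<open>beta_c\<close> yields a maximizer there with the same
  property. The second bound on \<open>x0\<close> is the local stability later needed for the
  Gaussian estimate.\<close>

lemma first_order_transition:
  assumes "admissible_rz r z"
  obtains x0 where "1 / r < x0" "beta_c r z * (z - 1) * x0 powr (z - 1) < 1"
    "\<exists>m\<in>maximizers r (beta_c r z). \<exists>i<r. x0 \<le> m i"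
proof -
  have r: "r \<ge> 2" using assms by (simp add: admissible_rz_def)
  let ?bc = "beta_c r z"
  obtain b1 where b1: "?bc < b1" "b1 < spinodal r" using beta_c_less_spinodal[OF assms] dense by blast
  have b10: "b1 > 0" using b1 beta_c_nonneg[OF r] by simp
  \<comment> \<open>The edge of the concave range at \<open>b1\<close>. It exceeds
    \<open>1 / r\<close> because \<open>b1\<close> lies below the spinodal, and one
    \<open>x0\<close> works for all \<open>b \<le> b1\<close>.\<close>
  define x0 where "x0 = (1 / (b1 * (z - 1))) powr (1 / (z - 1))"
  have x0p: "x0 powr (z - 1) = 1 / (b1 * (z - 1))"
    using z_gt_2 b10 by (simp add: x0_def powr_powr)
  have "b1 * (z - 1) < real r powr (z - 1)"
    using b1(2) z_gt_2 by (simp add: spinodal_def pos_less_divide_eq)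
  then have "(1 / r) powr (z - 1) < x0 powr (z - 1)"
    unfolding x0p using r b10 z_gt_2 by (simp add: powr_divide frac_less2)
  moreover have "0 \<le> x0" by (simp add: x0_def)
  ultimately have x0: "1 / r < x0"
    using powr_mono2[of "z - 1" x0 "1 / r"] z_gt_2 by (meson diff_ge_0_iff_ge linorder_not_le one_le_numeral order_trans less_imp_le)
  have x0b: "b * (z - 1) * x0 powr (z - 1) \<le> 1" if "b \<le> b1" for b
    unfolding x0p using that b10 z_gt_2 by (simp add: divide_le_eq_1)
  have x0c: "?bc * (z - 1) * x0 powr (z - 1) < 1"
    unfolding x0p using b1(1) b10 z_gt_2 by (simp add: divide_less_eq_1)
  define bs where "bs n = ?bc + (b1 - ?bc) * inverse (real (Suc n))" for n
  have bs: "?bc < bs n" "bs n \<le> b1" for n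
  proof -
    show "?bc < bs n" using b1(1) by (simp add: bs_def)
    have "(b1 - ?bc) * inverse (real (Suc n)) \<le> (b1 - ?bc) * 1"
      using b1(1) by (intro mult_left_mono) (auto simp: inverse_le_1_iff)
    then show "bs n \<le> b1" by (simp add: bs_def)
  qed
  have "bs \<longlonglongrightarrow> ?bc + (b1 - ?bc) * 0"
    unfolding bs_def by (intro tendsto_intros LIMSEQ_inverse_real_of_nat)
  then have bslim: "bs \<longlonglongrightarrow> ?bc" by simp
  have "\<exists>u\<in>prob_vectors r. (\<exists>i<r. x0 \<le> u i) \<and> F r (bs n) (uniform r) \<le> F r (bs n) u" for n
  proof -
    obtain u where u: "u \<in> prob_vectors r" "\<exists>i<r. u i \<noteq> 1 / r" "F r (bs n) (uniform r) \<le> F r (bs n) u"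
      using not_disordered_above_beta_c[OF r bs(1)[of n]] unfolding disordered_def by (auto simp: not_less)
    have "\<exists>i<r. x0 \<le> u i"
    proof (rule ccontr)
      assume "\<not> ?thesis"
      then have "F r (bs n) u < F r (bs n) (uniform r)"
        using x0 x0b[OF bs(2)] bs(1)[of n] beta_c_nonneg[OF r]
        by (intro functional_less_uniform[OF u(1,2), of x0]) (auto simp: not_le less_imp_le)
      then show False using u(3) by simp
    qed
    then show ?thesis using u by blast
  qed
  then obtain v where v: "\<And>n. v n \<in> prob_vectors r" "\<And>n. \<exists>i<r. x0 \<le> v n i"
    "\<And>n. F r (bs n) (uniform r) \<le> F r (bs n) (v n)" by metis
  obtain s u where s: "strict_mono (s::nat\<Rightarrow>nat)" "\<And>i. i < r \<Longrightarrow> (\<lambda>n. v (s n) i) \<longlonglongrightarrow> u i"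
    "u \<in> prob_vectors r" using prob_vectors_subseq[of v r] v(1) by blast
  have bss: "(\<lambda>n. bs (s n)) \<longlonglongrightarrow> ?bc" using LIMSEQ_subseq_LIMSEQ[OF bslim s(1)] by (simp add: o_def)
  have "u \<in> {u. \<exists>i<r. x0 \<le> u i}"
    by (rule seq_closedD[OF seq_closed_above, of "\<lambda>n. v (s n)"]) (use v s(2) in auto)
  then have ui: "\<exists>i<r. x0 \<le> u i" by simp
  have "F r ?bc (uniform r) \<le> F r ?bc u"
  proof (rule LIMSEQ_le)
    show "(\<lambda>n. F r (bs (s n)) (uniform r)) \<longlonglongrightarrow> F r ?bc (uniform r)"
      by (rule tendsto_functional) (use uniform_prob r bss in auto)
    show "(\<lambda>n. F r (bs (s n)) (v (s n))) \<longlonglongrightarrow> F r ?bc u"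
      by (rule tendsto_functional) (use s v bss in auto)
  qed (use v in blast)
  then have "u \<in> maximizers r ?bc"
    using uniform_maximizer_beta_c[OF r] s(3) by (auto simp: maximizers_def intro: order_trans)
  then show ?thesis using that[OF x0 x0c] ui by blast
qed

text \<open>At \<open>b = 0\<close> only the entropy is left, whose maximizer is unique; an ordered
  maximizer cannot coexist there.\<close>

lemma beta_c_pos:
  assumes "admissible_rz r z"
  shows "0 < beta_c r z"
proof (rule ccontr)
  assume *: "\<not> ?thesis"
  have "r \<ge> 2" using assms by (simp add: admissible_rz_def)
  then have 0: "beta_c r z = 0" using * beta_c_nonneg[of r] by simp
  obtain x0 m i where "1 / r < x0" "m \<in> maximizers r 0" "i < r" "x0 \<le> m i"
    using first_order_transition[OF assms] unfolding 0 by metis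
  then show False using maximizers_disordered[OF disordered_0] by fastforce
qed

end

section \<open>Two states with exponent at most four\<close>

context potts_exponent begin

lemma sinh_gt_self:
  assumes "0 < t"
  shows "t < sinh (t::real)"
proof -
  have "sinh 0 - 0 < sinh t - t"
  proof (rule increasing_from_0[where f = "\<lambda>t. sinh t - t" and f' = "\<lambda>t. cosh t - 1" and e = "t + 1"])
    show "((\<lambda>t. sinh t - t) has_real_derivative cosh x - 1) (at x)" for x :: real
      by (auto intro!: derivative_eq_intros)
    show "0 < cosh x - 1" if "0 < x" for x :: real
      using cosh_real_strict_mono[of 0 x] that by simp
  qed (use assms in auto)
  then show ?thesis by simp
qed

text \<open>In other words sinh (c t) / c increases in c; the derivative in \<open>t\<close> reduces
  this to monotonicity of \<open>cosh\<close>.\<close>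

lemma sinh_ratio:
  assumes "1 < a" "0 < t"
  shows "a * sinh ((a - 1) * t) < (a - 1) * sinh (a * (t::real))"
proof -
  let ?f = "\<lambda>t. (a - 1) * sinh (a * t) - a * sinh ((a - 1) * t)"
  have "?f 0 < ?f t"
  proof (rule increasing_from_0[where f' = "\<lambda>t. a * (a - 1) * (cosh (a * t) - cosh ((a - 1) * t))" and e = "t + 1"])
    show "(?f has_real_derivative a * (a - 1) * (cosh (a * x) - cosh ((a - 1) * x))) (at x)" for x
      by (auto intro!: derivative_eq_intros simp: algebra_simps)
    show "0 < a * (a - 1) * (cosh (a * x) - cosh ((a - 1) * x))" if "0 < x" for x
      using cosh_real_strict_mono[of "(a-1) * x" "a * x"] that assms by simp
  qed (use assms in auto)
  then show ?thesis by simp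
qed

text \<open>Up to a positive factor the difference is the derivative in
  \<open>ln_quotient_increasing\<close>. The bound \<open>a \<le> 3\<close>, that is
  \<open>z \<le> 4\<close>, enters as \<open>(a - 1) * (a - 1) \<le> a + 1\<close>.\<close>

lemma sinh_cosh_ineq:
  assumes "1 < a" "a \<le> 3" "0 < t"
  shows "a * t * cosh ((a - 1) * t) < sinh (a * t) * cosh (t::real)"
proof -
  let ?f = "\<lambda>t. sinh (a * t) * cosh t - a * t * cosh ((a - 1) * t)"
  let ?f' = "\<lambda>t. (a + 1) * (sinh (a * t) * sinh t) - a * (a - 1) * t * sinh ((a - 1) * t)"
  have "?f 0 < ?f t"
  proof (rule increasing_from_0[where f' = ?f' and e = "t + 1"])
    show "(?f has_real_derivative ?f' x) (at x)" for x
    proof -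
      have c: "cosh ((a - 1) * x) = cosh (a * x) * cosh x - sinh (a * x) * sinh x"
        using cosh_diff[of "a * x" x] by (simp add: left_diff_distrib)
      have "(?f has_real_derivative a * cosh (a * x) * cosh x + sinh (a * x) * sinh x
          - (a * cosh ((a - 1) * x) + a * x * ((a - 1) * sinh ((a - 1) * x)))) (at x)"
        by (auto intro!: derivative_eq_intros)
      moreover have "a * cosh (a * x) * cosh x + sinh (a * x) * sinh x
          - (a * cosh ((a - 1) * x) + a * x * ((a - 1) * sinh ((a - 1) * x))) = ?f' x"
        unfolding c by (simp add: algebra_simps)
      ultimately show ?thesis by simp
    qed
    fix x :: real assume x: "0 < x"
    have s: "sinh ((a - 1) * x) > 0" using x assms by simp
    have "(a - 1) * (a - 1) \<le> a + 1"
    proof -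
      have "0 \<le> a * (3 - a)" using assms by simp
      then show ?thesis by (simp add: algebra_simps)
    qed
    then have "(a - 1) * (a - 1) * (a * (x * sinh ((a - 1) * x)))
        \<le> (a + 1) * (a * (x * sinh ((a - 1) * x)))"
      using s x assms by (intro mult_right_mono) auto
    also have "\<dots> = (a + 1) * (x * (a * sinh ((a - 1) * x)))" by simp
    also have "\<dots> < (a + 1) * (sinh x * ((a - 1) * sinh (a * x)))"
    proof (rule mult_strict_left_mono[OF mult_strict_mono])
      show "x < sinh x" "a * sinh ((a - 1) * x) < (a - 1) * sinh (a * x)"
        using sinh_gt_self[OF x] sinh_ratio[OF assms(1) x] .
      show "0 < sinh x" using x by simp
      show "0 \<le> a * sinh ((a - 1) * x)" using s assms(1) by (intro mult_nonneg_nonneg) auto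
    qed (use assms(1) in auto)
    finally have "(a - 1) * (a * (a - 1) * x * sinh ((a - 1) * x))
        < (a - 1) * ((a + 1) * (sinh (a * x) * sinh x))" by (simp add: mult_ac)
    then show "0 < ?f' x" using assms by simp
  qed (use assms in auto)
  then show ?thesis by simp
qed

text \<open>The logarithm of t cosh(t)^a / sinh(a t). Its derivative times
  \<open>x * cosh x * sinh (a * x)\<close> is the difference estimated in
  \<open>sinh_cosh_ineq\<close>.\<close>

lemma ln_quotient_increasing:
  assumes "1 < a" "a \<le> 3" "0 < s" "s < (t::real)"
  shows "ln s + a * ln (cosh s) - ln (sinh (a * s)) < ln t + a * ln (cosh t) - ln (sinh (a * t))"
proof (rule DERIV_pos_imp_increasing[OF assms(4)])
  fix x assume "s \<le> x" "x \<le> t"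
  then have x: "0 < x" using assms by simp
  have sh: "sinh (a * x) > 0" using x assms by simp
  have ch: "cosh x > 0" by (rule cosh_real_pos)
  let ?d = "1 / x + a * (sinh x / cosh x) - a * cosh (a * x) / sinh (a * x)"
  have "((\<lambda>x. ln x + a * ln (cosh x) - ln (sinh (a * x))) has_real_derivative ?d) (at x)"
    using x sh ch by (auto intro!: derivative_eq_intros simp: mult_ac)
  moreover have "?d > 0"
  proof -
    have c: "cosh ((a - 1) * x) = cosh (a * x) * cosh x - sinh (a * x) * sinh x"
      using cosh_diff[of "a * x" x] by (simp add: left_diff_distrib)
    have "?d * (x * cosh x * sinh (a * x)) = sinh (a * x) * cosh x
        - a * x * (cosh (a * x) * cosh x - sinh (a * x) * sinh x)"
      using x sh ch by (simp add: field_simps)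
    then have "?d * (x * cosh x * sinh (a * x)) = sinh (a * x) * cosh x - a * x * cosh ((a - 1) * x)"
      unfolding c .
    then have "?d * (x * cosh x * sinh (a * x)) > 0" using sinh_cosh_ineq[OF assms(1,2) x] by simp
    moreover have "x * cosh x * sinh (a * x) > 0" using x sh ch by simp
    ultimately show ?thesis using zero_less_mult_pos2 by blast
  qed
  ultimately show "\<exists>y. ((\<lambda>x. ln x + a * ln (cosh x) - ln (sinh (a * x))) has_real_derivative y) (at x) \<and> 0 < y"
    by blast
qed

text \<open>Substitute x = tanh t, so that (1 + x) / 2 and (1 - x) / 2 become exp(t) and exp(-t)
  over 2 cosh t. With \<open>kf\<close> the quotient of the preceding lemma, the slope is positive
  exactly when \<open>kf t < b * 2 powr - a\<close>. Since \<open>kf\<close> increases, a zero at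
  \<open>w\<close> forces a positive slope at every smaller positive \<open>x\<close>.\<close>

lemma two_state_slope_sign:
  assumes z4: "z \<le> 4" and x: "0 < x" "x < w" "w < 1"
    and w0: "b * (((1 + w) / 2) powr (z - 1) - ((1 - w) / 2) powr (z - 1)) = ln ((1 + w) / 2) - ln ((1 - w) / 2)"
  shows "ln ((1 + x) / 2) - ln ((1 - x) / 2) < b * (((1 + x) / 2) powr (z - 1) - ((1 - x) / 2) powr (z - 1))"
proof -
  define a where "a = z - 1"
  have a: "1 < a" "a \<le> 3" using z4 z_gt_2 by (auto simp: a_def)
  define t where "t y = (ln ((1 + y) / 2) - ln ((1 - y) / 2)) / 2" for y :: real
  have tpos: "0 < t y" if "0 < y" "y < 1" for y using that by (simp add: t_def)
  have tmono: "t x < t w"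
    unfolding t_def using x by (intro divide_strict_right_mono diff_strict_mono) auto
  have E: "((1 + y) / 2) powr a - ((1 - y) / 2) powr a = 2 * sinh (a * t y) / (2 * cosh (t y)) powr a"
    if "0 < y" "y < 1" for y
  proof -
    define s where "s = (ln ((1 + y) / 2) + ln ((1 - y) / 2)) / 2"
    have e: "exp (s + t y) = (1 + y) / 2" "exp (s - t y) = (1 - y) / 2"
      using that by (simp_all add: s_def t_def add_divide_distrib[symmetric] diff_divide_distrib[symmetric])
    have l: "ln ((1 + y) / 2) = s + t y" "ln ((1 - y) / 2) = s - t y"
      by (auto simp: s_def t_def field_simps)
    have "exp s * (2 * cosh (t y)) = exp (s + t y) + exp (s - t y)"
      by (simp add: cosh_def exp_add exp_diff exp_minus field_simps)
    also have "\<dots> = 1" unfolding e by (simp add: field_simps)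
    finally have "2 * cosh (t y) = exp (- s)" by (simp add: exp_minus field_simps)
    then have h1: "(2 * cosh (t y)) powr a = exp (- (a * s))" by (simp add: powr_def)
    have h2: "((1 + y) / 2) powr a - ((1 - y) / 2) powr a = exp (a * (s + t y)) - exp (a * (s - t y))"
      using that unfolding powr_def l by simp
    have h3: "exp (a * (s + t y)) - exp (a * (s - t y)) = exp (a * s) * (2 * sinh (a * t y))"
      by (simp add: sinh_def exp_add exp_diff exp_minus distrib_left right_diff_distrib divide_simps)
    show ?thesis unfolding h1 h2 h3 exp_minus by (simp only: divide_inverse inverse_inverse_eq mult.commute)
  qed
  define kf where "kf s = exp (ln s + a * ln (cosh s) - ln (sinh (a * s)))" for s
  have K: "b * (((1 + y) / 2) powr a - ((1 - y) / 2) powr a) = 2 * t y * (b * 2 powr - a / kf (t y))"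
    if "0 < y" "y < 1" for y
  proof -
    have ty: "t y > 0" "sinh (a * t y) > 0" "cosh (t y) > 0"
      using tpos[OF that] a(1) by (simp_all add: cosh_real_pos)
    have "exp (a * ln (cosh (t y))) = cosh (t y) powr a" using ty(3) by (simp add: powr_def)
    then have ex: "kf (t y) = t y * cosh (t y) powr a / sinh (a * t y)"
      using ty(1,2) by (simp add: kf_def exp_diff exp_add)
    have "(2 * cosh (t y)) powr a = 2 powr a * cosh (t y) powr a" using ty(3) by (simp add: powr_mult)
    then show ?thesis
      unfolding E[OF that] ex using ty by (simp add: powr_minus divide_inverse)
  qed
  have w1: "0 < w" "w < 1" "x < 1" using x by auto
  have "2 * t w * (b * 2 powr - a / kf (t w)) = 2 * t w"
    using w0 K[OF w1(1,2)] unfolding a_def[symmetric] by (simp add: t_def)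
  then have one: "b * 2 powr - a = kf (t w)"
    using tpos[OF w1(1,2)] by (simp add: kf_def field_simps)
  have "kf (t x) < b * 2 powr - a"
    unfolding one kf_def using ln_quotient_increasing[OF a tpos[OF x(1) w1(3)] tmono] by simp
  then have "1 < b * 2 powr - a / kf (t x)"
    by (simp add: kf_def less_divide_eq)
  then have "2 * t x * 1 < 2 * t x * (b * 2 powr - a / kf (t x))"
    using tpos[OF x(1) w1(3)] by (intro mult_strict_left_mono) auto
  then have "2 * t x < b * (((1 + x) / 2) powr a - ((1 - x) / 2) powr a)"
    using K[OF x(1) w1(3)] by simp
  then show ?thesis by (simp add: t_def a_def)
qed

definition two_state_fn :: "real \<Rightarrow> real \<Rightarrow> real" where
  "two_state_fn b x = site_fn b ((1 + x) / 2) + site_fn b ((1 - x) / 2)"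

text \<open>Rolle gives a critical point \<open>y\<close> strictly between two points of equal
  value. The function then increases strictly from \<open>x\<close> to \<open>y\<close>, against
  maximality of \<open>x\<close>.\<close>

lemma two_state_max_unique:
  assumes z4: "z \<le> 4" and x: "0 \<le> x" "x < w" "w \<le> 1"
    and mx: "\<And>y. 0 \<le> y \<Longrightarrow> y \<le> 1 \<Longrightarrow> two_state_fn b y \<le> two_state_fn b x"
    and eq: "two_state_fn b x = two_state_fn b w"
  shows False
proof -
  define d where "d y = (b * (((1 + y) / 2) powr (z - 1) - ((1 - y) / 2) powr (z - 1))
      - (ln ((1 + y) / 2) - ln ((1 - y) / 2))) / 2" for y
  have der: "(two_state_fn b has_real_derivative d y) (at y)" if "0 < y" "y < 1" for y
  proof -
    define g' where "g' v = b * v powr (z - 1) - ln v - 1" for v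
    have sd: "(site_fn b has_real_derivative g' v) (at v)" if "v > 0" for v
      unfolding site_fn_def [abs_def] g'_def using that z_gt_2
      by (auto intro!: derivative_eq_intros)
    have "((\<lambda>y. site_fn b ((1 + y) / 2)) has_real_derivative g' ((1 + y) / 2) * (1 / 2)) (at y)"
      by (rule DERIV_chain2[OF sd]) (use that in \<open>auto intro!: derivative_eq_intros\<close>)
    moreover have "((\<lambda>y. site_fn b ((1 - y) / 2)) has_real_derivative g' ((1 - y) / 2) * (- 1 / 2)) (at y)"
      by (rule DERIV_chain2[OF sd]) (use that in \<open>auto intro!: derivative_eq_intros\<close>)
    ultimately have "(two_state_fn b has_real_derivative
        g' ((1 + y) / 2) * (1 / 2) + g' ((1 - y) / 2) * (- 1 / 2)) (at y)"
      unfolding two_state_fn_def [abs_def] by (rule DERIV_add)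
    moreover have "g' ((1 + y) / 2) * (1 / 2) + g' ((1 - y) / 2) * (- 1 / 2) = d y"
      by (simp add: g'_def d_def algebra_simps add_divide_distrib diff_divide_distrib)
    ultimately show ?thesis by simp
  qed
  have cont: "continuous_on {0..1} (two_state_fn b)"
    unfolding two_state_fn_def [abs_def]
    by (intro continuous_intros continuous_on_compose2[OF continuous_site_fn]) auto
  have "\<exists>y>x. y < w \<and> d y = 0"
  proof -
    have "\<exists>y>x. y < w \<and> (\<lambda>v. d y * v) = (\<lambda>v. 0)"
    proof (rule Rolle_deriv[OF x(2) eq])
      show "continuous_on {x..w} (two_state_fn b)" by (rule continuous_on_subset[OF cont]) (use x in auto)
      show "(two_state_fn b has_derivative (\<lambda>v. d y * v)) (at y)" if "x < y" "y < w" for y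
        using der[of y] that x by (simp add: has_field_derivative_def)
    qed
    then show ?thesis by (metis mult.right_neutral)
  qed
  then obtain y where y: "x < y" "y < w" "d y = 0" by blast
  have "two_state_fn b x < two_state_fn b y"
  proof (rule DERIV_pos_imp_increasing_open[OF y(1)])
    show "continuous_on {x..y} (two_state_fn b)" by (rule continuous_on_subset[OF cont]) (use x y in auto)
    fix v assume v: "x < v" "v < y"
    have "ln ((1 + v) / 2) - ln ((1 - v) / 2) < b * (((1 + v) / 2) powr (z - 1) - ((1 - v) / 2) powr (z - 1))"
      using y v x by (intro two_state_slope_sign[OF z4, of v y]) (auto simp: d_def)
    then show "\<exists>l. (two_state_fn b has_real_derivative l) (at v) \<and> 0 < l"
      using v x y der[of v] by (intro exI[of _ "d v"]) (auto simp: d_def)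
  qed
  then show False using mx[of y] x y by simp
qed

text \<open>Up to a swap, which does not affect symmetric sums, a two-state vector is determined by
  \<open>\<bar>u 0 - u 1\<bar>\<close>.\<close>

lemma two_state_field_sum_unique:
  assumes z4: "z \<le> 4" and m: "m \<in> maximizers 2 b" "m' \<in> maximizers 2 b"
  shows "field_sum 2 b m = field_sum 2 b m'"
proof -
  define x where "x u = \<bar>u 0 - u 1\<bar>" for u :: "nat \<Rightarrow> real"
  have two: "(\<Sum>i<2. f (u i)) = f ((1 + x u) / 2) + f ((1 - x u) / 2)" "0 \<le> x u" "x u \<le> 1"
    if "u \<in> prob_vectors 2" for u and f :: "real \<Rightarrow> real"
  proof -
    have s: "u 0 + u 1 = 1" "0 \<le> u 0" "0 \<le> u 1"
      using prob_vectorsD(1,2)[OF that] by (auto simp: numeral_2_eq_2)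
    show "0 \<le> x u" "x u \<le> 1" using s by (auto simp: x_def)
    have "u 0 = (1 + x u) / 2 \<and> u 1 = (1 - x u) / 2 \<or> u 1 = (1 + x u) / 2 \<and> u 0 = (1 - x u) / 2"
      using s by (auto simp: x_def abs_if field_simps)
    moreover have "(\<Sum>i<2. f (u i)) = f (u 0) + f (u 1)" by (simp add: numeral_2_eq_2)
    ultimately show "(\<Sum>i<2. f (u i)) = f ((1 + x u) / 2) + f ((1 - x u) / 2)"
      by (metis add.commute)
  qed
  have mx: "two_state_fn b y \<le> two_state_fn b (x u)" if u: "u \<in> maximizers 2 b" and y: "0 \<le> y" "y \<le> 1" for u y
  proof -
    define v where "v i = (if i = (0::nat) then (1 + y) / 2 else (1 - y) / 2)" for i
    have "v \<in> prob_vectors 2" using y by (auto simp: prob_vectors_def v_def numeral_2_eq_2 field_simps)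
    from maximizersD(2)[OF u this] two(1)[OF maximizersD(1)[OF u], of "site_fn b"]
    show ?thesis by (simp add: functional_sum_site two_state_fn_def v_def numeral_2_eq_2)
  qed
  have mp: "m \<in> prob_vectors 2" "m' \<in> prob_vectors 2" using m maximizersD(1) by blast+
  have "two_state_fn b (x m) = two_state_fn b (x m')"
    using mx[OF m(1), of "x m'"] mx[OF m(2), of "x m"] two(2,3)[OF mp(1)] two(2,3)[OF mp(2)] by auto
  then have "x m = x m'"
    using two_state_max_unique[OF z4, of "x m" "x m'" b] two_state_max_unique[OF z4, of "x m'" "x m" b]
      mx[OF m(1)] mx[OF m(2)] two(2,3)[OF mp(1)] two(2,3)[OF mp(2)] by (metis linorder_neqE_linordered_idom)
  then show ?thesis
    using two(1)[OF mp(1), of "\<lambda>v. exp (b * v powr (z - 1))"] two(1)[OF mp(2), of "\<lambda>v. exp (b * v powr (z - 1))"]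
    by (simp add: field_sum_def)
qed

end

section \<open>Configuration sums and concentration\<close>

definition lists_of :: "'a set \<Rightarrow> nat \<Rightarrow> 'a list set" where
  "lists_of A n = {xs. set xs \<subseteq> A \<and> length xs = n}"

lemma finite_lists_of [simp]: "finite A \<Longrightarrow> finite (lists_of A n)"
  unfolding lists_of_def by (rule finite_lists_length_eq)

lemma lists_of_0 [simp]: "lists_of A 0 = {[]}"
  by (auto simp: lists_of_def)

lemma sum_lists_of_Suc:
  "(\<Sum>xs\<in>lists_of A (Suc n). g xs) = (\<Sum>a\<in>A. \<Sum>xs\<in>lists_of A n. g (a # xs))"
proof -
  have "lists_of A (Suc n) = (\<lambda>(a, xs). a # xs) ` (A \<times> lists_of A n)"
    by (auto simp: lists_of_def length_Suc_conv image_def)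
  then have "(\<Sum>xs\<in>lists_of A (Suc n). g xs) = (\<Sum>(a, xs)\<in>A \<times> lists_of A n. g (a # xs))"
    by (simp add: sum.reindex inj_on_def case_prod_unfold)
  then show ?thesis by (simp add: sum.cartesian_product)
qed

lemma sum_prod_lists_of:
  fixes f :: "'a \<Rightarrow> 'b::comm_semiring_1"
  shows "(\<Sum>xs\<in>lists_of A n. prod_list (map f xs)) = (\<Sum>a\<in>A. f a) ^ n"
  by (induction n) (simp_all add: sum_lists_of_Suc sum_distrib_left[symmetric] sum_distrib_right[symmetric])

lemma emp_count: "emp xs a = real (count_list xs a) / real (length xs)"
proof -
  have "length (filter (\<lambda>b. b = a) xs) = count_list xs a" by (induction xs) auto
  then show ?thesis by (simp add: emp_def)
qed

lemma count_eq_emp: "xs \<noteq> [] \<Longrightarrow> real (count_list xs a) = real (length xs) * emp xs a"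
  by (simp add: emp_count)

lemma sum_list_emp:
  fixes f :: "'a \<Rightarrow> real"
  assumes "set xs \<subseteq> A" "finite A" "xs \<noteq> []"
  shows "sum_list (map f xs) = real (length xs) * (\<Sum>a\<in>A. emp xs a * f a)"
proof -
  have "sum_list (map f xs) = (\<Sum>a\<in>A. real (count_list xs a) * f a)"
    using assms(1)
  proof (induction xs)
    case (Cons x xs)
    have "(\<Sum>a\<in>A. real (count_list (x # xs) a) * f a)
        = (\<Sum>a\<in>A. (if x = a then f a else 0) + real (count_list xs a) * f a)"
      by (intro sum.cong) (auto simp: algebra_simps)
    also have "\<dots> = f x + (\<Sum>a\<in>A. real (count_list xs a) * f a)"
      using Cons.prems assms(2) by (simp add: sum.distrib sum.delta)
    finally show ?case using Cons by simp
  qed simp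
  then show ?thesis using assms(3) by (simp add: sum_distrib_left count_eq_emp mult.assoc)
qed

lemma prod_list_exp: "prod_list (map (\<lambda>x. exp (f x)) xs) = exp (sum_list (map f xs) :: real)"
  by (induction xs) (auto simp: exp_add)

lemma emp_prob_vectors:
  assumes "set xs \<subseteq> {..<r}" "xs \<noteq> []"
  shows "emp xs \<in> prob_vectors r"
  using sum_list_emp[OF assms(1) _ assms(2), of "\<lambda>_. 1"] assms(2)
  by (auto simp: prob_vectors_def emp_count sum_list_triv)

section \<open>Exponential bounds by types and by linearization\<close>

context potts_exponent begin

abbreviation configs :: "nat \<Rightarrow> nat \<Rightarrow> nat list set" where
  "configs r n \<equiv> lists_of {..<r} n"

definition config_weight :: "nat \<Rightarrow> real \<Rightarrow> nat list \<Rightarrow> real" where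
  "config_weight r b xs = exp (real (length xs) * b / z * power_sum r (emp xs))"

definition partition_fn :: "nat \<Rightarrow> nat \<Rightarrow> real \<Rightarrow> real" where
  "partition_fn r n b = (\<Sum>xs\<in>configs r n. config_weight r b xs)"

definition partial_sum :: "nat \<Rightarrow> nat \<Rightarrow> real \<Rightarrow> (nat \<Rightarrow> real) set \<Rightarrow> real" where
  "partial_sum r n b E = (\<Sum>xs\<in>{xs \<in> configs r n. emp xs \<in> E}. config_weight r b xs)"

lemma config_weight_pos: "0 < config_weight r b xs"
  by (simp add: config_weight_def)

lemma partial_sum_nonneg: "0 \<le> partial_sum r n b E"
  unfolding partial_sum_def by (intro sum_nonneg) (simp add: config_weight_pos less_imp_le)

lemma partial_sum_compl: "partial_sum r n b E + partial_sum r n b (- E) = partition_fn r n b"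
proof -
  have "configs r n = {xs \<in> configs r n. emp xs \<in> E} \<union> {xs \<in> configs r n. emp xs \<in> - E}"
    by auto
  then show ?thesis
    unfolding partial_sum_def partition_fn_def
    by (subst (3) \<open>configs r n = _\<close>) (intro sum.union_disjoint[symmetric]; force)
qed

text \<open>The weight of a configuration is \<open>exp (n * F)\<close> at its type times its probability under the
  product measure of that type, so every type contributes at most \<open>exp (n * F)\<close>.\<close>
lemma config_weight_eq:
  assumes "set xs \<subseteq> {..<r}" "xs \<noteq> []"
  shows "config_weight r b xs = exp (real (length xs) * F r b (emp xs)) * prod_list (map (emp xs) xs)"
proof -
  have pos: "emp xs x > 0" if "x \<in> set xs" for x
  proof -
    have "count_list xs x \<noteq> 0" using that by (simp add: count_list_0_iff)
    then show ?thesis using assms(2) by (simp add: emp_count)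
  qed
  have "prod_list (map (emp xs) xs) = prod_list (map (\<lambda>x. exp (ln (emp xs x))) xs)"
    using pos by (intro arg_cong[where f = prod_list]) (auto intro: map_cong)
  also have "\<dots> = exp (sum_list (map (\<lambda>x. ln (emp xs x)) xs))" by (rule prod_list_exp)
  also have "sum_list (map (\<lambda>x. ln (emp xs x)) xs) = real (length xs) * (\<Sum>i<r. emp xs i * ln (emp xs i))"
    using sum_list_emp[OF assms(1) _ assms(2)] by simp
  finally show ?thesis
    by (simp add: config_weight_def functional_eq flip: exp_add) (simp add: algebra_simps)
qed

text \<open>A type is determined by its \<open>r\<close> counts, each between 0 and
  \<open>n\<close>. Only polynomial growth of this number matters.\<close>

lemma card_types_le: "card (emp ` configs r n) \<le> (n + 1) ^ r"
proof -
  have "emp ` configs r n \<subseteq> (\<lambda>c i. if i < r then real (c i) / real n else 0) ` ({..<r} \<rightarrow>\<^sub>E {..n})"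
  proof (clarify, rule image_eqI)
    fix xs assume xs: "xs \<in> configs r n"
    show "restrict (count_list xs) {..<r} \<in> {..<r} \<rightarrow>\<^sub>E {..n}"
      using xs count_le_length by (auto simp: lists_of_def)
    show "emp xs = (\<lambda>i. if i < r then real (restrict (count_list xs) {..<r} i) / real n else 0)"
    proof
      fix i
      show "emp xs i = (if i < r then real (restrict (count_list xs) {..<r} i) / real n else 0)"
      proof (cases "i < r")
        case False
        then have "i \<notin> set xs" using xs by (auto simp: lists_of_def)
        then show ?thesis using False by (simp add: emp_count count_list_0_iff)
      qed (use xs in \<open>simp add: emp_count lists_of_def\<close>)
    qed
  qed
  then have "card (emp ` configs r n)
      \<le> card ((\<lambda>c i. if i < r then real (c i) / real n else 0) ` ({..<r} \<rightarrow>\<^sub>E {..n}))"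
    by (intro card_mono finite_imageI finite_PiE) auto
  also have "\<dots> \<le> card ({..<r} \<rightarrow>\<^sub>E {..n})" by (intro card_image_le finite_PiE) auto
  finally show ?thesis by (simp add: card_PiE)
qed

lemma partial_sum_le:
  assumes "n > 0" and M: "\<And>u. u \<in> prob_vectors r \<Longrightarrow> u \<in> E \<Longrightarrow> F r b u \<le> M"
  shows "partial_sum r n b E \<le> real (n + 1) ^ r * exp (real n * M)"
proof -
  let ?L = "configs r n" let ?V = "emp ` ?L"
  have emp: "emp xs \<in> prob_vectors r" "xs \<noteq> []" "set xs \<subseteq> {..<r}" "length xs = n" if "xs \<in> ?L" for xs
    using that assms(1) emp_prob_vectors[of xs r] by (auto simp: lists_of_def)
  have nn: "0 \<le> prod_list (map v xs)" if "v \<in> ?V" for v :: "nat \<Rightarrow> real" and xs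
  proof -
    have "0 \<le> v i" for i using that by (auto simp: emp_count)
    then show ?thesis by (induction xs) auto
  qed
  have "config_weight r b xs \<le> exp (real n * M) * (\<Sum>v\<in>?V. prod_list (map v xs))"
    if "xs \<in> ?L" "emp xs \<in> E" for xs
  proof -
    \<comment> \<open>The product measure of the configuration's own type is dominated by the sum
      over all types. After exchanging sums each product measure contributes total mass 1, so only
      the number of types remains.\<close>
    have "prod_list (map (emp xs) xs) \<le> (\<Sum>v\<in>?V. prod_list (map v xs))"
      using that nn by (intro member_le_sum[of "emp xs" ?V "\<lambda>v. prod_list (map v xs)"]) auto
    moreover have "real n * F r b (emp xs) \<le> real n * M"
      using M[OF emp(1)[OF that(1)] that(2)] by (intro mult_left_mono) auto
    ultimately show ?thesis
      using emp(2-4)[OF that(1)] nn[of "emp xs" xs] that by (subst config_weight_eq) (auto intro!: mult_mono)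
  qed
  then have "partial_sum r n b E \<le> (\<Sum>xs\<in>{xs \<in> ?L. emp xs \<in> E}. exp (real n * M) * (\<Sum>v\<in>?V. prod_list (map v xs)))"
    unfolding partial_sum_def by (intro sum_mono) auto
  also have "\<dots> \<le> (\<Sum>xs\<in>?L. exp (real n * M) * (\<Sum>v\<in>?V. prod_list (map v xs)))"
    using nn by (intro sum_mono2) (auto intro!: mult_nonneg_nonneg sum_nonneg)
  also have "\<dots> = exp (real n * M) * (\<Sum>v\<in>?V. \<Sum>xs\<in>?L. prod_list (map v xs))"
    by (subst sum.swap) (simp add: sum_distrib_left)
  also have "\<dots> = exp (real n * M) * real (card ?V)"
  proof -
    have "(\<Sum>v\<in>?V. \<Sum>xs\<in>?L. prod_list (map v xs)) = (\<Sum>v\<in>?V. 1)"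
      using prob_vectorsD(2)[OF emp(1)] by (intro sum.cong refl) (auto simp: sum_prod_lists_of)
    then show ?thesis by simp
  qed
  also have "\<dots> \<le> exp (real n * M) * real ((n + 1) ^ r)"
    using card_types_le[of r n] by (intro mult_left_mono) (simp_all only: of_nat_le_iff exp_ge_zero)
  finally show ?thesis by (simp add: mult.commute)
qed

text \<open>Replacing the power sum by its tangent at \<open>m\<close> lowers the weights and makes
  the sum factorize into \<open>field_sum r b m ^ n\<close>. The bound carries no polynomial
  prefactor, which is essential for the comparison at \<open>beta_c\<close>.\<close>

lemma partition_fn_ge:
  assumes "n > 0" "0 \<le> b" and m: "m \<in> prob_vectors r"
  shows "exp (real n * F r b m) \<le> partition_fn r n b"
proof -
  let ?L = "configs r n"
  let ?c = "exp (- (real n * (b * (1 - 1 / z) * power_sum r m)))"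
  have "?c * prod_list (map (\<lambda>i. exp (b * m i powr (z - 1))) xs) \<le> config_weight r b xs" if "xs \<in> ?L" for xs
  proof -
    have xs: "set xs \<subseteq> {..<r}" "xs \<noteq> []" "length xs = n" using that assms(1) by (auto simp: lists_of_def)
    have "b / z * (z * (\<Sum>i<r. emp xs i * m i powr (z - 1)) - (z - 1) * power_sum r m) \<le> b / z * power_sum r (emp xs)"
      using assms(2) z_gt_2 by (intro mult_left_mono power_sum_tangent m emp_prob_vectors xs) auto
    moreover have "b / z * (z * A - (z - 1) * B) = b * A - b * (1 - 1 / z) * B" for A B
      using z_gt_2 by (simp add: field_simps)
    ultimately have "real n * (b * (\<Sum>i<r. emp xs i * m i powr (z - 1)) - b * (1 - 1 / z) * power_sum r m)
        \<le> real n * (b / z * power_sum r (emp xs))"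
      by (intro mult_left_mono) auto
    moreover have "sum_list (map (\<lambda>i. b * m i powr (z - 1)) xs) = real n * (b * (\<Sum>i<r. emp xs i * m i powr (z - 1)))"
      using sum_list_emp[OF xs(1) _ xs(2)] xs(3) by (simp add: sum_distrib_left mult_ac)
    ultimately show ?thesis
      unfolding prod_list_exp config_weight_def xs(3) exp_add[symmetric] by (simp add: algebra_simps)
  qed
  then have "(\<Sum>xs\<in>?L. ?c * prod_list (map (\<lambda>i. exp (b * m i powr (z - 1))) xs)) \<le> partition_fn r n b"
    unfolding partition_fn_def by (intro sum_mono)
  also have "(\<Sum>xs\<in>?L. ?c * prod_list (map (\<lambda>i. exp (b * m i powr (z - 1))) xs)) = ?c * field_sum r b m ^ n"
    by (simp add: sum_distrib_left[symmetric] sum_prod_lists_of field_sum_def)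
  also have "field_sum r b m ^ n = exp (real n * ln (field_sum r b m))"
    using field_sum_pos[OF prob_vectorsD(4)[OF m]] by (simp add: exp_of_nat_mult)
  also have "?c * exp (real n * ln (field_sum r b m)) = exp (real n * gibbs_bound r b m)"
    by (simp add: gibbs_bound_def algebra_simps flip: exp_add)
  finally have "exp (real n * gibbs_bound r b m) \<le> partition_fn r n b" .
  moreover have "real n * F r b m \<le> real n * gibbs_bound r b m"
    using functional_le_gibbs_bound[OF m] by (intro mult_left_mono) auto
  ultimately show ?thesis by (meson exp_le_cancel_iff order_trans)
qed

lemma partition_fn_pos: "r > 0 \<Longrightarrow> 0 < partition_fn r n b"
proof -
  assume "r > 0"
  then have "replicate n 0 \<in> configs r n" by (auto simp: lists_of_def)
  then show ?thesis unfolding partition_fn_def by (intro sum_pos) (auto simp: config_weight_pos)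
qed

lemma poly_times_exp_decay:
  assumes "0 < c"
  shows "(\<lambda>n. real (n + 1) ^ r * exp (- c * real n)) \<longlonglongrightarrow> 0"
proof -
  have f: "filterlim (\<lambda>n. c * (1 + real n)) at_top sequentially"
    using assms by (intro filterlim_tendsto_pos_mult_at_top[of _ c] tendsto_const
        filterlim_tendsto_add_at_top[of _ 1] filterlim_real_sequentially) auto
  have "(\<lambda>n. (c * (1 + real n)) ^ r / exp (c * (1 + real n))) \<longlonglongrightarrow> 0"
    using filterlim_compose[OF tendsto_power_div_exp_0 f] .
  then have "(\<lambda>n. exp c / c ^ r * ((c * (1 + real n)) ^ r / exp (c * (1 + real n)))) \<longlonglongrightarrow> exp c / c ^ r * 0"
    by (intro tendsto_intros)
  moreover have "exp c / c ^ r * ((c * (1 + real n)) ^ r / exp (c * (1 + real n)))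
      = real (n + 1) ^ r * exp (- c * real n)" for n
  proof -
    have "exp (c * (1 + real n)) = exp c * exp (c * real n)" by (simp add: distrib_left exp_add)
    then show ?thesis
      using assms unfolding power_mult_distrib by (simp add: exp_minus divide_simps add.commute)
  qed
  ultimately show ?thesis by simp
qed

text \<open>On a closed set without maximizers the functional stays a fixed distance below its
  maximum, and the exponential gain beats the number of types. Letting the inverse temperature vary
  with \<open>k\<close> accommodates class fractions that only converge.\<close>

lemma concentration:
  assumes bs: "bs \<longlonglongrightarrow> b" "\<And>k. 0 \<le> bs k" and ns: "filterlim ns at_top sequentially"
    and E: "seq_closed r E" "E \<inter> maximizers r b = {}" and r: "r > 0"
  shows "(\<lambda>k. partial_sum r (ns k) (bs k) E / partition_fn r (ns k) (bs k)) \<longlonglongrightarrow> 0"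
proof (cases "E \<inter> prob_vectors r = {}")
  case True
  have "eventually (\<lambda>k. ns k > 0) sequentially"
    using ns[unfolded filterlim_at_top, rule_format, of 1] by (simp add: Suc_le_eq)
  then have "eventually (\<lambda>k. partial_sum r (ns k) (bs k) E / partition_fn r (ns k) (bs k) = 0) sequentially"
  proof eventually_elim
    case (elim k)
    then have "{xs \<in> configs r (ns k). emp xs \<in> E} = {}"
      using True emp_prob_vectors[of _ r] by (force simp: lists_of_def)
    then show ?case by (simp only: partial_sum_def sum.empty)
  qed
  then show ?thesis by (rule tendsto_eventually)
next
  case False
  obtain v where v: "v \<in> E" "v \<in> prob_vectors r" "\<And>u. u \<in> E \<Longrightarrow> u \<in> prob_vectors r \<Longrightarrow> F r b u \<le> F r b v"
    using functional_attains_max[OF E(1) False, of b] by blast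
  obtain m where m: "m \<in> maximizers r b" using maximizers_nonempty[OF r] .
  have mp: "m \<in> prob_vectors r" using maximizersD(1)[OF m] .
  have "F r b v < F r b m"
  proof (rule ccontr)
    assume "\<not> ?thesis"
    then have "v \<in> maximizers r b" using m v(2) by (auto simp: maximizers_def not_less intro: order_trans)
    then show False using E(2) v(1) by blast
  qed
  \<comment> \<open>One third of the gap pays for replacing \<open>b\<close> by \<open>bs k\<close>
    on \<open>E\<close>, one third for doing so at \<open>m\<close>, and the last third is the decay
    rate.\<close>
  define c where "c = (F r b m - F r b v) / 3"
  have c: "c > 0" using \<open>F r b v < F r b m\<close> by (simp add: c_def)
  have ps: "\<bar>F r (bs k) u - F r b u\<bar> \<le> \<bar>bs k - b\<bar>" if "u \<in> prob_vectors r" for k u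
  proof -
    have "\<bar>F r (bs k) u - F r b u\<bar> = \<bar>bs k - b\<bar> / z * power_sum r u"
      using functional_shift[of r "bs k" u b] z_gt_2 power_sum_nonneg[of r u] by (simp add: abs_mult)
    also have "\<dots> \<le> \<bar>bs k - b\<bar> / z * 1"
      using power_sum_le_1[OF that] z_gt_2 by (intro mult_left_mono) auto
    also have "\<dots> \<le> \<bar>bs k - b\<bar>" using z_gt_2 by (simp add: divide_le_eq mult_le_cancel_left1)
    finally show ?thesis .
  qed
  have ev: "eventually (\<lambda>k. \<bar>bs k - b\<bar> < c \<and> ns k > 0) sequentially"
    using tendstoD[OF bs(1) c] ns[unfolded filterlim_at_top, rule_format, of 1]
    by (intro eventually_conj) (simp_all add: dist_real_def Suc_le_eq)
  have lim: "(\<lambda>k. real (ns k + 1) ^ r * exp (- c * real (ns k))) \<longlonglongrightarrow> 0"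
    using filterlim_compose[OF poly_times_exp_decay[OF c] ns] .
  show ?thesis
  proof (rule tendsto_sandwich[OF _ _ tendsto_const lim])
    show "eventually (\<lambda>k. 0 \<le> partial_sum r (ns k) (bs k) E / partition_fn r (ns k) (bs k)) sequentially"
      using partial_sum_nonneg partition_fn_pos[OF r] by (intro always_eventually allI divide_nonneg_pos)
    show "eventually (\<lambda>k. partial_sum r (ns k) (bs k) E / partition_fn r (ns k) (bs k)
        \<le> real (ns k + 1) ^ r * exp (- c * real (ns k))) sequentially"
      using ev
    proof eventually_elim
      case (elim k)
      let ?n = "real (ns k)"
      have "partial_sum r (ns k) (bs k) E \<le> real (ns k + 1) ^ r * exp (?n * (F r b v + c))"
        using elim ps[of _ k] v(3) by (intro partial_sum_le) (fastforce)+
      also have "?n * (F r b v + c) = ?n * (F r b m - c) + - c * ?n"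
        by (simp add: c_def field_simps)
      also have "real (ns k + 1) ^ r * exp \<dots> = real (ns k + 1) ^ r * exp (- c * ?n) * exp (?n * (F r b m - c))"
        by (simp add: mult.assoc flip: exp_add)
      also have "exp (?n * (F r b m - c)) \<le> partition_fn r (ns k) (bs k)"
      proof -
        have "?n * (F r b m - c) \<le> ?n * F r (bs k) m"
          using ps[OF mp, of k] elim by (intro mult_left_mono) auto
        then have "exp (?n * (F r b m - c)) \<le> exp (?n * F r (bs k) m)" by simp
        also have "\<dots> \<le> partition_fn r (ns k) (bs k)"
          using elim bs(2) mp by (intro partition_fn_ge) auto
        finally show ?thesis .
      qed
      finally have "partial_sum r (ns k) (bs k) E
          \<le> real (ns k + 1) ^ r * exp (- c * ?n) * partition_fn r (ns k) (bs k)"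
        by (simp add: mult_left_mono)
      then show ?case using partition_fn_pos[OF r] by (simp add: pos_divide_le_eq)
    qed
  qed
qed

section \<open>Sums over a single class and their spin ratios\<close>

definition class_sum :: "nat set \<Rightarrow> real \<Rightarrow> nat \<Rightarrow> real" where
  "class_sum A c n = (\<Sum>xs\<in>lists_of A n. exp (c * (\<Sum>i\<in>A. real (count_list xs i) powr z)))"

text \<open>Writing \<open>N * beta / z * (k / N) powr z\<close> as
  \<open>coupling beta N * k powr z\<close> puts the exponent in terms of counts. The classes then
  interact only through the total number \<open>N\<close> of sites.\<close>

definition coupling :: "real \<Rightarrow> nat \<Rightarrow> real" where
  "coupling beta N = beta / z * real N powr (1 - z)"

text \<open>The factor gained by adding one spin \<open>j\<close>, summed over \<open>j\<close>; its
  average over configurations of the class is the spin ratio.\<close>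

definition growth :: "nat \<Rightarrow> real \<Rightarrow> nat list \<Rightarrow> real" where
  "growth r c xs = (\<Sum>j<r. exp (c * (real (count_list xs j + 1) powr z - real (count_list xs j) powr z)))"

text \<open>\<open>N\<close> counts all sites including the added one, \<open>n\<close> the
  conditioning sites in the class. Numerator and denominator share the coupling for
  \<open>N\<close>.\<close>

definition spin_ratio :: "nat \<Rightarrow> real \<Rightarrow> nat \<Rightarrow> nat \<Rightarrow> real" where
  "spin_ratio r beta N n =
     class_sum {..<r} (coupling beta N) (Suc n) / class_sum {..<r} (coupling beta N) n"

abbreviation count_weight :: "nat \<Rightarrow> real \<Rightarrow> nat list \<Rightarrow> real" where
  "count_weight r c xs \<equiv> exp (c * (\<Sum>i<r. real (count_list xs i) powr z))"

abbreviation type_prob :: "nat \<Rightarrow> real \<Rightarrow> nat \<Rightarrow> (nat \<Rightarrow> real) set \<Rightarrow> real" where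
  "type_prob r c n E \<equiv> (\<Sum>xs\<in>{xs \<in> configs r n. emp xs \<in> E}. count_weight r c xs)
     / (\<Sum>xs\<in>configs r n. count_weight r c xs)"

lemma class_sum_Suc:
  "class_sum {..<r} c (Suc n) =
     (\<Sum>xs\<in>configs r n. count_weight r c xs * growth r c xs)"
proof -
  have "exp (c * (\<Sum>i<r. real (count_list (j # xs) i) powr z)) =
      count_weight r c xs *
      exp (c * (real (count_list xs j + 1) powr z - real (count_list xs j) powr z))" if "j < r" for j xs
  proof -
    have "(\<Sum>i<r. real (count_list (j # xs) i) powr z) = (\<Sum>i<r. real (count_list xs i) powr z
        + (if j = i then real (count_list xs j + 1) powr z - real (count_list xs j) powr z else 0))"
      by (intro sum.cong) auto
    also have "\<dots> = (\<Sum>i<r. real (count_list xs i) powr z)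
        + (real (count_list xs j + 1) powr z - real (count_list xs j) powr z)"
      using that by (simp add: sum.distrib sum.delta)
    finally show ?thesis by (simp only: distrib_left exp_add)
  qed
  then have "class_sum {..<r} c (Suc n) = (\<Sum>j<r. \<Sum>xs\<in>configs r n.
      count_weight r c xs *
      exp (c * (real (count_list xs j + 1) powr z - real (count_list xs j) powr z)))"
    unfolding class_sum_def sum_lists_of_Suc by (intro sum.cong refl) blast
  also have "\<dots> = (\<Sum>xs\<in>configs r n. count_weight r c xs * growth r c xs)"
    by (subst sum.swap) (simp add: growth_def sum_distrib_left)
  finally show ?thesis .
qed

text \<open>Because \<open>N powr (1 - z) * n powr z\<close> is
  \<open>n * (n / N) powr (z - 1)\<close>, a class holding \<open>n\<close> of \<open>N\<close>
  sites behaves like a Potts model on \<open>n\<close> sites with a lowered inverse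
  temperature.\<close>

lemma coupling_weight:
  assumes "xs \<in> configs r n" "n > 0" "N > 0"
  shows "count_weight r (coupling beta N) xs
    = config_weight r (beta * (real n / real N) powr (z - 1)) xs"
proof -
  have len: "length xs = n" "xs \<noteq> []" using assms by (auto simp: lists_of_def)
  have "(\<Sum>i<r. real (count_list xs i) powr z) = real n powr z * power_sum r (emp xs)"
    unfolding power_sum_def count_eq_emp[OF len(2)] len(1) sum_distrib_left
    by (intro sum.cong refl powr_mult)
  moreover have "real n powr z = real n powr (z - 1) * real n" by (rule powr_split) simp
  moreover have "real N powr (1 - z) = 1 / real N powr (z - 1)"
    using powr_minus_divide[of "real N" "z - 1"] by simp
  ultimately show ?thesis
    using assms by (simp add: config_weight_def len coupling_def powr_divide mult_ac)
qed

lemma class_sum_pos: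
  assumes "finite A" "A \<noteq> {}"
  shows "0 < class_sum A c n"
proof -
  obtain a where "a \<in> A" using assms(2) by blast
  then have "replicate n a \<in> lists_of A n" by (auto simp: lists_of_def)
  then show ?thesis unfolding class_sum_def using assms(1) by (intro sum_pos) auto
qed

text \<open>A unit increment of a convex function lies between its slopes at the two
  endpoints.\<close>

lemma growth_term_bounds:
  assumes "0 \<le> beta" "N > 0"
  shows "beta * (real c / real N) powr (z - 1) \<le> coupling beta N * (real (c + 1) powr z - real c powr z)"
    and "coupling beta N * (real (c + 1) powr z - real c powr z) \<le> beta * (real (c + 1) / real N) powr (z - 1)"
proof -
  have N: "real N powr (1 - z) = 1 / real N powr (z - 1)"
    using powr_minus_divide[of "real N" "z - 1"] by simp
  have eq: "beta * (real d / real N) powr (z - 1) = coupling beta N * (z * real d powr (z - 1))" for d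
    using z_gt_2 by (simp add: coupling_def N powr_divide)
  have "0 \<le> coupling beta N" using assms z_gt_2 by (simp add: coupling_def)
  moreover have "z * real c powr (z - 1) \<le> real (c + 1) powr z - real c powr z"
    using powr_tangent[of "real c" "real (c + 1)"] by simp
  moreover have "real (c + 1) powr z - real c powr z \<le> z * real (c + 1) powr (z - 1)"
    using powr_tangent[of "real (c + 1)" "real c"] by simp
  ultimately show "beta * (real c / real N) powr (z - 1) \<le> coupling beta N * (real (c + 1) powr z - real c powr z)"
    "coupling beta N * (real (c + 1) powr z - real c powr z) \<le> beta * (real (c + 1) / real N) powr (z - 1)"
    unfolding eq by (auto intro: mult_left_mono)
qed

text \<open>Each term lies between \<open>h\<close> at \<open>c / N\<close> and at
  \<open>(c + 1) / N\<close>, and \<open>h\<close> is uniformly continuous on the unit interval, so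
  the estimate is uniform over all configurations. \<open>ns k < Ns k\<close> keeps
  \<open>(c + 1) / N\<close> in that interval; the limit fraction may be 0.\<close>

lemma growth_uniform:
  assumes less: "\<And>k. ns k < Ns k" and N: "filterlim Ns at_top sequentially"
    and nu: "(\<lambda>k. real (ns k) / real (Ns k)) \<longlonglongrightarrow> nu" and beta: "0 \<le> beta" and e: "0 < e"
  shows "eventually (\<lambda>k. \<forall>xs\<in>configs r (ns k).
    \<bar>growth r (coupling beta (Ns k)) xs - field_sum r (beta * nu powr (z - 1)) (emp xs)\<bar> < e) sequentially"
proof -
  define h where "h t = exp (beta * t powr (z - 1))" for t :: real
  have "continuous_on {0..1} h"
    unfolding h_def [abs_def] using z_gt_2 by (intro continuous_intros continuous_on_powr') auto
  then have "uniformly_continuous_on {0..1} h" by (rule compact_uniformly_continuous) simp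
  moreover define e' where "e' = e / (real r + 1)"
  moreover have e': "e' > 0" using e by (simp add: e'_def)
  ultimately obtain d where d: "d > 0"
    "\<And>s t. s \<in> {0..1} \<Longrightarrow> t \<in> {0..1} \<Longrightarrow> \<bar>s - t\<bar> < d \<Longrightarrow> \<bar>h s - h t\<bar> < e'"
    unfolding uniformly_continuous_on_def dist_real_def by metis
  have nu01: "0 \<le> nu" "nu \<le> 1"
    using LIMSEQ_le_const[OF nu, of 0] LIMSEQ_le_const2[OF nu, of 1] less
    by (auto simp: divide_le_eq less_imp_le)
  have "(\<lambda>k. 1 / real (Ns k)) \<longlonglongrightarrow> 0"
    using N by (intro tendsto_divide_0[OF tendsto_const] filterlim_at_top_imp_at_infinity
        filterlim_compose[OF filterlim_real_sequentially])
  then have "eventually (\<lambda>k. \<bar>real (ns k) / real (Ns k) - nu\<bar> < d / 2 \<and> 1 / real (Ns k) < d / 2) sequentially"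
    using tendstoD[OF nu, of "d / 2"] order_tendstoD(2)[of "\<lambda>k. 1 / real (Ns k)" 0 sequentially "d / 2"] d(1)
    by (intro eventually_conj) (simp_all add: dist_real_def)
  then show ?thesis
  proof eventually_elim
    case (elim k)
    let ?N = "real (Ns k)"
    have Npos: "?N > 0" using less[of k] by simp
    show ?case
    proof
      fix xs assume xs: "xs \<in> configs r (ns k)"
      have "\<bar>exp (coupling beta (Ns k) * (real (count_list xs j + 1) powr z - real (count_list xs j) powr z))
          - exp (beta * nu powr (z - 1) * emp xs j powr (z - 1))\<bar> \<le> e'" if "j < r" for j
      proof -
        let ?c = "count_list xs j"
        let ?g = "exp (coupling beta (Ns k) * (real (?c + 1) powr z - real ?c powr z))"
        have len: "length xs = ns k" using xs by (simp add: lists_of_def)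
        have cle: "?c \<le> ns k" using count_le_length[of xs j] len by simp
        have u: "0 \<le> emp xs j" "emp xs j \<le> 1" using cle by (auto simp: emp_count len divide_le_eq_1)
        have target: "exp (beta * nu powr (z - 1) * emp xs j powr (z - 1)) = h (nu * emp xs j)"
          using nu01 u by (simp add: h_def powr_mult mult.assoc)
        have "real ?c / ?N = emp xs j * (real (ns k) / ?N)"
          using cle by (cases "ns k = 0") (auto simp: emp_count len)
        then have "real ?c / ?N - nu * emp xs j = emp xs j * (real (ns k) / ?N - nu)"
          by (simp only: right_diff_distrib mult.commute)
        then have "\<bar>real ?c / ?N - nu * emp xs j\<bar> = emp xs j * \<bar>real (ns k) / ?N - nu\<bar>"
          using u by (simp add: abs_mult)
        also have "\<dots> \<le> 1 * \<bar>real (ns k) / ?N - nu\<bar>" using u by (intro mult_right_mono) auto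
        finally have c1: "\<bar>real ?c / ?N - nu * emp xs j\<bar> < d / 2" using elim by simp
        have "real (?c + 1) / ?N = real ?c / ?N + 1 / ?N" by (simp add: add_divide_distrib)
        moreover have "0 < 1 / ?N" using Npos by simp
        ultimately have c2: "\<bar>real (?c + 1) / ?N - nu * emp xs j\<bar> < d"
          using c1 conjunct2[OF elim] unfolding abs_less_iff by linarith
        have "nu * emp xs j \<in> {0..1}" using nu01 u by (auto intro: mult_le_one)
        moreover have "real ?c / ?N \<in> {0..1}" "real (?c + 1) / ?N \<in> {0..1}"
          using cle less[of k] by (auto simp: divide_le_eq_1)
        ultimately have "\<bar>h (real ?c / ?N) - h (nu * emp xs j)\<bar> < e'" "\<bar>h (real (?c + 1) / ?N) - h (nu * emp xs j)\<bar> < e'"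
          using c1 c2 d by auto
        moreover have "h (real ?c / ?N) \<le> ?g" "?g \<le> h (real (?c + 1) / ?N)"
          using growth_term_bounds[OF beta, of "Ns k" ?c] Npos by (auto simp: h_def)
        ultimately show ?thesis unfolding target by linarith
      qed
      then have "\<bar>growth r (coupling beta (Ns k)) xs - field_sum r (beta * nu powr (z - 1)) (emp xs)\<bar> \<le> (\<Sum>j<r. e')"
        unfolding growth_def field_sum_def sum_subtractf[symmetric]
        by (intro order_trans[OF sum_abs] sum_mono) auto
      also have "\<dots> < (real r + 1) * e'" using e' by simp
      also have "\<dots> = e" by (simp add: e'_def)
      finally show "\<bar>growth r (coupling beta (Ns k)) xs - field_sum r (beta * nu powr (z - 1)) (emp xs)\<bar> < e" .
    qed
  qed
qed

end

text \<open>\<open>T\<close> is an exceptional set: \<open>f\<close> is estimated by 0 on it here,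
  and by \<open>K\<close> in the upper version. Both convert a vanishing relative mass of
  \<open>T\<close> into a bound on the average.\<close>

lemma weighted_average_lower:
  fixes w f :: "'a \<Rightarrow> real"
  assumes S: "finite S" "T \<subseteq> S" and w: "\<And>x. x \<in> S \<Longrightarrow> 0 \<le> w x" "0 < sum w S"
    and f: "\<And>x. x \<in> S \<Longrightarrow> 0 \<le> f x" "\<And>x. x \<in> S - T \<Longrightarrow> c \<le> f x"
  shows "c * (1 - sum w T / sum w S) \<le> (\<Sum>x\<in>S. w x * f x) / sum w S"
proof -
  have "c * (sum w S - sum w T) = (\<Sum>x\<in>S - T. w x * c)"
    using sum_diff[OF S, of w] by (simp flip: sum_distrib_right)
  also have "\<dots> \<le> (\<Sum>x\<in>S - T. w x * f x)" using w f by (intro sum_mono mult_left_mono) auto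
  also have "\<dots> \<le> (\<Sum>x\<in>S. w x * f x)" using S w f by (intro sum_mono2) auto
  finally have "c * (sum w S - sum w T) / sum w S \<le> (\<Sum>x\<in>S. w x * f x) / sum w S"
    using w(2) by (intro divide_right_mono) auto
  then show ?thesis using w(2) by (simp add: field_simps)
qed

lemma weighted_average_upper:
  fixes w f :: "'a \<Rightarrow> real"
  assumes S: "finite S" "T \<subseteq> S" and w: "\<And>x. x \<in> S \<Longrightarrow> 0 \<le> w x" "0 < sum w S"
    and f: "\<And>x. x \<in> S \<Longrightarrow> f x \<le> K" "\<And>x. x \<in> S - T \<Longrightarrow> f x \<le> c" and c: "0 \<le> c"
  shows "(\<Sum>x\<in>S. w x * f x) / sum w S \<le> c + K * (sum w T / sum w S)"
proof -
  have "(\<Sum>x\<in>S. w x * f x) = (\<Sum>x\<in>S - T. w x * f x) + (\<Sum>x\<in>T. w x * f x)"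
    using S sum.subset_diff by blast
  also have "\<dots> \<le> (\<Sum>x\<in>S - T. w x * c) + (\<Sum>x\<in>T. w x * K)"
    using S w f by (intro add_mono sum_mono mult_left_mono) auto
  also have "(\<Sum>x\<in>S - T. w x * c) \<le> (\<Sum>x\<in>S. w x * c)"
    using S w c by (intro sum_mono2) auto
  finally have "(\<Sum>x\<in>S. w x * f x) \<le> sum w S * c + sum w T * K"
    by (simp add: sum_distrib_right)
  then have "(\<Sum>x\<in>S. w x * f x) / sum w S \<le> (sum w S * c + sum w T * K) / sum w S"
    using w(2) by (intro divide_right_mono) auto
  then show ?thesis using w(2) by (simp add: add_divide_distrib mult.commute)
qed

context potts_exponent begin

lemma spin_ratio_average:
  "spin_ratio r beta N n =
     (\<Sum>xs\<in>configs r n. count_weight r (coupling beta N) xs * growth r (coupling beta N) xs)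
     / (\<Sum>xs\<in>configs r n. count_weight r (coupling beta N) xs)"
  unfolding spin_ratio_def class_sum_Suc by (simp add: class_sum_def)

lemma growth_nonneg: "0 \<le> growth r c xs"
  by (simp add: growth_def sum_nonneg)

lemma spin_ratio_ge:
  assumes "r > 0" "0 \<le> beta" "N > 0"
  shows "real r \<le> spin_ratio r beta N n"
proof -
  have "real r * (1 - 0) \<le> spin_ratio r beta N n"
    unfolding spin_ratio_average
  proof (rule order_trans[OF _ weighted_average_lower[where T = "{}" and c = "real r"]])
    fix xs :: "nat list"
    have "1 \<le> exp (coupling beta N * (real (count_list xs j + 1) powr z - real (count_list xs j) powr z))" for j
    proof -
      have "0 \<le> beta * (real (count_list xs j) / real N) powr (z - 1)" using assms by simp
      then show ?thesis using growth_term_bounds(1)[OF assms(2,3), of "count_list xs j"] by simp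
    qed
    then have "(\<Sum>j<r. 1) \<le> growth r (coupling beta N) xs" unfolding growth_def by (intro sum_mono)
    then show "real r \<le> growth r (coupling beta N) xs" by simp
  qed (use class_sum_pos[of "{..<r}"] assms(1) in \<open>auto simp: growth_nonneg class_sum_def\<close>)
  then show ?thesis by simp
qed

lemma seq_closed_field_sum:
  "seq_closed r {u. field_sum r b u \<le> s}" "seq_closed r {u. s \<le> field_sum r b u}"
proof -
  have lim: "(\<lambda>n. field_sum r b (v n)) \<longlonglongrightarrow> field_sum r b u"
    if "\<forall>n. v n \<in> prob_vectors r" "\<forall>i<r. (\<lambda>n. v n i) \<longlonglongrightarrow> u i" for v u
    using that by (intro tendsto_field_sum) auto
  show "seq_closed r {u. field_sum r b u \<le> s}"
    unfolding seq_closed_def by (auto intro!: LIMSEQ_le_const2[OF lim])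
  show "seq_closed r {u. s \<le> field_sum r b u}"
    unfolding seq_closed_def by (auto intro!: LIMSEQ_le_const[OF lim])
qed

lemma field_sum_0: "field_sum r 0 u = real r"
  by (simp add: field_sum_def)

lemma field_sum_le:
  assumes "u \<in> prob_vectors r" "0 \<le> b"
  shows "field_sum r b u \<le> real r * exp b"
proof -
  have "exp (b * u i powr (z - 1)) \<le> exp b" if "i < r" for i
  proof -
    have "u i powr (z - 1) \<le> 1 powr (z - 1)"
      using prob_vectorsD[OF assms(1)] that z_gt_2 by (intro powr_mono2) auto
    then show ?thesis using assms(2) by (simp add: mult_left_le)
  qed
  then have "field_sum r b u \<le> (\<Sum>i<r. exp b)" unfolding field_sum_def by (intro sum_mono) auto
  then show ?thesis by simp
qed

text \<open>A positive limit fraction makes the class itself infinite in the limit, as concentration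
  requires.\<close>

lemma config_probability_tendsto_0:
  assumes less: "\<And>k. ns k < Ns k" and N: "filterlim Ns at_top sequentially"
    and nu: "(\<lambda>k. real (ns k) / real (Ns k)) \<longlonglongrightarrow> nu" "0 < nu" and beta: "0 \<le> beta" and r: "r > 0"
    and E: "seq_closed r E" "E \<inter> maximizers r (beta * nu powr (z - 1)) = {}"
  shows "(\<lambda>k. type_prob r (coupling beta (Ns k)) (ns k) E) \<longlonglongrightarrow> 0"
    (is "?q \<longlonglongrightarrow> 0") and "filterlim ns at_top sequentially"
proof -
  have "filterlim (\<lambda>k. real (ns k) / real (Ns k) * real (Ns k)) at_top sequentially"
    using N by (intro filterlim_tendsto_pos_mult_at_top[OF nu] filterlim_compose[OF filterlim_real_sequentially])
  moreover have "real (ns k) / real (Ns k) * real (Ns k) = real (ns k)" for k using less[of k] by simp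
  ultimately show ns: "filterlim ns at_top sequentially"
    by (simp add: filterlim_sequentially_iff_filterlim_real)
  define bs where "bs k = beta * (real (ns k) / real (Ns k)) powr (z - 1)" for k
  have "bs \<longlonglongrightarrow> beta * nu powr (z - 1)"
    unfolding bs_def using nu by (intro tendsto_intros) auto
  from concentration[OF this _ ns E r]
  have "(\<lambda>k. partial_sum r (ns k) (bs k) E / partition_fn r (ns k) (bs k)) \<longlonglongrightarrow> 0"
    using beta by (simp add: bs_def)
  moreover have "eventually (\<lambda>k. partial_sum r (ns k) (bs k) E / partition_fn r (ns k) (bs k) = ?q k) sequentially"
    using ns[unfolded filterlim_at_top, rule_format, of 1]
  proof eventually_elim
    case (elim k)
    have Npos: "Ns k > 0" using less[of k] by simp
    show ?case
      unfolding partial_sum_def partition_fn_def bs_def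
      using coupling_weight[of _ r "ns k" "Ns k" beta] elim Npos
      by (intro arg_cong2[where f = "(/)"] sum.cong) auto
  qed
  ultimately show "?q \<longlonglongrightarrow> 0" by (rule Lim_transform_eventually)
qed

text \<open>Only a lower bound valid for all maximizers enters, so the estimate remains meaningful
  where phases coexist and the spin ratio need not converge.\<close>

lemma spin_ratio_lower:
  assumes less: "\<And>k. ns k < Ns k" and N: "filterlim Ns at_top sequentially"
    and nu: "(\<lambda>k. real (ns k) / real (Ns k)) \<longlonglongrightarrow> nu" and beta: "0 \<le> beta" and r: "r > 0"
    and s: "\<And>m. m \<in> maximizers r (beta * nu powr (z - 1)) \<Longrightarrow> s \<le> field_sum r (beta * nu powr (z - 1)) m"
    and e: "0 < e"
  shows "eventually (\<lambda>k. s - e < spin_ratio r beta (Ns k) (ns k)) sequentially"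
proof -
  let ?b = "beta * nu powr (z - 1)"
  have nu0: "0 \<le> nu" using LIMSEQ_le_const[OF nu, of 0] by auto
  define E where "E = {u. field_sum r ?b u \<le> s - e / 2}"
  define c where "c = max 0 (s - 3 / 4 * e)"
  have pos: "0 < (\<Sum>xs\<in>configs r n. count_weight r (coupling beta N') xs)" for n N'
    using class_sum_pos[of "{..<r}"] r by (auto simp: class_sum_def)
  let ?q = "\<lambda>k. type_prob r (coupling beta (Ns k)) (ns k) E"
  \<comment> \<open>At \<open>nu = 0\<close> the class may stay finite and nothing concentrates, but
    the effective inverse temperature is 0 and the field sum is constantly \<open>r\<close>, so
    \<open>E\<close> is empty.\<close>
  have q: "?q \<longlonglongrightarrow> 0"
  proof (cases "nu = 0")
    case True
    obtain m where "m \<in> maximizers r ?b" using maximizers_nonempty[OF r] .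
    then have "s \<le> real r" using s True by (simp add: field_sum_0)
    then have "E = {}" using True e by (auto simp: E_def field_sum_0)
    then show ?thesis by simp
  next
    case False
    have "E \<inter> maximizers r ?b = {}" using s e by (force simp: E_def)
    moreover have "seq_closed r E" unfolding E_def by (rule seq_closed_field_sum)
    ultimately show ?thesis
      using config_probability_tendsto_0(1)[OF less N nu _ beta r] False nu0 by simp
  qed
  have "(\<lambda>k. c * (1 - ?q k)) \<longlonglongrightarrow> c * (1 - 0)" by (intro tendsto_intros q)
  moreover have "s - e < c * (1 - 0)" using e by (simp add: c_def)
  ultimately have "eventually (\<lambda>k. s - e < c * (1 - ?q k)) sequentially" by (rule order_tendstoD)
  moreover have "eventually (\<lambda>k. \<forall>xs\<in>configs r (ns k).
    \<bar>growth r (coupling beta (Ns k)) xs - field_sum r ?b (emp xs)\<bar> < e / 4) sequentially"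
    using e by (intro growth_uniform[OF less N nu beta]) auto
  ultimately show ?thesis
  proof eventually_elim
    case (elim k)
    have "c * (1 - ?q k) \<le> spin_ratio r beta (Ns k) (ns k)"
      unfolding spin_ratio_average
    proof (rule weighted_average_lower[OF _ _ _ pos])
      fix xs assume xs: "xs \<in> configs r (ns k) - {xs \<in> configs r (ns k). emp xs \<in> E}"
      then have "s - e / 2 < field_sum r ?b (emp xs)" by (auto simp: E_def)
      moreover have "\<bar>growth r (coupling beta (Ns k)) xs - field_sum r ?b (emp xs)\<bar> < e / 4" using xs elim(2) by blast
      ultimately show "c \<le> growth r (coupling beta (Ns k)) xs"
        using growth_nonneg[of r "coupling beta (Ns k)" xs] e unfolding c_def by linarith
    qed (auto simp: growth_nonneg)
    then show ?case using elim(1) by linarith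
  qed
qed

lemma spin_ratio_upper:
  assumes less: "\<And>k. ns k < Ns k" and N: "filterlim Ns at_top sequentially"
    and nu: "(\<lambda>k. real (ns k) / real (Ns k)) \<longlonglongrightarrow> nu" and beta: "0 \<le> beta" and r: "r > 0"
    and s: "\<And>m. m \<in> maximizers r (beta * nu powr (z - 1)) \<Longrightarrow> field_sum r (beta * nu powr (z - 1)) m \<le> s"
    and e: "0 < e"
  shows "eventually (\<lambda>k. spin_ratio r beta (Ns k) (ns k) < s + e) sequentially"
proof -
  let ?b = "beta * nu powr (z - 1)"
  have nu0: "0 \<le> nu" using LIMSEQ_le_const[OF nu, of 0] by auto
  have b0: "0 \<le> ?b" using beta by simp
  obtain m where m: "m \<in> maximizers r ?b" using maximizers_nonempty[OF r] .
  have s0: "0 < s" using s[OF m] field_sum_pos[OF r, of ?b m] by simp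
  define E where "E = {u. s + e / 2 \<le> field_sum r ?b u}"
  define c where "c = s + 3 / 4 * e"
  \<comment> \<open>A crude bound for \<open>growth\<close> on the exceptional configurations: the
    largest possible field sum plus the approximation error.\<close>
  define K where "K = real r * exp ?b + e"
  have pos: "0 < (\<Sum>xs\<in>configs r n. count_weight r (coupling beta N') xs)" for n N'
    using class_sum_pos[of "{..<r}"] r by (auto simp: class_sum_def)
  let ?q = "\<lambda>k. type_prob r (coupling beta (Ns k)) (ns k) E"
  have q: "?q \<longlonglongrightarrow> 0"
  proof (cases "nu = 0")
    case True
    have "real r \<le> s" using s[OF m] True by (simp add: field_sum_0)
    then have "E = {}" using True e by (auto simp: E_def field_sum_0)
    then show ?thesis by simp
  next
    case False
    have "E \<inter> maximizers r ?b = {}" using s e by (force simp: E_def)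
    moreover have "seq_closed r E" unfolding E_def by (rule seq_closed_field_sum)
    ultimately show ?thesis
      using config_probability_tendsto_0(1)[OF less N nu _ beta r] False nu0 by simp
  qed
  have "(\<lambda>k. c + K * ?q k) \<longlonglongrightarrow> c + K * 0" by (intro tendsto_intros q)
  moreover have "c + K * 0 < s + e" using e by (simp add: c_def)
  ultimately have "eventually (\<lambda>k. c + K * ?q k < s + e) sequentially" by (rule order_tendstoD)
  moreover have "eventually (\<lambda>k. \<forall>xs\<in>configs r (ns k).
    \<bar>growth r (coupling beta (Ns k)) xs - field_sum r ?b (emp xs)\<bar> < e / 4) sequentially"
    using e by (intro growth_uniform[OF less N nu beta]) auto
  ultimately show ?thesis
  proof eventually_elim
    case (elim k)
    have "spin_ratio r beta (Ns k) (ns k) \<le> c + K * ?q k"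
      unfolding spin_ratio_average
    proof (rule weighted_average_upper[OF _ _ _ pos])
      fix xs assume xs: "xs \<in> configs r (ns k) - {xs \<in> configs r (ns k). emp xs \<in> E}"
      then have "field_sum r ?b (emp xs) < s + e / 2" by (auto simp: E_def)
      moreover have "\<bar>growth r (coupling beta (Ns k)) xs - field_sum r ?b (emp xs)\<bar> < e / 4" using xs elim(2) by blast
      ultimately show "growth r (coupling beta (Ns k)) xs \<le> c" unfolding c_def by linarith
    next
      fix xs assume xs: "xs \<in> configs r (ns k)"
      have "field_sum r ?b (emp xs) \<le> real r * exp ?b"
      proof (cases "xs = []")
        case True
        have "1 \<le> exp ?b" using b0 by simp
        then show ?thesis using True r z_gt_2 by (simp add: field_sum_def emp_def mult_le_cancel_left1)
      next
        case False
        then show ?thesis using emp_prob_vectors xs b0 by (intro field_sum_le) (auto simp: lists_of_def)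
      qed
      moreover have "\<bar>growth r (coupling beta (Ns k)) xs - field_sum r ?b (emp xs)\<bar> < e / 4" using xs elim(2) by blast
      ultimately show "growth r (coupling beta (Ns k)) xs \<le> K" unfolding K_def using e by linarith
    qed (use s0 e in \<open>auto simp: c_def\<close>)
    then show ?case using elim(1) by linarith
  qed
qed

lemma spin_ratio_limit:
  assumes "\<And>k. ns k < Ns k" "filterlim Ns at_top sequentially"
    and "(\<lambda>k. real (ns k) / real (Ns k)) \<longlonglongrightarrow> nu" and "0 \<le> beta" and "r > 0"
    and s: "\<And>m. m \<in> maximizers r (beta * nu powr (z - 1)) \<Longrightarrow> field_sum r (beta * nu powr (z - 1)) m = s"
  shows "(\<lambda>k. spin_ratio r beta (Ns k) (ns k)) \<longlonglongrightarrow> s"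
proof (rule order_tendstoI)
  fix a assume "a < s"
  then show "eventually (\<lambda>k. a < spin_ratio r beta (Ns k) (ns k)) sequentially"
    using spin_ratio_lower[OF assms(1-5), of s "s - a"] s by simp
next
  fix a assume "s < a"
  then show "eventually (\<lambda>k. spin_ratio r beta (Ns k) (ns k) < a) sequentially"
    using spin_ratio_upper[OF assms(1-5), of s "a - s"] s by simp
qed

end

section \<open>Phase coexistence at the critical inverse temperature\<close>

text \<open>On this half-line the second derivative of \<open>exp\<close> is at most
  \<open>1 + 2 * e\<close>, so the quadratic minus \<open>exp\<close> is convex and lies above its
  tangent at 0.\<close>

lemma exp_le_quadratic:
  assumes "0 < e" "s \<le> ln (1 + 2 * e)"
  shows "exp s \<le> 1 + s + (1 / 2 + e) * (s::real)\<^sup>2"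
proof -
  let ?C = "{..ln (1 + 2 * e)}"
  have "(2 * (1 / 2 + e) * 0 - exp 0) * (s - 0) \<le> ((1 / 2 + e) * s\<^sup>2 - exp s) - ((1 / 2 + e) * 0\<^sup>2 - exp 0)"
  proof (rule f''_imp_f'[where C = ?C and f = "\<lambda>s. (1 / 2 + e) * s\<^sup>2 - exp s" and f' = "\<lambda>s. 2 * (1 / 2 + e) * s - exp s"
      and f'' = "\<lambda>s. 2 * (1 / 2 + e) - exp s"])
    fix x assume "x \<in> ?C"
    then have "exp x \<le> exp (ln (1 + 2 * e))" by simp
    also have "\<dots> = 1 + 2 * e" using assms(1) by simp
    finally show "0 \<le> 2 * (1 / 2 + e) - exp x" by simp
  qed (use assms in \<open>auto intro!: derivative_eq_intros simp: power2_eq_square algebra_simps\<close>)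
  then show ?thesis by (simp add: algebra_simps)
qed

lemma gaussian_sum_bounded:
  assumes "0 < c"
  shows "\<exists>C. \<forall>S. finite S \<longrightarrow> (\<Sum>k\<in>S. exp (- c * (real_of_int k)\<^sup>2)) \<le> C"
proof -
  define q where "q = exp (- c)"
  have q: "0 < q" "q < 1" using assms by (auto simp: q_def)
  have "(\<Sum>k\<in>S. exp (- c * (real_of_int k)\<^sup>2)) \<le> 2 * (1 / (1 - q))" if "finite S" for S :: "int set"
  proof -
    obtain J where J: "\<forall>k\<in>S. nat \<bar>k\<bar> < J"
      using finite_nat_bounded[of "(\<lambda>k. nat \<bar>k\<bar>) ` S"] \<open>finite S\<close> by auto
    let ?g = "\<lambda>k. exp (- c * (real_of_int k)\<^sup>2)"
    have "S \<subseteq> int ` {..<J} \<union> (\<lambda>j. - int j) ` {..<J}"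
    proof
      fix k assume "k \<in> S"
      then have "nat \<bar>k\<bar> < J" using J by blast
      moreover have "k = int (nat \<bar>k\<bar>) \<or> k = - int (nat \<bar>k\<bar>)" by auto
      ultimately show "k \<in> int ` {..<J} \<union> (\<lambda>j. - int j) ` {..<J}" by blast
    qed
    then have "(\<Sum>k\<in>S. ?g k) \<le> (\<Sum>k\<in>int ` {..<J} \<union> (\<lambda>j. - int j) ` {..<J}. ?g k)"
      by (intro sum_mono2) auto
    also have "\<dots> \<le> (\<Sum>k\<in>int ` {..<J}. ?g k) + (\<Sum>k\<in>(\<lambda>j. - int j) ` {..<J}. ?g k)"
      by (subst sum.union_inter[symmetric]) (auto intro: sum_nonneg)
    also have "\<dots> = 2 * (\<Sum>j<J. ?g (int j))"
      by (simp add: sum.reindex inj_on_def)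
    also have "(\<Sum>j<J. ?g (int j)) \<le> (\<Sum>j<J. q ^ j)"
    proof (rule sum_mono)
      fix j
      have "real j \<le> (real j)\<^sup>2" by (simp add: power2_eq_square flip: of_nat_mult)
      then have "c * real j \<le> c * (real j)\<^sup>2" using assms by (intro mult_left_mono) auto
      then have "exp (- c * (real j)\<^sup>2) \<le> exp (real j * (- c))" by (simp add: mult.commute)
      then show "?g (int j) \<le> q ^ j" by (simp only: q_def exp_of_nat_mult of_int_of_nat_eq)
    qed
    also have "(\<Sum>j<J. q ^ j) \<le> (\<Sum>j. q ^ j)"
      using q by (intro sum_le_suminf summable_geometric) auto
    also have "\<dots> = 1 / (1 - q)" using q by (intro suminf_geometric) auto
    finally show ?thesis by simp
  qed
  then show ?thesis by blast
qed

text \<open>Rounding towards zero instead of to the nearest integer keeps the rounded point inside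
  the symmetric range that contains \<open>y\<close>.\<close>

lemma integer_towards_zero: "\<exists>k::int. \<bar>real_of_int k\<bar> \<le> \<bar>y\<bar> \<and> \<bar>real_of_int k - y\<bar> \<le> (1::real)"
proof (cases "0 \<le> y")
  case True
  then have "0 \<le> real_of_int \<lfloor>y\<rfloor>" by simp
  then show ?thesis
    using True of_int_floor_le[of y] real_of_int_floor_gt_diff_one[of y]
    unfolding abs_le_iff by (intro exI[of _ "\<lfloor>y\<rfloor>"] conjI) linarith+
next
  case False
  then have "real_of_int \<lceil>y\<rceil> \<le> 0" by simp
  then show ?thesis
    using False le_of_int_ceiling[of y] ceiling_correct[of y]
    unfolding abs_le_iff by (intro exI[of _ "\<lceil>y\<rceil>"] conjI) linarith+
qed

text \<open>A discrete Hubbard-Stratonovich transform: \<open>exp (n * a * |v|^2)\<close> is dominated by a sum of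
  \<open>exp (n * (t \<bullet> v) - k/2 * |t|^2)\<close> over the lattice points \<open>t\<close> of mesh \<open>1 / sqrt n\<close>; for fixed \<open>t\<close>
  the sum over configurations factorizes, and the remaining Gaussian sum is bounded
  uniformly in \<open>n\<close>.\<close>
lemma quadratic_exponential_moment:
  assumes r: "r > 0" and a: "0 < a" "2 * a < real r"
  shows "\<exists>d>0. \<exists>C. \<forall>n>0. (\<Sum>xs\<in>{xs \<in> lists_of {..<r} n. \<forall>i<r. \<bar>emp xs i - 1 / r\<bar> \<le> d}.
      exp (real n * a * (\<Sum>i<r. (emp xs i - 1 / r)\<^sup>2))) \<le> C * real r ^ n"
proof -
  \<comment> \<open>The expression t v - t^2 / (2 l) is largest at t = l v, with value a v^2; this
    fixes \<open>l\<close>.\<close>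
  define l where "l = 2 * a"
  \<comment> \<open>Positive because \<open>2 * a < r\<close>. With this choice the net Gaussian
    rate \<open>rho\<close> becomes \<open>e / r\<close>.\<close>
  define e where "e = (real r / l - 1) / 4"
  have l: "0 < l" "l < real r" using a by (auto simp: l_def)
  have e: "e > 0" using l by (simp add: e_def)
  define rho where "rho = 1 / (2 * l) - (1 / 2 + e) / r"
  have rho: "rho > 0"
  proof -
    have "rho = (real r / l - 1 - 2 * e) / (2 * real r)"
      using r l by (simp add: rho_def field_simps)
    also have "real r / l - 1 - 2 * e = 2 * e"
    proof -
      have "4 * e = real r / l - 1" by (simp add: e_def)
      then show ?thesis by simp
    qed
    finally show ?thesis using e r by simp
  qed
  obtain G where G: "\<And>S. finite S \<Longrightarrow> (\<Sum>k\<in>S. exp (- rho * (real_of_int k)\<^sup>2)) \<le> G"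
    using gaussian_sum_bounded[OF rho] by blast
  \<comment> \<open>The centred tilts are then at most \<open>2 * l * d = ln (1 + 2 * e)\<close>,
    the range in which the quadratic bound for \<open>exp\<close> holds.\<close>
  define d where "d = ln (1 + 2 * e) / (2 * l)"
  have d: "d > 0" using e l by (simp add: d_def)
  define C where "C = exp (real r / (2 * l)) * G ^ r"
  have "(\<Sum>xs\<in>{xs \<in> lists_of {..<r} n. \<forall>i<r. \<bar>emp xs i - 1 / r\<bar> \<le> d}.
      exp (real n * a * (\<Sum>i<r. (emp xs i - 1 / r)\<^sup>2))) \<le> C * real r ^ n" if n: "n > 0" for n
  proof -
    define S where "S = {k::int. \<bar>real_of_int k\<bar> \<le> l * d * sqrt n}"
    have "S \<subseteq> {- \<lceil>l * d * sqrt n\<rceil>..\<lceil>l * d * sqrt n\<rceil>}"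
      unfolding S_def by (auto simp: abs_le_iff le_ceiling_iff minus_le_iff)
    then have finS: "finite S" using finite_subset by blast
    let ?K = "{..<r} \<rightarrow>\<^sub>E S"
    let ?L = "lists_of {..<r} n"
    let ?D = "{xs \<in> ?L. \<forall>i<r. \<bar>emp xs i - 1 / r\<bar> \<le> d}"
    define t where "t k i = real_of_int (k i) / sqrt n" for k :: "nat \<Rightarrow> int" and i
    let ?sq = "\<lambda>k. \<Sum>i<r. (real_of_int (k i))\<^sup>2"
    \<comment> \<open>Centring \<open>t\<close> leaves its pairing with \<open>v\<close> unchanged,
      as the coordinates of \<open>v\<close> sum to 0, and removes the linear term when the
      exponentials are expanded.\<close>
    define tm where "tm k = (\<Sum>i<r. t k i) / r" for k
    define W where "W k xs = exp (- (1 / (2 * l)) * ?sq k)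
        * prod_list (map (\<lambda>i. exp (t k i - tm k)) xs)" for k xs
    have t2: "n * (t k i)\<^sup>2 = (real_of_int (k i))\<^sup>2" for k i
      using n by (simp add: t_def power_divide)
    have point: "exp (real n * a * (\<Sum>i<r. (emp xs i - 1 / r)\<^sup>2)) \<le> exp (real r / (2 * l)) * (\<Sum>k\<in>?K. W k xs)"
      if xs: "xs \<in> ?D" for xs
    proof -
      define v where "v i = emp xs i - 1 / r" for i
      have len: "set xs \<subseteq> {..<r}" "xs \<noteq> []" "length xs = n" using xs n by (auto simp: lists_of_def)
      obtain k0 where k0: "\<And>i. \<bar>real_of_int (k0 i)\<bar> \<le> \<bar>l * v i * sqrt n\<bar>" "\<And>i. \<bar>real_of_int (k0 i) - l * v i * sqrt n\<bar> \<le> 1"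
      proof -
        have "\<forall>i. \<exists>k::int. \<bar>real_of_int k\<bar> \<le> \<bar>l * v i * sqrt n\<bar> \<and> \<bar>real_of_int k - l * v i * sqrt n\<bar> \<le> 1"
          using integer_towards_zero by blast
        then show ?thesis using that by metis
      qed
      define k where "k = restrict k0 {..<r}"
      have kK: "k \<in> ?K"
      proof -
        have "k0 i \<in> S" if "i < r" for i
        proof -
          have "\<bar>v i\<bar> \<le> d" using xs that by (simp add: v_def)
          then have "\<bar>l * v i * sqrt n\<bar> \<le> l * d * sqrt n"
            using l by (simp add: abs_mult mult_mono)
          then show ?thesis using k0(1)[of i] by (simp add: S_def)
        qed
        then show ?thesis by (auto simp: k_def)
      qed
      \<comment> \<open>The rounding bound (k - l v sqrt n)^2 \<le> 1, divided by 2 l and expanded.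
        Rounding costs a factor exp (1 / (2 l)) per coordinate, independent of
        \<open>n\<close>.\<close>
      have summand: "real n * a * (v i)\<^sup>2 - 1 / (2 * l) \<le> real n * (t k i * v i) - (1 / (2 * l)) * (real_of_int (k i))\<^sup>2"
        if "i < r" for i
      proof -
        let ?y = "real_of_int (k i)" and ?w = "l * v i * sqrt n"
        have "\<bar>?y - ?w\<bar> \<le> 1" using k0(2)[of i] that by (simp add: k_def)
        then have "(?y - ?w)\<^sup>2 \<le> 1" by (simp add: abs_square_le_1)
        then have "(1 / (2 * l)) * (?y - ?w)\<^sup>2 \<le> (1 / (2 * l)) * 1" using l by (intro mult_left_mono) auto
        moreover have "(1 / (2 * l)) * (?y - ?w)\<^sup>2 = (1 / (2 * l)) * ?y\<^sup>2 - ?y * v i * sqrt n + real n * a * (v i)\<^sup>2"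
        proof -
          have "(?y - ?w)\<^sup>2 = ?y\<^sup>2 - 2 * l * (?y * v i * sqrt n) + l * l * (v i)\<^sup>2 * (sqrt n)\<^sup>2"
            by (simp add: power2_eq_square algebra_simps)
          then have "(?y - ?w)\<^sup>2 = ?y\<^sup>2 - 2 * l * (?y * v i * sqrt n) + l * (2 * a) * (v i)\<^sup>2 * n"
            by (simp add: l_def)
          then show ?thesis using l by (simp add: field_simps)
        qed
        moreover have "real n * (t k i * v i) = ?y * v i * sqrt n"
          using real_div_sqrt[of "real n"] n by (simp add: t_def field_simps)
        ultimately show ?thesis by linarith
      qed
      have "real n * a * (\<Sum>i<r. (v i)\<^sup>2) - real r / (2 * l) = (\<Sum>i<r. real n * a * (v i)\<^sup>2 - 1 / (2 * l))"
        by (simp add: sum_subtractf sum_distrib_left)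
      also have "\<dots> \<le> (\<Sum>i<r. real n * (t k i * v i) - (1 / (2 * l)) * (real_of_int (k i))\<^sup>2)"
        using summand by (intro sum_mono) auto
      also have "\<dots> = real n * (\<Sum>i<r. t k i * v i) - (1 / (2 * l)) * ?sq k"
        by (simp add: sum_subtractf sum_distrib_left)
      also have "real n * (\<Sum>i<r. t k i * v i) = sum_list (map (\<lambda>i. t k i - tm k) xs)"
      proof -
        have "(\<Sum>i<r. emp xs i) = 1" using emp_prob_vectors[OF len(1,2)] by (simp add: prob_vectors_def)
        then have "(\<Sum>i<r. emp xs i * (t k i - tm k)) = (\<Sum>i<r. emp xs i * t k i) - tm k"
          by (simp add: right_diff_distrib sum_subtractf flip: sum_distrib_right)
        also have "\<dots> = (\<Sum>i<r. t k i * v i)"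
          by (simp add: v_def tm_def right_diff_distrib sum_subtractf mult.commute sum_divide_distrib)
        finally show ?thesis
          using sum_list_emp[OF len(1) _ len(2), of "\<lambda>i. t k i - tm k"] len(3) by simp
      qed
      finally have "real n * a * (\<Sum>i<r. (v i)\<^sup>2) \<le> real r / (2 * l)
          + (- (1 / (2 * l)) * ?sq k + sum_list (map (\<lambda>i. t k i - tm k) xs))" by simp
      then have "exp (real n * a * (\<Sum>i<r. (v i)\<^sup>2)) \<le> exp (real r / (2 * l)) * W k xs"
        unfolding W_def prod_list_exp exp_add[symmetric] by simp
      also have "W k xs \<le> (\<Sum>k\<in>?K. W k xs)"
        using kK finS by (intro member_le_sum finite_PiE) (auto simp: W_def prod_list_exp)
      finally show ?thesis by (simp add: v_def)
    qed
    have fac: "(\<Sum>xs\<in>?L. W k xs) \<le> real r ^ n * (\<Prod>i<r. exp (- rho * (real_of_int (k i))\<^sup>2))" if k: "k \<in> ?K" for k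
    proof -
      define s where "s i = t k i - tm k" for i
      have tb: "\<bar>t k i\<bar> \<le> l * d" if "i < r" for i
      proof -
        have "k i \<in> S" using k that by auto
        then show ?thesis using n by (simp add: S_def t_def field_simps)
      qed
      have "\<bar>\<Sum>i<r. t k i\<bar> \<le> (\<Sum>i<r. l * d)"
        using tb by (intro order_trans[OF sum_abs] sum_mono) auto
      then have "\<bar>tm k\<bar> \<le> l * d" using r by (simp add: tm_def field_simps)
      then have sb: "s i \<le> ln (1 + 2 * e)" if "i < r" for i
      proof -
        have "s i \<le> 2 * (l * d)" using tb[OF that] \<open>\<bar>tm k\<bar> \<le> l * d\<close> by (simp add: s_def)
        also have "\<dots> = ln (1 + 2 * e)" using l by (simp add: d_def)
        finally show ?thesis .
      qed
      have s0: "(\<Sum>i<r. s i) = 0" using r by (simp add: s_def sum_subtractf tm_def)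
      let ?tq = "\<Sum>i<r. (t k i)\<^sup>2"
      have "(\<Sum>i<r. (s i)\<^sup>2) = ?tq - r * (tm k)\<^sup>2"
      proof -
        have "(\<Sum>i<r. (s i)\<^sup>2) = (\<Sum>i<r. (t k i)\<^sup>2 + (tm k)\<^sup>2 - 2 * tm k * t k i)"
          by (intro sum.cong) (auto simp: s_def power2_diff)
        also have "\<dots> = ?tq + r * (tm k)\<^sup>2 - 2 * tm k * (\<Sum>i<r. t k i)"
          by (simp add: sum_subtractf sum.distrib sum_distrib_left)
        also have "(\<Sum>i<r. t k i) = r * tm k" using r by (simp add: tm_def)
        finally show ?thesis by (simp add: power2_eq_square)
      qed
      then have s2: "(\<Sum>i<r. (s i)\<^sup>2) \<le> ?tq" by simp
      have "(\<Sum>i<r. exp (s i)) \<le> (\<Sum>i<r. 1 + s i + (1 / 2 + e) * (s i)\<^sup>2)"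
        using exp_le_quadratic[OF e sb] by (intro sum_mono) auto
      also have "\<dots> = r + (1 / 2 + e) * (\<Sum>i<r. (s i)\<^sup>2)"
        by (simp add: sum.distrib s0 sum_distrib_left)
      also have "\<dots> \<le> r + (1 / 2 + e) * ?tq"
        using s2 e by (intro add_left_mono mult_left_mono) auto
      also have "\<dots> = r * (1 + (1 / 2 + e) / r * ?tq)" using r by (simp add: field_simps)
      also have "\<dots> \<le> r * exp ((1 / 2 + e) / r * ?tq)"
        by (intro mult_left_mono exp_ge_add_one_self) auto
      finally have "(\<Sum>i<r. exp (s i)) ^ n \<le> (r * exp ((1 / 2 + e) / r * ?tq)) ^ n"
        by (intro power_mono sum_nonneg) auto
      also have "\<dots> = real r ^ n * exp (n * ((1 / 2 + e) / r * ?tq))"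
        by (simp only: power_mult_distrib exp_of_nat_mult)
      also have "n * ((1 / 2 + e) / r * ?tq) = (1 / 2 + e) / r * ?sq k"
        by (simp add: t2[symmetric] sum_distrib_left mult_ac)
      finally have pw: "(\<Sum>i<r. exp (s i)) ^ n \<le> real r ^ n * exp ((1 / 2 + e) / r * ?sq k)" .
      have "(\<Sum>xs\<in>?L. W k xs) = exp (- (1 / (2 * l)) * ?sq k) * (\<Sum>i<r. exp (s i)) ^ n"
        unfolding W_def by (simp add: sum_distrib_left[symmetric] sum_prod_lists_of s_def)
      also have "\<dots> \<le> exp (- (1 / (2 * l)) * ?sq k)
          * (real r ^ n * exp ((1 / 2 + e) / r * ?sq k))"
        by (intro mult_left_mono pw) auto
      also have "\<dots> = real r ^ n * exp (- rho * ?sq k)"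
        by (simp add: rho_def left_diff_distrib exp_diff exp_minus field_simps)
      also have "exp (- rho * ?sq k) = (\<Prod>i<r. exp (- rho * (real_of_int (k i))\<^sup>2))"
        by (simp add: exp_sum sum_distrib_left sum_negf flip: exp_sum)
      finally show ?thesis .
    qed
    have "(\<Sum>xs\<in>?D. exp (real n * a * (\<Sum>i<r. (emp xs i - 1 / r)\<^sup>2)))
        \<le> (\<Sum>xs\<in>?D. exp (real r / (2 * l)) * (\<Sum>k\<in>?K. W k xs))"
      by (intro sum_mono point)
    also have "\<dots> \<le> (\<Sum>xs\<in>?L. exp (real r / (2 * l)) * (\<Sum>k\<in>?K. W k xs))"
    proof (rule sum_mono2)
      show "0 \<le> exp (real r / (2 * l)) * (\<Sum>k\<in>?K. W k xs)" for xs
        by (intro mult_nonneg_nonneg sum_nonneg) (simp_all add: W_def prod_list_exp)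
    qed (simp, blast)
    also have "\<dots> = exp (real r / (2 * l)) * (\<Sum>k\<in>?K. \<Sum>xs\<in>?L. W k xs)"
      by (subst sum.swap) (simp add: sum_distrib_left)
    also have "\<dots> \<le> exp (real r / (2 * l)) * (\<Sum>k\<in>?K. real r ^ n * (\<Prod>i<r. exp (- rho * (real_of_int (k i))\<^sup>2)))"
      by (intro mult_left_mono sum_mono fac) auto
    also have "\<dots> = exp (real r / (2 * l)) * real r ^ n * (\<Prod>i<r. \<Sum>k\<in>S. exp (- rho * (real_of_int k)\<^sup>2))"
      using finS by (subst prod_sum_PiE) (simp_all add: sum_distrib_left mult.assoc)
    also have "\<dots> \<le> exp (real r / (2 * l)) * real r ^ n * G ^ r"
      using G[OF finS] by (intro mult_left_mono) (auto intro!: power_mono sum_nonneg)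
    finally show ?thesis by (simp add: C_def mult_ac)
  qed
  then show ?thesis using d by blast
qed

section \<open>Comparing the two phases up to constant factors\<close>

context potts_exponent begin

text \<open>The second derivative of \<open>x powr z\<close> increases as \<open>z > 2\<close>, so
  its value at \<open>x1\<close> bounds it on the whole range.\<close>

lemma powr_quadratic_upper:
  assumes "0 < m" "m \<le> x1" "0 < x" "x \<le> x1"
  shows "x powr z \<le> m powr z + z * m powr (z - 1) * (x - m) + z * (z - 1) / 2 * x1 powr (z - 2) * (x - m)\<^sup>2"
proof -
  let ?K = "z * (z - 1) * x1 powr (z - 2)"
  have "(?K * (m - m) - z * m powr (z - 1)) * (x - m)
      \<le> (?K / 2 * (x - m)\<^sup>2 - x powr z) - (?K / 2 * (m - m)\<^sup>2 - m powr z)"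
  proof (rule f''_imp_f'[where C = "{0<..x1}" and f = "\<lambda>x. ?K / 2 * (x - m)\<^sup>2 - x powr z"
      and f' = "\<lambda>x. ?K * (x - m) - z * x powr (z - 1)" and f'' = "\<lambda>x. ?K - z * ((z - 1) * x powr (z - 2))"])
    fix y assume y: "y \<in> {0<..x1}"
    show "((\<lambda>x. ?K / 2 * (x - m)\<^sup>2 - x powr z) has_real_derivative ?K * (y - m) - z * y powr (z - 1)) (at y)"
      using y by (auto intro!: derivative_eq_intros)
    show "((\<lambda>x. ?K * (x - m) - z * x powr (z - 1)) has_real_derivative ?K - z * ((z - 1) * y powr (z - 2))) (at y)"
      using y by (auto intro!: derivative_eq_intros)
    have "y powr (z - 2) \<le> x1 powr (z - 2)" using y z_gt_2 by (intro powr_mono2) auto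
    then have "z * (z - 1) * y powr (z - 2) \<le> ?K" using z_gt_2 by (intro mult_left_mono) auto
    then show "0 \<le> ?K - z * ((z - 1) * y powr (z - 2))" by simp
  qed (use assms in auto)
  then show ?thesis by simp
qed

lemma disordered_part_bound:
  assumes r: "r > 0" and b: "0 < b" and x0: "1 / r < x0" "b * (z - 1) * x0 powr (z - 1) < 1"
  shows "\<exists>x1 C. 1 / r < x1 \<and> (\<forall>x n. 1 / r < x \<longrightarrow> x \<le> x1 \<longrightarrow> n > 0 \<longrightarrow>
     partial_sum r n b {u. \<forall>i<r. u i < x} \<le> C * exp (n * F r b (uniform r)))"
proof -
  have x0p: "0 < x0" using x0(1) r by (meson divide_pos_pos less_trans of_nat_0_less_iff zero_less_one)
  define a where "a = b * (z - 1) * x0 powr (z - 2) / 2"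
  have a: "0 < a" using b z_gt_2 x0p by (simp add: a_def)
  have "b * (z - 1) * x0 powr (z - 1) = 2 * a * x0"
    using powr_add[of x0 "z - 2" 1] x0p by (simp add: a_def)
  then have "2 * a < 1 / x0" using x0(2) x0p by (simp add: field_simps)
  also have "\<dots> < r" using x0(1) x0p r by (simp add: field_simps)
  finally have a2: "2 * a < r" .
  obtain d C where d: "d > 0" and C: "\<And>n. n > 0 \<Longrightarrow> (\<Sum>xs\<in>{xs \<in> configs r n. \<forall>i<r. \<bar>emp xs i - 1 / r\<bar> \<le> d}.
      exp (real n * a * (\<Sum>i<r. (emp xs i - 1 / r)\<^sup>2))) \<le> C * real r ^ n"
    using quadratic_exponential_moment[OF r a a2] by blast
  \<comment> \<open>If no coordinate exceeds \<open>1 / r\<close> by more than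
    \<open>d' / r\<close>, none falls short by more than \<open>d'\<close>, since the sum is 1. The
    cap \<open>1 / (2 * r)\<close> keeps all coordinates positive.\<close>
  define d' where "d' = min d (1 / (2 * r))"
  define x1 where "x1 = min x0 (1 / r + d' / r)"
  have d': "0 < d'" "d' \<le> d" "d' < 1 / r" using d r by (auto simp: d'_def min_def field_simps)
  have x1: "1 / r < x1" using x0(1) d' r by (simp add: x1_def)
  have "partial_sum r n b {u. \<forall>i<r. u i < x} \<le> C * exp (n * F r b (uniform r))"
    if x: "1 / r < x" "x \<le> x1" and n: "n > 0" for x n
  proof -
    let ?D = "{xs \<in> configs r n. emp xs \<in> {u. \<forall>i<r. u i < x}}"
    let ?D' = "{xs \<in> configs r n. \<forall>i<r. \<bar>emp xs i - 1 / r\<bar> \<le> d}"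
    let ?q = "\<lambda>xs. exp (real n * a * (\<Sum>i<r. (emp xs i - 1 / r)\<^sup>2))"
    let ?c = "exp (n * b / z * power_sum r (uniform r))"
    have key: "xs \<in> ?D' \<and> config_weight r b xs \<le> ?c * ?q xs" if xs: "xs \<in> ?D" for xs
    proof -
      have len: "set xs \<subseteq> {..<r}" "xs \<noteq> []" "length xs = n" using xs n by (auto simp: lists_of_def)
      have u: "emp xs \<in> prob_vectors r" using emp_prob_vectors[OF len(1,2)] .
      let ?u = "emp xs"
      have close: "\<bar>?u i - 1 / r\<bar> \<le> d'" if i: "i < r" for i
      proof -
        have "?u i < x" using xs i by simp
        moreover have "x - 1 / r \<le> d' / r" using x by (simp add: x1_def)
        moreover have "d' / r \<le> d'" using d' r by (simp add: divide_le_eq mult_le_cancel_left1)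
        ultimately have up: "?u i - 1 / r \<le> d'" by linarith
        have "(\<Sum>j\<in>{..<r} - {i}. ?u j) \<le> (\<Sum>j\<in>{..<r} - {i}. 1 / r + d' / r)"
          using xs x by (intro sum_mono) (force simp: x1_def)
        also have "\<dots> = (real r - 1) * (1 / r + d' / r)" using i r by (simp add: of_nat_diff)
        also have "\<dots> \<le> 1 - 1 / r + d'" using r d' by (simp add: field_simps)
        finally have "1 - ?u i \<le> 1 - 1 / r + d'"
          using prob_vectorsD(2)[OF u] sum.remove[of "{..<r}" i ?u] i by simp
        then show ?thesis using up by (simp add: abs_le_iff)
      qed
      have "power_sum r ?u \<le> (\<Sum>i<r. (1 / r) powr z + z * (1 / r) powr (z - 1) * (?u i - 1 / r)
          + z * (z - 1) / 2 * x0 powr (z - 2) * (?u i - 1 / r)\<^sup>2)"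
        unfolding power_sum_def
      proof (intro sum_mono powr_quadratic_upper)
        fix i assume "i \<in> {..<r}"
        then have i: "i < r" by simp
        show "0 < ?u i" using close[OF i] d'(3) by (simp add: abs_le_iff)
        show "?u i \<le> x0" using xs i x by (force simp: x1_def)
      qed (use r x0 in auto)
      also have "\<dots> = power_sum r (uniform r) + z * (1 / r) powr (z - 1) * (\<Sum>i<r. ?u i - 1 / r)
          + z * (z - 1) / 2 * x0 powr (z - 2) * (\<Sum>i<r. (?u i - 1 / r)\<^sup>2)"
        by (simp add: sum.distrib sum_distrib_left power_sum_def uniform_def)
      also have "(\<Sum>i<r. ?u i - 1 / r) = 0" using prob_vectorsD(2)[OF u] r by (simp add: sum_subtractf)
      finally have "b / z * power_sum r ?u \<le> b / z * (power_sum r (uniform r)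
          + z * (z - 1) / 2 * x0 powr (z - 2) * (\<Sum>i<r. (?u i - 1 / r)\<^sup>2))"
        using b z_gt_2 by (intro mult_left_mono) auto
      also have "\<dots> = b / z * power_sum r (uniform r) + a * (\<Sum>i<r. (?u i - 1 / r)\<^sup>2)"
        using z_gt_2 by (simp add: a_def distrib_left)
      finally have "real n * (b / z * power_sum r ?u)
          \<le> real n * (b / z * power_sum r (uniform r) + a * (\<Sum>i<r. (?u i - 1 / r)\<^sup>2))"
        by (intro mult_left_mono) auto
      then have "config_weight r b xs \<le> ?c * ?q xs"
        unfolding config_weight_def len(3) exp_add[symmetric] by (simp add: distrib_left mult.assoc)
      moreover have "\<bar>?u i - 1 / r\<bar> \<le> d" if "i < r" for i using close[OF that] d'(2) by linarith
      ultimately show ?thesis using xs by blast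
    qed
    have "partial_sum r n b {u. \<forall>i<r. u i < x} \<le> (\<Sum>xs\<in>?D. ?c * ?q xs)"
      unfolding partial_sum_def using key by (intro sum_mono) blast
    also have "\<dots> \<le> (\<Sum>xs\<in>?D'. ?c * ?q xs)" using key by (intro sum_mono2) auto
    also have "\<dots> = ?c * (\<Sum>xs\<in>?D'. ?q xs)" by (simp add: sum_distrib_left)
    also have "\<dots> \<le> ?c * (C * real r ^ n)" by (intro mult_left_mono C n) auto
    also have "real r ^ n = exp (n * ln r)" using r by (simp add: exp_of_nat_mult)
    also have "?c * (C * exp (n * ln r)) = C * exp (n * F r b (uniform r))"
    proof -
      have "F r b (uniform r) = b / z * power_sum r (uniform r) + ln r"
        using r by (simp add: functional_eq uniform_def ln_div)
      then show ?thesis by (simp add: distrib_left exp_add mult_ac)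
    qed
    finally show ?thesis .
  qed
  then show ?thesis using x1 by blast
qed

text \<open>Applied with \<open>b' - b\<close> of order 1 / n, so the factor stays bounded in
  \<open>n\<close>. A bound on the power sum that differs between phases shifts their relative
  weights.\<close>

lemma partial_sum_shift:
  assumes "b \<le> b'" and psum: "\<And>u. u \<in> prob_vectors r \<Longrightarrow> u \<in> E \<Longrightarrow> power_sum r u \<le> s" and n: "n > 0"
  shows "partial_sum r n b' E \<le> exp (n * (b' - b) / z * s) * partial_sum r n b E"
proof -
  have "config_weight r b' xs \<le> exp (n * (b' - b) / z * s) * config_weight r b xs"
    if xs: "xs \<in> {xs \<in> configs r n. emp xs \<in> E}" for xs
  proof -
    have len: "set xs \<subseteq> {..<r}" "xs \<noteq> []" "length xs = n" using xs n by (auto simp: lists_of_def)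
    have "config_weight r b' xs = exp (n * (b' - b) / z * power_sum r (emp xs)) * config_weight r b xs"
      using z_gt_2 by (simp add: config_weight_def len(3) field_simps flip: exp_add)
    moreover have "n * (b' - b) / z * power_sum r (emp xs) \<le> n * (b' - b) / z * s"
      using assms(1) psum[OF emp_prob_vectors[OF len(1,2)]] xs z_gt_2 by (intro mult_left_mono) auto
    ultimately show ?thesis by (simp add: config_weight_pos less_imp_le mult_right_mono)
  qed
  then have "partial_sum r n b' E \<le> (\<Sum>xs\<in>{xs \<in> configs r n. emp xs \<in> E}. exp (n * (b' - b) / z * s) * config_weight r b xs)"
    unfolding partial_sum_def by (intro sum_mono)
  then show ?thesis by (simp add: partial_sum_def sum_distrib_left)
qed

lemma partial_sum_mono_temperature:
  assumes "b \<le> b'"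
  shows "partial_sum r n b E \<le> partial_sum r n b' E"
  unfolding partial_sum_def config_weight_def
  using assms z_gt_2 power_sum_nonneg
  by (intro sum_mono) (auto intro!: mult_right_mono divide_right_mono mult_left_mono)

text \<open>At \<open>beta_c + K / n\<close> the ordered phase already carries half of the partition function once
  \<open>K\<close> is large, and moving back by \<open>O(1 / n)\<close> costs only a constant factor.\<close>
lemma ordered_part_fraction:
  assumes adm: "admissible_rz r z"
  shows "\<exists>x c. 1 / r < x \<and> 0 < c \<and> (\<forall>n>0.
     c * partition_fn r n (beta_c r z * (real n / real (Suc n)) powr (z - 1))
     \<le> partial_sum r n (beta_c r z * (real n / real (Suc n)) powr (z - 1)) {u. \<exists>i<r. x \<le> u i})"
proof -
  let ?bc = "beta_c r z"
  have r: "r \<ge> 2" using adm by (simp add: admissible_rz_def)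
  have bc: "?bc > 0" by (rule beta_c_pos[OF adm])
  obtain x0 m where x0: "1 / r < x0" "?bc * (z - 1) * x0 powr (z - 1) < 1"
    and m: "m \<in> maximizers r ?bc" "\<exists>i<r. x0 \<le> m i"
    using first_order_transition[OF adm] by blast
  have mp: "m \<in> prob_vectors r" using maximizersD(1)[OF m(1)] .
  have Fm: "F r ?bc m = F r ?bc (uniform r)"
    using m(1) uniform_maximizer_beta_c[OF r] by (auto simp: maximizers_def intro: order_antisym)
  let ?p = "F r ?bc m"
  \<comment> \<open>Half the gap between the power sums of the two phases: the disordered types will
    stay below the midpoint, the ordered maximizer lies \<open>e\<close> above it.\<close>
  define e where "e = (power_sum r m - power_sum r (uniform r)) / 2"
  have e: "e > 0" using power_sum_uniform_less[OF mp] m(2) x0(1) by (force simp: e_def)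
  obtain x1 C where x1: "1 / r < x1" and C: "\<And>x n. 1 / r < x \<Longrightarrow> x \<le> x1 \<Longrightarrow> n > 0 \<Longrightarrow>
     partial_sum r n ?bc {u. \<forall>i<r. u i < x} \<le> C * exp (n * F r ?bc (uniform r))"
    using disordered_part_bound[OF _ bc x0] r by auto
  have "((\<lambda>x. real r * x powr z) \<longlongrightarrow> real r * (1 / r) powr z) (at_right (1 / r))"
    using r by (intro tendsto_intros) auto
  then have "eventually (\<lambda>x. real r * x powr z < power_sum r (uniform r) + e) (at_right (1 / r))"
    using e by (intro order_tendstoD) (auto simp: power_sum_def uniform_def)
  moreover have "eventually (\<lambda>x. x \<in> {1 / r<..<x1}) (at_right (1 / r))"
    using x1 by (rule eventually_at_right_real)
  ultimately obtain x where x: "real r * x powr z < power_sum r (uniform r) + e" "1 / r < x" "x < x1"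
    using eventually_happens[OF eventually_conj] by (metis (mono_tags, lifting) greaterThanLessThan_iff trivial_limit_at_right_real)
  define D where "D = {u :: nat \<Rightarrow> real. \<forall>i<r. u i < x}"
  have Dc: "- D = {u. \<exists>i<r. x \<le> u i}" by (auto simp: D_def not_less)
  define C' where "C' = max C 1"
  have C': "C' \<ge> 1" by (simp add: C'_def)
  have dis: "partial_sum r n ?bc D \<le> C' * exp (n * ?p)" if "n > 0" for n
  proof -
    have "partial_sum r n ?bc D \<le> C * exp (n * ?p)" using C[OF x(2) _ that] x(3) by (simp add: D_def Fm)
    also have "\<dots> \<le> C' * exp (n * ?p)" by (intro mult_right_mono) (auto simp: C'_def)
    finally show ?thesis .
  qed
  \<comment> \<open>Chosen so that \<open>exp (K / z * e) = 2 * C'\<close>: raising \<open>b\<close>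
    by \<open>K / n\<close> favours the ordered phase by this factor, leaving the disordered part at
    most half of the lower bound for the partition function.\<close>
  define K where "K = z / e * ln (2 * C')"
  have K: "K \<ge> 0" using e z_gt_2 C' by (simp add: K_def)
  define c1 where "c1 = exp (- (K + ?bc * z) / z) / 2"
  have c1: "c1 > 0" by (simp add: c1_def)
  have main: "c1 / (c1 + C') * partition_fn r n b \<le> partial_sum r n b (- D)"
    if n: "n > 0" and b_def: "b = ?bc * (real n / real (Suc n)) powr (z - 1)" for n b
  proof -
    have q1: "(real n / real (Suc n)) powr (z - 1) \<le> 1" using z_gt_2 by (intro powr_le1) auto
    have b_le: "b \<le> ?bc" using bc q1 by (simp add: b_def mult_left_le)
    \<comment> \<open>The tangent of \<open>x powr z\<close> at 1 bounds the loss from having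
      \<open>n\<close> instead of \<open>n + 1\<close> sites, so \<open>b\<close> is within order 1
      / n of \<open>beta_c\<close>.\<close>
    have gap: "real n * (?bc - b) \<le> ?bc * z"
    proof -
      have "1 + z * (real n / real (Suc n) - 1) \<le> (real n / real (Suc n)) powr z"
        using powr_tangent[of 1 "real n / real (Suc n)"] by simp
      also have "\<dots> \<le> (real n / real (Suc n)) powr (z - 1)" using n by (intro powr_mono') auto
      finally have "1 - (real n / real (Suc n)) powr (z - 1) \<le> z * (1 - real n / real (Suc n))" by (simp add: algebra_simps)
      also have "1 - real n / real (Suc n) = 1 / real (Suc n)" by (simp add: field_simps)
      finally have "real n * (1 - (real n / real (Suc n)) powr (z - 1)) \<le> real n * (z * (1 / real (Suc n)))"
        by (intro mult_left_mono) auto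
      also have "\<dots> \<le> z" using z_gt_2 by (simp add: field_simps)
      finally have "?bc * (real n * (1 - (real n / real (Suc n)) powr (z - 1))) \<le> ?bc * z"
        using bc by (intro mult_left_mono) auto
      then show ?thesis by (simp add: b_def algebra_simps)
    qed
    let ?bK = "?bc + K / n"
    have Kn: "real n * (?bK - ?bc) = K" using n by simp
    have "exp (n * F r ?bK m) \<le> partition_fn r n ?bK"
      using bc K n mp by (intro partition_fn_ge) auto
    moreover have "n * F r ?bK m = n * ?p + K / z * power_sum r m"
      using Kn n by (simp add: functional_shift[of r ?bK m ?bc] distrib_left)
    ultimately have tot: "exp (n * ?p + K / z * power_sum r m) \<le> partition_fn r n ?bK" by simp
    have "partial_sum r n ?bK D \<le> exp (n * (?bK - ?bc) / z * (power_sum r (uniform r) + e)) * partial_sum r n ?bc D"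
    proof (rule partial_sum_shift)
      fix u assume u: "u \<in> prob_vectors r" "u \<in> D"
      have "power_sum r u \<le> (\<Sum>i<r. x powr z)"
        unfolding power_sum_def using u prob_vectorsD(1)[OF u(1)] z_gt_2
        by (intro sum_mono powr_mono2) (auto simp: D_def less_imp_le)
      then show "power_sum r u \<le> power_sum r (uniform r) + e" using x(1) by simp
    qed (use K n in auto)
    also have "\<dots> \<le> exp (K / z * (power_sum r (uniform r) + e)) * (C' * exp (n * ?p))"
      unfolding Kn by (intro mult_left_mono dis n) auto
    also have "\<dots> = exp (n * ?p + K / z * power_sum r m) / 2"
    proof -
      have "power_sum r m = (power_sum r (uniform r) + e) + e" by (simp add: e_def field_simps)
      then have "exp (K / z * power_sum r m) = exp (K / z * (power_sum r (uniform r) + e)) * exp (K / z * e)"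
        by (simp only: distrib_left exp_add)
      also have "K / z * e = ln (2 * C')" using e z_gt_2 by (simp add: K_def)
      also have "exp (ln (2 * C')) = 2 * C'" using C' by simp
      finally show ?thesis by (simp add: exp_add)
    qed
    finally have "exp (n * ?p + K / z * power_sum r m) / 2 \<le> partial_sum r n ?bK (- D)"
      using tot partial_sum_compl[of r n ?bK D] by simp
    moreover have "exp (n * ?p) \<le> exp (n * ?p + K / z * power_sum r m)"
      using K z_gt_2 power_sum_nonneg[of r m] by simp
    ultimately have "exp (n * ?p) / 2 \<le> partial_sum r n ?bK (- D)" by linarith
    also have "\<dots> \<le> exp (n * (?bK - b) / z * 1) * partial_sum r n b (- D)"
      using b_le K n power_sum_le_1 by (intro partial_sum_shift) (auto intro: add_increasing2)
    also have "\<dots> \<le> exp ((K + ?bc * z) / z) * partial_sum r n b (- D)"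
    proof -
      have "n * (?bK - b) \<le> K + ?bc * z" using gap n by (simp add: algebra_simps)
      then show ?thesis using z_gt_2
        by (intro mult_right_mono partial_sum_nonneg) (auto intro: divide_right_mono)
    qed
    finally have half: "exp (n * ?p) / 2 \<le> exp ((K + ?bc * z) / z) * partial_sum r n b (- D)" .
    have "exp (- (K + ?bc * z) / z) = inverse (exp ((K + ?bc * z) / z))"
      by (simp only: minus_divide_left[symmetric] exp_minus)
    then have c1_eq: "c1 = inverse (exp ((K + ?bc * z) / z)) / 2" by (simp add: c1_def)
    have ord: "c1 * exp (n * ?p) \<le> partial_sum r n b (- D)"
      using half unfolding c1_eq by (simp add: divide_simps mult.commute)
    have "partial_sum r n b D \<le> C' * exp (n * ?p)"
      using partial_sum_mono_temperature[OF b_le] dis[OF n] by (rule order_trans)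
    then have "c1 * partial_sum r n b D \<le> c1 * (C' * exp (n * ?p))" using c1 by (intro mult_left_mono) auto
    also have "\<dots> = C' * (c1 * exp (n * ?p))" by simp
    also have "\<dots> \<le> C' * partial_sum r n b (- D)" using C' by (intro mult_left_mono ord) auto
    finally have "c1 * partition_fn r n b \<le> (c1 + C') * partial_sum r n b (- D)"
      unfolding partial_sum_compl[of r n b D, symmetric] by (simp add: algebra_simps)
    then show ?thesis using c1 C' by (simp add: field_simps)
  qed
  have "0 < c1 / (c1 + C')" using c1 C' by simp
  then show ?thesis using x(2) main unfolding Dc by blast
qed

text \<open>Almost all mass has growth close to at least the disordered value, and a fixed share of
  the mass lies in ordered types with strictly larger growth. The average therefore stays strictly
  above the disordered value, although the effective inverse temperature is below
  \<open>beta_c\<close>.\<close>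

lemma spin_ratio_critical:
  assumes adm: "admissible_rz r z"
  shows "\<exists>c>0. eventually (\<lambda>N. field_sum r (beta_c r z) (uniform r) + c < spin_ratio r (beta_c r z) (Suc N) N) sequentially"
proof -
  let ?bc = "beta_c r z"
  have r: "r \<ge> 2" using adm by (simp add: admissible_rz_def)
  then have r0: "r > 0" by simp
  have bc: "?bc > 0" by (rule beta_c_pos[OF adm])
  obtain x c where x: "1 / r < x" and c: "0 < c" and frac: "\<And>n. n > 0 \<Longrightarrow>
     c * partition_fn r n (?bc * (real n / real (Suc n)) powr (z - 1))
     \<le> partial_sum r n (?bc * (real n / real (Suc n)) powr (z - 1)) {u. \<exists>i<r. x \<le> u i}"
    using ordered_part_fraction[OF adm] by blast
  define ord where "ord = {u :: nat \<Rightarrow> real. \<exists>i<r. x \<le> u i}"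
  define S0 where "S0 = field_sum r ?bc (uniform r)"
  have S0: "S0 > 0" unfolding S0_def by (rule field_sum_pos[OF r0])
  define g where "g = x powr z - (1 / r) powr z - z * (1 / r) powr (z - 1) * (x - 1 / r)"
  have g: "g > 0" using powr_tangent_strict[of "1 / r" x] x r0 by (simp add: g_def)
  have val: "F r ?bc m = F r ?bc (uniform r)" if "m \<in> maximizers r ?bc" for m
    using that uniform_maximizer_beta_c[OF r] by (auto simp: maximizers_def intro: order_antisym)
  have fs: "field_sum r ?bc m = S0 * exp (?bc * (1 - 1 / z) * (power_sum r m - power_sum r (uniform r)))"
    if "m \<in> maximizers r ?bc" for m
    using maximizer_field_sum[OF that] maximizer_field_sum[OF uniform_maximizer_beta_c[OF r]] val[OF that] bc
    by (simp add: S0_def algebra_simps flip: exp_add)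
  have bz: "?bc * (1 - 1 / z) > 0" using bc z_gt_2 by simp
  have all_ge: "S0 \<le> field_sum r ?bc m" if "m \<in> maximizers r ?bc" for m
    using fs[OF that] power_sum_uniform_le[OF maximizersD(1)[OF that]] bz S0 by (simp add: mult_le_cancel_left1)
  define s1 where "s1 = S0 * exp (?bc * (1 - 1 / z) * g)"
  have s1: "S0 < s1" using S0 bz g by (simp add: s1_def mult_less_cancel_left1)
  have ord_ge: "s1 \<le> field_sum r ?bc m" if m: "m \<in> maximizers r ?bc" "m \<in> ord" for m
  proof -
    obtain i where "i < r" "x \<le> m i" using m(2) by (auto simp: ord_def)
    then have "g \<le> power_sum r m - power_sum r (uniform r)"
      using power_sum_gap[OF maximizersD(1)[OF m(1)] _ _ x] unfolding g_def by fastforce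
    then have "?bc * (1 - 1 / z) * g \<le> ?bc * (1 - 1 / z) * (power_sum r m - power_sum r (uniform r))"
      using bz by (intro mult_left_mono) auto
    then show ?thesis using fs[OF m(1)] S0 by (simp add: s1_def)
  qed
  define d where "d = (s1 - S0) / 2"
  have d: "d > 0" using s1 by (simp add: d_def)
  \<comment> \<open>The baseline loses at most \<open>2 * e \<le> d * c / 2\<close>, while the
    ordered share gains \<open>d * c\<close>; so more than \<open>d * c / 4\<close> remains in the
    limit. The other bound, by \<open>S0 / 2\<close>, keeps the reduced growth \<open>h\<close>
    nonnegative.\<close>
  define e where "e = min (d * c / 4) (S0 / 2)"
  have e: "e > 0" "e \<le> d * c / 4" "e \<le> S0 / 2" using d c S0 by (auto simp: e_def)
  \<comment> \<open>\<open>E1\<close> collects ordered types with too small a field sum,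
    \<open>E2\<close> types below the disordered value. Neither contains a maximizer, so both have
    vanishing probability.\<close>
  define E1 where "E1 = ord \<inter> {u. field_sum r ?bc u \<le> S0 + d}"
  define E2 where "E2 = {u. field_sum r ?bc u \<le> S0 - e}"
  have cl: "seq_closed r E1" "seq_closed r E2"
  proof -
    show "seq_closed r E1"
      using seq_closed_above[of r x] seq_closed_field_sum(1)[of r ?bc "S0 + d"]
      unfolding E1_def ord_def seq_closed_def by blast
    show "seq_closed r E2" unfolding E2_def by (rule seq_closed_field_sum)
  qed
  have dj: "E1 \<inter> maximizers r ?bc = {}" "E2 \<inter> maximizers r ?bc = {}"
  proof -
    have "m \<notin> maximizers r ?bc" if "m \<in> E1" for m
    proof
      assume "m \<in> maximizers r ?bc"
      then have "s1 \<le> field_sum r ?bc m" using that by (intro ord_ge) (simp_all add: E1_def)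
      moreover have "field_sum r ?bc m \<le> S0 + d" using that by (simp add: E1_def)
      moreover have "S0 + d < s1" using s1 by (simp add: d_def field_simps)
      ultimately show False by linarith
    qed
    then show "E1 \<inter> maximizers r ?bc = {}" by blast
    have "m \<notin> maximizers r ?bc" if "m \<in> E2" for m
    proof
      assume "m \<in> maximizers r ?bc"
      then have "S0 \<le> field_sum r ?bc m" by (rule all_ge)
      moreover have "field_sum r ?bc m \<le> S0 - e" using that by (simp add: E2_def)
      ultimately show False using e(1) by linarith
    qed
    then show "E2 \<inter> maximizers r ?bc = {}" by blast
  qed
  have N: "filterlim Suc at_top sequentially" by (rule filterlim_Suc)
  have "(\<lambda>N. 1 - 1 / real (Suc N)) \<longlonglongrightarrow> 1 - 0"
    by (intro tendsto_intros LIMSEQ_Suc lim_1_over_n)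
  moreover have "1 - 1 / real (Suc N) = real N / real (Suc N)" for N by (simp add: field_simps)
  ultimately have nu: "(\<lambda>N. real N / real (Suc N)) \<longlonglongrightarrow> 1" by simp
  define b where "b N = ?bc * (real N / real (Suc N)) powr (z - 1)" for N
  have "b \<longlonglongrightarrow> ?bc * 1 powr (z - 1)" unfolding b_def using nu by (intro tendsto_intros) auto
  then have blim: "b \<longlonglongrightarrow> ?bc" by simp
  have b0: "0 \<le> b N" for N using bc by (simp add: b_def)
  define q where "q E N = partial_sum r N (b N) E / partition_fn r N (b N)" for E N
  have q1: "q E1 \<longlonglongrightarrow> 0" and q2: "q E2 \<longlonglongrightarrow> 0"
    unfolding q_def using concentration[OF blim b0 filterlim_ident _ _ r0] cl dj by blast+
  have "(\<lambda>N. (S0 - 2 * e) * (1 - q E2 N) + d * (c - q E1 N - q E2 N)) \<longlonglongrightarrow> (S0 - 2 * e) * (1 - 0) + d * (c - 0 - 0)"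
    by (intro tendsto_intros q1 q2)
  moreover have "S0 + d * c / 4 < (S0 - 2 * e) * (1 - 0) + d * (c - 0 - 0)"
  proof -
    have "0 < d * c" using d c by simp
    then show ?thesis unfolding diff_zero mult_1_right using e(2) by linarith
  qed
  ultimately have "eventually (\<lambda>N. S0 + d * c / 4 < (S0 - 2 * e) * (1 - q E2 N) + d * (c - q E1 N - q E2 N)) sequentially"
    by (rule order_tendstoD)
  moreover have "eventually (\<lambda>N. \<forall>xs\<in>configs r N.
    \<bar>growth r (coupling ?bc (Suc N)) xs - field_sum r (?bc * 1 powr (z - 1)) (emp xs)\<bar> < e) sequentially"
    by (rule growth_uniform[OF _ N nu]) (use bc e in auto)
  moreover have "eventually (\<lambda>N. N > (0::nat)) sequentially" by (rule eventually_gt_at_top)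
  ultimately have "eventually (\<lambda>N. S0 + d * c / 4 < spin_ratio r ?bc (Suc N) N) sequentially"
  proof eventually_elim
    case (elim N)
    let ?L = "configs r N" let ?w = "config_weight r (b N)" let ?f = "growth r (coupling ?bc (Suc N))"
    define T where "T E = {xs \<in> ?L. emp xs \<in> E}" for E
    define U where "U = T (ord - E1 - E2)"
    have TL: "T E \<subseteq> ?L" for E by (auto simp: T_def)
    have Z: "partition_fn r N (b N) > 0" by (rule partition_fn_pos[OF r0])
    have close: "\<bar>?f xs - field_sum r ?bc (emp xs)\<bar> < e" if "xs \<in> ?L" for xs using elim(2) that by simp
    \<comment> \<open>Taking the gain \<open>d\<close> off the good ordered configurations lets the
      baseline and the gain be averaged separately.\<close>
    define h where "h xs = ?f xs - (if xs \<in> U then d else 0)" for xs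
    have h0: "0 \<le> h xs" "xs \<notin> T E2 \<Longrightarrow> S0 - 2 * e \<le> h xs" if xs: "xs \<in> ?L" for xs
    proof -
      show "0 \<le> h xs"
      proof (cases "xs \<in> U")
        case True
        then have "S0 + d < field_sum r ?bc (emp xs)" by (auto simp: U_def T_def E1_def)
        then show ?thesis using close[OF xs] True e S0 by (simp add: h_def)
      qed (simp add: h_def growth_nonneg)
      assume "xs \<notin> T E2"
      then have 1: "S0 - e < field_sum r ?bc (emp xs)" using xs by (auto simp: T_def E2_def)
      show "S0 - 2 * e \<le> h xs"
      proof (cases "xs \<in> U")
        case True
        then have "S0 + d < field_sum r ?bc (emp xs)" by (auto simp: U_def T_def E1_def)
        then show ?thesis using close[OF xs] True e by (simp add: h_def)
      qed (use 1 close[OF xs] in \<open>simp add: h_def\<close>)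
    qed
    have "(S0 - 2 * e) * (1 - sum ?w (T E2) / sum ?w ?L) \<le> (\<Sum>xs\<in>?L. ?w xs * h xs) / sum ?w ?L"
      by (rule weighted_average_lower)
         (use TL h0 Z config_weight_pos in \<open>auto simp: partition_fn_def less_imp_le\<close>)
    then have low: "(S0 - 2 * e) * (1 - q E2 N) \<le> (\<Sum>xs\<in>?L. ?w xs * h xs) / partition_fn r N (b N)"
      by (simp add: q_def partial_sum_def partition_fn_def T_def)
    have split: "(\<Sum>xs\<in>?L. ?w xs * ?f xs) = (\<Sum>xs\<in>?L. ?w xs * h xs) + d * sum ?w U"
    proof -
      have "(\<Sum>xs\<in>?L. ?w xs * ?f xs) = (\<Sum>xs\<in>?L. ?w xs * h xs + (if xs \<in> U then d * ?w xs else 0))"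
        by (intro sum.cong) (auto simp: h_def algebra_simps)
      also have "\<dots> = (\<Sum>xs\<in>?L. ?w xs * h xs) + (\<Sum>xs\<in>?L \<inter> U. d * ?w xs)"
        by (simp add: sum.distrib sum.inter_restrict)
      also have "?L \<inter> U = U" using TL by (auto simp: U_def)
      finally show ?thesis by (simp add: sum_distrib_left)
    qed
    have "sum ?w (T ord) \<le> sum ?w (U \<union> (T E1 \<union> T E2))"
      using TL finite_subset[OF TL] config_weight_pos
      by (intro sum_mono2) (auto simp: U_def T_def less_imp_le intro: finite_subset)
    also have "\<dots> \<le> sum ?w U + (sum ?w (T E1) + sum ?w (T E2))"
    proof -
      have fin: "finite U" "finite (T E1)" "finite (T E2)"
        using finite_subset[OF TL] by (auto simp: U_def)
      have "sum ?w (A \<union> B) \<le> sum ?w A + sum ?w B" if "finite A" "finite B" for A B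
        using sum.union_inter[OF that, of ?w] sum_nonneg[of "A \<inter> B" ?w] config_weight_pos
        by (simp add: less_imp_le)
      from this[of U "T E1 \<union> T E2"] this[of "T E1" "T E2"] fin show ?thesis by simp
    qed
    finally have "partial_sum r N (b N) ord \<le> sum ?w U + partial_sum r N (b N) E1 + partial_sum r N (b N) E2"
      by (simp add: partial_sum_def T_def)
    moreover have "c * partition_fn r N (b N) \<le> partial_sum r N (b N) ord"
      using frac[of N] elim(3) by (simp add: b_def ord_def)
    ultimately have "c * partition_fn r N (b N) - partial_sum r N (b N) E1 - partial_sum r N (b N) E2 \<le> sum ?w U" by simp
    then have "(c * partition_fn r N (b N) - partial_sum r N (b N) E1 - partial_sum r N (b N) E2) / partition_fn r N (b N)
        \<le> sum ?w U / partition_fn r N (b N)"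
      using Z by (intro divide_right_mono) auto
    then have "c - q E1 N - q E2 N \<le> sum ?w U / partition_fn r N (b N)"
      using Z by (simp add: q_def diff_divide_distrib)
    then have "d * (c - q E1 N - q E2 N) \<le> d * (sum ?w U / partition_fn r N (b N))"
      using d by (intro mult_left_mono) auto
    moreover have "spin_ratio r ?bc (Suc N) N = (\<Sum>xs\<in>?L. ?w xs * ?f xs) / partition_fn r N (b N)"
      unfolding spin_ratio_average partition_fn_def b_def
      using coupling_weight[of _ r N "Suc N" ?bc] elim(3)
      by (intro arg_cong2[where f = "(/)"] sum.cong) auto
    ultimately show ?case using low elim(1) unfolding split by (simp add: add_divide_distrib)
  qed
  then show ?thesis using d c unfolding S0_def by (intro exI[of _ "d * c / 4"]) simp
qed

end

section \<open>The fuzzy measure\<close>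

text \<open>Generalising over \<open>\<Phi>\<close> lets a prepended spin be absorbed into the factor of its class.\<close>
lemma sum_compatible_factorization:
  fixes \<Phi> :: "'a set \<Rightarrow> 'a list \<Rightarrow> 'b::comm_semiring_1"
  assumes P: "finite P" "disjoint P" "\<And>A. A \<in> P \<Longrightarrow> finite A"
  shows "set eta \<subseteq> P \<Longrightarrow>
    (\<Sum>xs\<in>{xs. list_all2 (\<lambda>k A. k \<in> A) xs eta}. \<Prod>A\<in>P. \<Phi> A (filter (\<lambda>x. x \<in> A) xs))
      = (\<Prod>A\<in>P. \<Sum>ys\<in>lists_of A (count_list eta A). \<Phi> A ys)"
proof (induction eta arbitrary: \<Phi>)
  case Nil
  then show ?case by simp
next
  case (Cons A eta)
  then have A: "A \<in> P" and eta: "set eta \<subseteq> P" by auto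
  let ?S = "\<lambda>eta. {xs. list_all2 (\<lambda>k A. k \<in> A) xs eta}"
  define \<Psi> where "\<Psi> a = \<Phi>(A := \<lambda>ys. \<Phi> A (a # ys))" for a
  have "?S (A # eta) = (\<lambda>(a, xs). a # xs) ` (A \<times> ?S eta)"
    by (auto simp: list_all2_Cons2 image_def)
  then have "(\<Sum>xs\<in>?S (A # eta). \<Prod>B\<in>P. \<Phi> B (filter (\<lambda>x. x \<in> B) xs))
      = (\<Sum>(a, xs)\<in>A \<times> ?S eta. \<Prod>B\<in>P. \<Phi> B (filter (\<lambda>x. x \<in> B) (a # xs)))"
    by (simp add: sum.reindex inj_on_def case_prod_unfold)
  also have "\<dots> = (\<Sum>a\<in>A. \<Sum>xs\<in>?S eta. \<Prod>B\<in>P. \<Phi> B (filter (\<lambda>x. x \<in> B) (a # xs)))"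
    by (simp add: sum.cartesian_product)
  also have "\<dots> = (\<Sum>a\<in>A. \<Sum>xs\<in>?S eta. \<Prod>B\<in>P. \<Psi> a B (filter (\<lambda>x. x \<in> B) xs))"
  proof (intro sum.cong prod.cong refl)
    fix a xs B assume a: "a \<in> A" and B: "B \<in> P"
    have "a \<in> B \<longleftrightarrow> B = A" using disjointD[OF P(2) A B] a by blast
    then show "\<Phi> B (filter (\<lambda>x. x \<in> B) (a # xs)) = \<Psi> a B (filter (\<lambda>x. x \<in> B) xs)"
      using a by (simp add: \<Psi>_def)
  qed
  also have "\<dots> = (\<Sum>a\<in>A. \<Prod>B\<in>P. \<Sum>ys\<in>lists_of B (count_list eta B). \<Psi> a B ys)"
    by (intro sum.cong refl Cons.IH eta)
  also have "\<dots> = (\<Sum>a\<in>A. (\<Sum>ys\<in>lists_of A (count_list eta A). \<Phi> A (a # ys))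
      * (\<Prod>B\<in>P - {A}. \<Sum>ys\<in>lists_of B (count_list eta B). \<Phi> B ys))"
    by (intro sum.cong refl, subst prod.remove[OF P(1) A]) (simp add: \<Psi>_def)
  also have "\<dots> = (\<Sum>ys\<in>lists_of A (Suc (count_list eta A)). \<Phi> A ys)
      * (\<Prod>B\<in>P - {A}. \<Sum>ys\<in>lists_of B (count_list eta B). \<Phi> B ys)"
    by (simp add: sum_lists_of_Suc sum_distrib_right)
  also have "\<dots> = (\<Prod>B\<in>P. \<Sum>ys\<in>lists_of B (count_list (A # eta) B). \<Phi> B ys)"
  proof -
    have "(\<Prod>B\<in>P - {A}. \<Sum>ys\<in>lists_of B (count_list (A # eta) B). \<Phi> B ys)
        = (\<Prod>B\<in>P - {A}. \<Sum>ys\<in>lists_of B (count_list eta B). \<Phi> B ys)"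
      by (intro prod.cong refl) auto
    then show ?thesis
      unfolding prod.remove[OF P(1) A, of "\<lambda>B. \<Sum>ys\<in>lists_of B (count_list (A # eta) B). \<Phi> B ys"] by simp
  qed
  finally show ?case .
qed

lemma finite_partition_classes:
  assumes "partition_on {1..q::nat} P"
  shows "finite P" "A \<in> P \<Longrightarrow> finite A"
proof -
  show "finite P" using finite_elements[OF _ assms] by simp
  have "finite (\<Union>P)" using partition_onD1[OF assms] by (metis finite_atLeastAtMost)
  then show "A \<in> P \<Longrightarrow> finite A" by (meson Union_upper finite_subset)
qed

lemma bij_betw_map_lists_of:
  assumes "bij_betw h B A"
  shows "bij_betw (map h) (lists_of B n) (lists_of A n)"
proof -
  have inj: "inj_on h B" and im: "A = h ` B" using assms by (auto simp: bij_betw_def)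
  have "inj_on (map h) (lists_of B n)"
  proof (rule inj_onI)
    fix xs ys assume "xs \<in> lists_of B n" "ys \<in> lists_of B n" "map h xs = map h ys"
    then show "xs = ys"
      using inj by (intro map_inj_on[of h xs ys]) (auto simp: lists_of_def intro: inj_on_subset)
  qed
  moreover have "map h ` lists_of B n = lists_of A n"
  proof -
    have "ys \<in> map h ` lists_of B n" if "ys \<in> lists_of A n" for ys
    proof -
      have "ys \<in> map h ` lists B" using that unfolding lists_image[symmetric] im by (auto simp: lists_of_def)
      then show ?thesis using that by (auto simp: lists_of_def)
    qed
    moreover have "map h xs \<in> lists_of A n" if "xs \<in> lists_of B n" for xs
      using that by (auto simp: lists_of_def im)
    ultimately show ?thesis by blast
  qed
  ultimately show ?thesis by (simp add: bij_betw_def)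
qed

lemma count_list_filter_mem: "i \<in> A \<Longrightarrow> count_list (filter (\<lambda>x. x \<in> A) xs) i = count_list xs i"
  by (induction xs) auto

lemma count_list_map_inj:
  assumes "inj_on h B" "set xs \<subseteq> B" "b \<in> B"
  shows "count_list (map h xs) (h b) = count_list xs b"
  using assms by (induction xs) (auto dest: inj_onD)

context potts_exponent begin

lemma class_sum_card:
  assumes "finite A"
  shows "class_sum A c n = class_sum {..<card A} c n"
proof -
  obtain h where h: "bij_betw h {..<card A} A"
    using ex_bij_betw_nat_finite[OF assms] by (auto simp: atLeast0LessThan)
  have inj: "inj_on h {..<card A}" and im: "h ` {..<card A} = A" using h by (auto simp: bij_betw_def)
  have "bij_betw (map h) (lists_of {..<card A} n) (lists_of A n)" by (rule bij_betw_map_lists_of[OF h])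
  then have "class_sum A c n = (\<Sum>xs\<in>lists_of {..<card A} n. exp (c * (\<Sum>i\<in>A. real (count_list (map h xs) i) powr z)))"
    unfolding class_sum_def by (rule sum.reindex_bij_betw[symmetric])
  also have "\<dots> = class_sum {..<card A} c n"
    unfolding class_sum_def
  proof (rule sum.cong[OF refl])
    fix xs assume "xs \<in> lists_of {..<card A} n"
    then have xs: "set xs \<subseteq> {..<card A}" by (simp add: lists_of_def)
    have "(\<Sum>i\<in>A. real (count_list (map h xs) i) powr z) = (\<Sum>i<card A. real (count_list xs i) powr z)"
      using sum.reindex_bij_betw[OF h, of "\<lambda>i. real (count_list (map h xs) i) powr z"]
        count_list_map_inj[OF inj xs] by simp
    then show "exp (c * (\<Sum>i\<in>A. real (count_list (map h xs) i) powr z))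
        = exp (c * (\<Sum>i<card A. real (count_list xs i) powr z))" by simp
  qed
  finally show ?thesis .
qed

lemma potts_weight_factor:
  assumes P: "partition_on {1..q} P" and N: "length xi = N" "N > 0"
  shows "potts_weight beta q z xi = (\<Prod>A\<in>P. exp (coupling beta N * (\<Sum>i\<in>A. real (count_list (filter (\<lambda>x. x \<in> A) xi) i) powr z)))"
proof -
  have fin: "finite P" "\<And>A. A \<in> P \<Longrightarrow> finite A"
    using finite_partition_classes[OF P] by auto
  have "real N powr z = real N powr (z - 1) * real N" by (rule powr_split) simp
  moreover have "real N powr (1 - z) = 1 / real N powr (z - 1)"
    using powr_minus_divide[of "real N" "z - 1"] by simp
  ultimately have c: "real N * beta / z * (real k / real N) powr z = coupling beta N * real k powr z" for k
    using N(2) by (simp add: coupling_def powr_divide)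
  have "real N * beta / z * (\<Sum>i=1..q. emp xi i powr z) = coupling beta N * (\<Sum>i=1..q. real (count_list xi i) powr z)"
    unfolding sum_distrib_left emp_count N(1) by (intro sum.cong refl c)
  also have "(\<Sum>i=1..q. real (count_list xi i) powr z) = (\<Sum>A\<in>P. \<Sum>i\<in>A. real (count_list xi i) powr z)"
    unfolding partition_onD1[OF P]
    using partition_onD2[OF P] fin by (intro sum.Union_disjoint[unfolded comp_def]) (auto simp: disjoint_def)
  also have "\<dots> = (\<Sum>A\<in>P. \<Sum>i\<in>A. real (count_list (filter (\<lambda>x. x \<in> A) xi) i) powr z)"
    by (simp add: count_list_filter_mem cong: sum.cong)
  finally show ?thesis
    using fin(1) by (simp add: potts_weight_def N(1) sum_distrib_left exp_sum)
qed

lemma fuzzy_measure_eq: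
  assumes P: "partition_on {1..q} P" and eta: "set eta \<subseteq> P" "eta \<noteq> []"
  shows "fuzzy_measure beta q z P eta =
    (\<Prod>A\<in>P. class_sum A (coupling beta (length eta)) (count_list eta A))
      / (\<Sum>zeta\<in>potts_configs q (length eta). potts_weight beta q z zeta)"
proof -
  have fin: "finite P" "\<And>A. A \<in> P \<Longrightarrow> finite A"
    using finite_partition_classes[OF P] by auto
  have "{xi \<in> potts_configs q (length eta). list_all2 (\<lambda>k A. k \<in> A) xi eta} = {xi. list_all2 (\<lambda>k A. k \<in> A) xi eta}"
  proof -
    have "xi \<in> potts_configs q (length eta)" if "list_all2 (\<lambda>k A. k \<in> A) xi eta" for xi
    proof -
      have "xi ! i \<in> {1..q}" if "i < length xi" for i
      proof -
        have "xi ! i \<in> eta ! i" "eta ! i \<in> P"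
          using \<open>list_all2 _ xi eta\<close> eta(1) that by (auto simp: list_all2_conv_all_nth)
        then show ?thesis using partition_onD1[OF P] by blast
      qed
      then have "set xi \<subseteq> {1..q}" by (metis in_set_conv_nth subsetI)
      then show ?thesis using list_all2_lengthD[OF that] by (simp add: potts_configs_def)
    qed
    then show ?thesis by blast
  qed
  then have "fuzzy_measure beta q z P eta =
      (\<Sum>xi\<in>{xi. list_all2 (\<lambda>k A. k \<in> A) xi eta}. potts_weight beta q z xi)
      / (\<Sum>zeta\<in>potts_configs q (length eta). potts_weight beta q z zeta)"
    by (simp add: fuzzy_measure_def potts_measure_def sum_divide_distrib)
  also have "(\<Sum>xi\<in>{xi. list_all2 (\<lambda>k A. k \<in> A) xi eta}. potts_weight beta q z xi)
      = (\<Sum>xi\<in>{xi. list_all2 (\<lambda>k A. k \<in> A) xi eta}.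
          \<Prod>A\<in>P. exp (coupling beta (length eta) * (\<Sum>i\<in>A. real (count_list (filter (\<lambda>x. x \<in> A) xi) i) powr z)))"
    using eta(2) by (intro sum.cong refl potts_weight_factor[OF P]) (auto dest: list_all2_lengthD)
  also have "\<dots> = (\<Prod>A\<in>P. class_sum A (coupling beta (length eta)) (count_list eta A))"
    unfolding class_sum_def
    using sum_compatible_factorization[OF fin(1) partition_onD2[OF P] fin(2) eta(1),
      of "\<lambda>A ys. exp (coupling beta (length eta) * (\<Sum>i\<in>A. real (count_list ys i) powr z))"] by simp
  finally show ?thesis .
qed

text \<open>Prepending a spin of class \<open>B\<close> changes only the factor of \<open>B\<close>;
  the product \<open>V\<close> over the old counts cancels. All factors use the coupling for the
  full number \<open>Suc (length eta)\<close> of sites.\<close>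

lemma fuzzy_cond_eq:
  assumes P: "partition_on {1..q} P" and eta: "set eta \<subseteq> P" and A: "A \<in> P"
  shows "fuzzy_cond beta q z P A eta = spin_ratio (card A) beta (Suc (length eta)) (count_list eta A)
     / (\<Sum>B\<in>P. spin_ratio (card B) beta (Suc (length eta)) (count_list eta B))"
proof -
  have fin: "finite P" "\<And>A. A \<in> P \<Longrightarrow> finite A"
    using finite_partition_classes[OF P] by auto
  have ne: "A \<noteq> {}" if "A \<in> P" for A using partition_onD3[OF P] that by blast
  let ?N = "Suc (length eta)" let ?k = "coupling beta ?N"
  let ?Z = "\<Sum>zeta\<in>potts_configs q ?N. potts_weight beta q z zeta"
  define V where "V = (\<Prod>B\<in>P. class_sum B ?k (count_list eta B)) / ?Z"
  have Z: "?Z > 0"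
  proof (rule sum_pos)
    have "potts_configs q ?N = lists_of {1..q} ?N" by (auto simp: potts_configs_def lists_of_def)
    then show "finite (potts_configs q ?N)" by simp
    obtain x where "x \<in> A" using ne[OF A] by blast
    then have "x \<in> {1..q}" using partition_onD1[OF P] A by blast
    then have "replicate ?N x \<in> potts_configs q ?N" by (auto simp: potts_configs_def)
    then show "potts_configs q ?N \<noteq> {}" by blast
  qed (simp add: potts_weight_def)
  have V: "V > 0" unfolding V_def using Z fin ne by (intro divide_pos_pos prod_pos class_sum_pos) auto
  have step: "fuzzy_measure beta q z P (B # eta) = V * spin_ratio (card B) beta ?N (count_list eta B)" if B: "B \<in> P" for B
  proof -
    have "fuzzy_measure beta q z P (B # eta) = (\<Prod>C\<in>P. class_sum C ?k (count_list (B # eta) C)) / ?Z"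
      using fuzzy_measure_eq[OF P, of "B # eta" beta] eta B by simp
    also have "(\<Prod>C\<in>P. class_sum C ?k (count_list (B # eta) C))
        = class_sum B ?k (Suc (count_list eta B)) * (\<Prod>C\<in>P - {B}. class_sum C ?k (count_list eta C))"
    proof -
      have "(\<Prod>C\<in>P - {B}. class_sum C ?k (count_list (B # eta) C)) = (\<Prod>C\<in>P - {B}. class_sum C ?k (count_list eta C))"
        by (intro prod.cong refl) auto
      then show ?thesis
        unfolding prod.remove[OF fin(1) B, of "\<lambda>C. class_sum C ?k (count_list (B # eta) C)"] by simp
    qed
    also have "class_sum B ?k (Suc (count_list eta B))
        = spin_ratio (card B) beta ?N (count_list eta B) * class_sum B ?k (count_list eta B)"
      using class_sum_pos[OF fin(2)[OF B] ne[OF B], of ?k "count_list eta B"]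
      unfolding spin_ratio_def class_sum_card[OF fin(2)[OF B]] by simp
    finally show ?thesis
      unfolding V_def by (subst prod.remove[OF fin(1) B]) (simp add: mult_ac)
  qed
  show ?thesis
    unfolding fuzzy_cond_def using step[OF A] V
    by (simp add: step sum_distrib_left[symmetric] cong: sum.cong)
qed

end

section \<open>Gibbs property\<close>

context potts_exponent begin

lemma spin_ratio_le:
  assumes "r > 0" "0 \<le> beta" "n < N"
  shows "spin_ratio r beta N n \<le> real r * exp beta"
proof -
  have gr: "growth r (coupling beta N) xs \<le> real r * exp beta" if xs: "xs \<in> configs r n" for xs
  proof -
    have "coupling beta N * (real (count_list xs j + 1) powr z - real (count_list xs j) powr z) \<le> beta" for j
    proof -
      have "count_list xs j \<le> n" using count_le_length[of xs j] xs by (simp add: lists_of_def)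
      then have "(real (count_list xs j + 1) / real N) powr (z - 1) \<le> 1"
        using assms(3) z_gt_2 by (intro powr_le1) auto
      then have "beta * (real (count_list xs j + 1) / real N) powr (z - 1) \<le> beta"
        using assms(2) by (simp add: mult_left_le)
      then show ?thesis using growth_term_bounds(2)[OF assms(2), of N "count_list xs j"] assms(3) by simp
    qed
    then have "growth r (coupling beta N) xs \<le> (\<Sum>j<r. exp beta)"
      unfolding growth_def by (intro sum_mono) simp
    then show ?thesis by simp
  qed
  have "spin_ratio r beta N n \<le> real r * exp beta + real r * exp beta * (sum (\<lambda>_. 0) {} / 1)"
    unfolding spin_ratio_average
    by (rule order_trans[OF weighted_average_upper[where T = "{}" and c = "real r * exp beta" and K = "real r * exp beta"]])
       (use gr class_sum_pos[of "{..<r}"] assms(1) in \<open>auto simp: class_sum_def\<close>)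
  then show ?thesis by simp
qed

lemma spin_ratio_pos: "r > 0 \<Longrightarrow> 0 < spin_ratio r beta N n"
  unfolding spin_ratio_def by (intro divide_pos_pos class_sum_pos) auto

text \<open>The absence of jumps: the interval from 0 to \<open>beta\<close> is the range of
  effective inverse temperatures over all class fractions. Several maximizers are allowed as long as
  their field sums agree.\<close>

definition unique_field :: "nat \<Rightarrow> real \<Rightarrow> bool" where
  "unique_field r beta \<longleftrightarrow> (\<forall>b. 0 \<le> b \<longrightarrow> b \<le> beta \<longrightarrow>
     (\<forall>m\<in>maximizers r b. \<forall>m'\<in>maximizers r b. field_sum r b m = field_sum r b m'))"

text \<open>Under \<open>unique_field\<close> the chosen maximizer does not matter for inverse
  temperatures in the interval.\<close>

definition limit_field :: "nat \<Rightarrow> real \<Rightarrow> real" where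
  "limit_field r b = field_sum r b (SOME m. m \<in> maximizers r b)"

lemma unique_field_disordered:
  assumes "2 \<le> r" "beta < beta_c r z"
  shows "unique_field r beta"
  unfolding unique_field_def
proof (intro allI impI ballI)
  fix b m m' assume "b \<le> beta" and m: "m \<in> maximizers r b" "m' \<in> maximizers r b"
  then have dis: "disordered r b" using disordered_below_beta_c[of r b] assms by simp
  have "field_sum r b w = field_sum r b (uniform r)" if "w \<in> maximizers r b" for w
    unfolding field_sum_def uniform_def
    using maximizers_disordered[OF dis that] by (intro sum.cong) auto
  then show "field_sum r b m = field_sum r b m'" using m by simp
qed

lemma unique_field_one: "unique_field 1 beta"
proof -
  have "field_sum 1 b m = exp b" if "m \<in> maximizers 1 b" for m b
  proof -
    have "m 0 = 1" using prob_vectorsD(2)[OF maximizersD(1)[OF that]] by simp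
    then show ?thesis by (simp add: field_sum_def)
  qed
  then show ?thesis unfolding unique_field_def by metis
qed

lemma unique_field_two: "z \<le> 4 \<Longrightarrow> unique_field 2 beta"
  unfolding unique_field_def using two_state_field_sum_unique by blast

lemma limit_field_eq:
  assumes "unique_field r beta" "0 \<le> b" "b \<le> beta" "m \<in> maximizers r b"
  shows "field_sum r b m = limit_field r b"
proof -
  have "(SOME m. m \<in> maximizers r b) \<in> maximizers r b" using someI[of "\<lambda>m. m \<in> maximizers r b", OF assms(4)] .
  then show ?thesis using assms unfolding unique_field_def limit_field_def by blast
qed

text \<open>Maximizers along a bad subsequence accumulate at a maximizer of the limit problem, whose
  field sum is the unique one.\<close>

lemma limit_field_continuous:
  assumes r: "r > 0" and uf: "unique_field r beta" and bs: "\<And>n. 0 \<le> bs n" "\<And>n. bs n \<le> beta" "bs \<longlonglongrightarrow> b"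
  shows "(\<lambda>n. limit_field r (bs n)) \<longlonglongrightarrow> limit_field r b"
proof (rule ccontr)
  assume "\<not> ?thesis"
  then obtain e where e: "e > 0" "\<not> eventually (\<lambda>n. dist (limit_field r (bs n)) (limit_field r b) < e) sequentially"
    by (auto simp: tendsto_iff)
  from not_eventually_sequentiallyD[OF e(2)] obtain s where s: "strict_mono (s::nat\<Rightarrow>nat)"
    "\<And>n. \<not> dist (limit_field r (bs (s n))) (limit_field r b) < e" by blast
  have "\<forall>n. \<exists>m. m \<in> maximizers r (bs (s n))" using maximizers_nonempty[OF r] by blast
  then obtain m where m: "\<And>n. m n \<in> maximizers r (bs (s n))" by metis
  have mp: "m n \<in> prob_vectors r" for n using maximizersD(1)[OF m] .
  obtain s' u where s': "strict_mono (s'::nat\<Rightarrow>nat)" "\<And>i. i < r \<Longrightarrow> (\<lambda>n. m (s' n) i) \<longlonglongrightarrow> u i"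
    using prob_vectors_subseq[of m r] mp by blast
  have "(\<lambda>n. bs (s n)) \<longlonglongrightarrow> b" using LIMSEQ_subseq_LIMSEQ[OF bs(3) s(1)] by (simp add: o_def)
  from LIMSEQ_subseq_LIMSEQ[OF this s'(1)] have bl: "(\<lambda>n. bs (s (s' n))) \<longlonglongrightarrow> b" by (simp add: o_def)
  have u: "u \<in> maximizers r b" by (rule maximizers_limit[of "\<lambda>n. m (s' n)", OF m bl s'(2)])
  have b: "0 \<le> b" "b \<le> beta" using bs LIMSEQ_le_const[OF bs(3)] LIMSEQ_le_const2[OF bs(3)] by blast+
  have "(\<lambda>n. field_sum r (bs (s (s' n))) (m (s' n))) \<longlonglongrightarrow> field_sum r b u"
    by (rule tendsto_field_sum[OF s'(2) bl mp])
  then have "(\<lambda>n. limit_field r (bs (s (s' n)))) \<longlonglongrightarrow> limit_field r b"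
    using limit_field_eq[OF uf bs(1,2) m] limit_field_eq[OF uf b u] by simp
  then have "eventually (\<lambda>n. dist (limit_field r (bs (s (s' n)))) (limit_field r b) < e) sequentially"
    using e(1) by (rule tendstoD)
  then show False using s(2) by (auto simp: eventually_sequentially)
qed

lemma effective_temperature_bounds:
  assumes "0 \<le> beta" "0 \<le> x" "x \<le> 1"
  shows "0 \<le> beta * x powr (z - 1)" "beta * x powr (z - 1) \<le> beta"
  using assms z_gt_2 powr_le1[of "z - 1" x] by (auto simp: mult_left_le)

text \<open>Gibbsianness speaks of fractions of the N conditioning sites, the spin ratios of
  fractions of all N + 1.\<close>

lemma tendsto_over_Suc:
  assumes "(\<lambda>N. real (n N) / real N) \<longlonglongrightarrow> x" "\<And>N. n N \<le> N"
  shows "(\<lambda>N. real (n N) / real (Suc N)) \<longlonglongrightarrow> x"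
proof -
  have "(\<lambda>N. 1 - 1 / real (Suc N)) \<longlonglongrightarrow> 1 - 0"
    by (intro tendsto_intros LIMSEQ_Suc lim_1_over_n)
  then have "(\<lambda>N. real (n N) / real N * (1 - 1 / real (Suc N))) \<longlonglongrightarrow> x * (1 - 0)"
    by (intro tendsto_mult assms(1))
  moreover have "real (n N) / real N * (1 - 1 / real (Suc N)) = real (n N) / real (Suc N)" for N
    using assms(2)[of N] by (cases "N = 0") (auto simp: field_simps)
  ultimately show ?thesis by simp
qed

text \<open>Every spin ratio converges to a continuous function of its class fraction, and the
  normalising sum has a positive limit; the quotient is the limiting kernel.\<close>

lemma fuzzy_gibbs_if_unique_field:
  assumes P: "partition_on {1..q} P" and beta: "0 \<le> beta"
    and uf: "\<And>A. A \<in> P \<Longrightarrow> unique_field (card A) beta"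
  shows "fuzzy_gibbs beta q z P"
proof -
  define val where "val A x = limit_field (card A) (beta * x powr (z - 1))" for A :: "nat set" and x
  define Q where "Q A nu = val A (nu A) / (\<Sum>B\<in>P. val B (nu B))" for A and nu :: "nat set \<Rightarrow> real"
  have cpos: "card A > 0" if "A \<in> P" for A
    using finite_partition_classes(2)[OF P that] partition_onD3[OF P] that by (auto simp: card_gt_0_iff)
  have val: "field_sum (card A) (beta * x powr (z - 1)) m = val A x"
    if "A \<in> P" "0 \<le> x" "x \<le> 1" "m \<in> maximizers (card A) (beta * x powr (z - 1))" for A x m
    unfolding val_def using limit_field_eq[OF uf[OF that(1)] _ _ that(4)] effective_temperature_bounds[OF beta that(2,3)] by simp
  have val_pos: "val A x > 0" if "A \<in> P" for A x
    unfolding val_def limit_field_def by (rule field_sum_pos[OF cpos[OF that]])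
  have nu01: "0 \<le> nu A \<and> nu A \<le> 1" if "nu \<in> simplex_on P" "A \<in> P" for nu A
    using that member_le_sum[of A P nu] finite_partition_classes(1)[OF P] by (auto simp: simplex_on_def)
  have sum_ne: "(\<Sum>B\<in>P. val B (nu B)) \<noteq> 0" if "A \<in> P" for A nu
    using sum_pos[of P "\<lambda>B. val B (nu B)"] val_pos finite_partition_classes(1)[OF P] that by fastforce
  show ?thesis
    unfolding fuzzy_gibbs_def
  proof (intro exI[of _ Q] conjI ballI allI impI)
    fix nu and etas :: "nat \<Rightarrow> nat set list" and A
    assume nu: "nu \<in> simplex_on P" and A: "A \<in> P"
      and h: "(\<forall>N. length (etas N) = N \<and> set (etas N) \<subseteq> P) \<and> (\<forall>A\<in>P. (\<lambda>N. emp (etas N) A) \<longlonglongrightarrow> nu A)"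
    have cl: "count_list (etas N) B \<le> N" for N B using count_le_length[of "etas N" B] h by simp
    have lim: "(\<lambda>N. spin_ratio (card B) beta (Suc N) (count_list (etas N) B)) \<longlonglongrightarrow> val B (nu B)" if B: "B \<in> P" for B
    proof (rule spin_ratio_limit)
      show "count_list (etas N) B < Suc N" for N using cl[of N B] by simp
      have "(\<lambda>N. emp (etas N) B) \<longlonglongrightarrow> nu B" "length (etas N) = N" for N using h B by blast+
      then have "(\<lambda>N. real (count_list (etas N) B) / real N) \<longlonglongrightarrow> nu B" by (simp add: emp_count)
      then show "(\<lambda>N. real (count_list (etas N) B) / real (Suc N)) \<longlonglongrightarrow> nu B"
        by (rule tendsto_over_Suc) (rule cl)
      show "field_sum (card B) (beta * nu B powr (z - 1)) m = val B (nu B)"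
        if "m \<in> maximizers (card B) (beta * nu B powr (z - 1))" for m
        using val[OF B _ _ that] nu01[OF nu B] by blast
    qed (use beta cpos[OF B] filterlim_Suc in auto)
    have "(\<lambda>N. spin_ratio (card A) beta (Suc N) (count_list (etas N) A)
        / (\<Sum>B\<in>P. spin_ratio (card B) beta (Suc N) (count_list (etas N) B))) \<longlonglongrightarrow> Q A nu"
      unfolding Q_def by (intro tendsto_divide tendsto_sum lim A sum_ne[OF A])
    moreover have "fuzzy_cond beta q z P A (etas N) = spin_ratio (card A) beta (Suc N) (count_list (etas N) A)
        / (\<Sum>B\<in>P. spin_ratio (card B) beta (Suc N) (count_list (etas N) B))" for N
      using fuzzy_cond_eq[OF P _ A, of "etas N" beta] h by simp
    ultimately show "(\<lambda>N. fuzzy_cond beta q z P A (etas N)) \<longlonglongrightarrow> Q A nu" by simp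
  next
    fix A nu and nus :: "nat \<Rightarrow> nat set \<Rightarrow> real"
    assume A: "A \<in> P" and nu: "nu \<in> simplex_on P"
      and h: "(\<forall>n. nus n \<in> simplex_on P) \<and> (\<forall>B\<in>P. (\<lambda>n. nus n B) \<longlonglongrightarrow> nu B)"
    have lim: "(\<lambda>n. val B (nus n B)) \<longlonglongrightarrow> val B (nu B)" if B: "B \<in> P" for B
      unfolding val_def
    proof (rule limit_field_continuous[OF cpos[OF B] uf[OF B]])
      have n01: "0 \<le> nus n B" "nus n B \<le> 1" for n using nu01[OF _ B] h by blast+
      show "0 \<le> beta * nus n B powr (z - 1)" "beta * nus n B powr (z - 1) \<le> beta" for n
        using effective_temperature_bounds[OF beta n01] .
      show "(\<lambda>n. beta * nus n B powr (z - 1)) \<longlonglongrightarrow> beta * nu B powr (z - 1)"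
        using h B z_gt_2 n01 by (intro tendsto_intros) auto
    qed
    show "(\<lambda>n. Q A (nus n)) \<longlonglongrightarrow> Q A nu"
      unfolding Q_def by (intro tendsto_divide tendsto_sum lim A sum_ne[OF A])
  qed
qed

text \<open>With a single fuzzy spin value the conditional probability is identically 1, whatever
  phase transition the underlying model has.\<close>

lemma fuzzy_gibbs_singleton:
  assumes "1 \<le> q"
  shows "fuzzy_gibbs beta q z {{1..q}}"
proof -
  have P: "partition_on {1..q} {{1..q}}" using assms by (intro partition_on_space) auto
  have "fuzzy_cond beta q z {{1..q}} A eta = 1" if "A \<in> {{1..q}}" "set eta \<subseteq> {{1..q}}" for A eta
  proof -
    have "spin_ratio q beta (Suc (length eta)) (count_list eta {1..q}) > 0"
      using assms by (intro spin_ratio_pos) simp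
    then show ?thesis using fuzzy_cond_eq[OF P that(2,1), of beta] that(1) by simp
  qed
  then show ?thesis
    unfolding fuzzy_gibbs_def by (intro exI[of _ "\<lambda>_ _. 1"]) auto
qed

end

section \<open>Failure of the Gibbs property\<close>

lemma count_list_replicate: "count_list (replicate n x) y = (if x = y then n else 0)"
  by (induction n) auto

lemma tendsto_floor_fraction:
  assumes "0 \<le> x"
  shows "(\<lambda>N. real (nat \<lfloor>x * real N\<rfloor>) / real N) \<longlonglongrightarrow> x"
proof (rule tendsto_sandwich)
  have "(\<lambda>N. x - 1 / real N) \<longlonglongrightarrow> x - 0" by (intro tendsto_intros lim_1_over_n)
  then show "(\<lambda>N. x - 1 / real N) \<longlonglongrightarrow> x" by simp
  have fl: "x * real N - 1 \<le> real (nat \<lfloor>x * real N\<rfloor>)" "real (nat \<lfloor>x * real N\<rfloor>) \<le> x * real N" for N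
    using assms by (auto intro: of_nat_floor)
  show "eventually (\<lambda>N. x - 1 / real N \<le> real (nat \<lfloor>x * real N\<rfloor>) / real N) sequentially"
    using eventually_gt_at_top[of 0]
  proof eventually_elim
    case (elim N)
    have "(x * real N - 1) / real N \<le> real (nat \<lfloor>x * real N\<rfloor>) / real N"
      by (intro divide_right_mono fl(1)) simp
    then show ?case using elim by (simp add: diff_divide_distrib)
  qed
  show "eventually (\<lambda>N. real (nat \<lfloor>x * real N\<rfloor>) / real N \<le> x) sequentially"
    using eventually_gt_at_top[of 0]
  proof eventually_elim
    case (elim N)
    have "real (nat \<lfloor>x * real N\<rfloor>) / real N \<le> x * real N / real N"
      by (intro divide_right_mono fl(2)) simp
    then show ?case using elim by simp
  qed
qed auto

context potts_exponent begin

text \<open>Along configurations using only the classes \<open>A\<close> and \<open>B\<close>, the quotient of the two conditional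
  probabilities is the quotient of the spin ratios. As the fraction \<open>x\<close> of \<open>A\<close> passes the critical
  value, the spin ratio of \<open>A\<close> jumps up while that of \<open>B\<close>, whose effective temperature decreases
  in \<open>x\<close>, can only jump down, so the two jumps cannot cancel.\<close>
lemma not_fuzzy_gibbs:
  assumes P: "partition_on {1..q} P" and A: "A \<in> P" and B: "B \<in> P" "B \<noteq> A"
    and adm: "admissible_rz (card A) z" and beta: "beta_c (card A) z \<le> beta"
  shows "\<not> fuzzy_gibbs beta q z P"
proof
  assume "fuzzy_gibbs beta q z P"
  then obtain Q where Qlim: "\<And>nu etas X. nu \<in> simplex_on P \<Longrightarrow> (\<forall>N. length (etas N) = N \<and> set (etas N) \<subseteq> P) \<Longrightarrow>
      (\<forall>X\<in>P. (\<lambda>N. emp (etas N) X) \<longlonglongrightarrow> nu X) \<Longrightarrow> X \<in> P \<Longrightarrow> (\<lambda>N. fuzzy_cond beta q z P X (etas N)) \<longlonglongrightarrow> Q X nu"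
    and Qcont: "\<And>X nu nus. X \<in> P \<Longrightarrow> nu \<in> simplex_on P \<Longrightarrow> (\<forall>n. nus n \<in> simplex_on P) \<Longrightarrow>
      (\<forall>X\<in>P. (\<lambda>n. nus n X) \<longlonglongrightarrow> nu X) \<Longrightarrow> (\<lambda>n. Q X (nus n)) \<longlonglongrightarrow> Q X nu"
    unfolding fuzzy_gibbs_def by blast
  let ?rA = "card A" and ?rB = "card B" let ?bc = "beta_c ?rA z"
  have fin: "finite P" using finite_partition_classes(1)[OF P] .
  have cpos: "card X > 0" if "X \<in> P" for X
    using finite_partition_classes(2)[OF P that] partition_onD3[OF P] that by (auto simp: card_gt_0_iff)
  have rA: "?rA \<ge> 2" using adm by (simp add: admissible_rz_def)
  have bc: "?bc > 0" by (rule beta_c_pos[OF adm])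
  then have beta0: "0 < beta" "0 \<le> beta" using beta by auto
  define nuv where "nuv x X = (if X = A then x else if X = B then 1 - x else 0)" for x :: real and X
  have nuv: "nuv x \<in> simplex_on P" if "0 \<le> x" "x \<le> 1" for x
  proof -
    have "(\<Sum>X\<in>P. nuv x X) = (\<Sum>X\<in>{A, B}. nuv x X)"
      using A B fin by (intro sum.mono_neutral_right) (auto simp: nuv_def)
    also have "\<dots> = 1" using B(2) by (auto simp: nuv_def)
    finally show ?thesis using that A B by (auto simp: simplex_on_def nuv_def)
  qed
  define RA where "RA n N = spin_ratio ?rA beta (Suc N) (n N)" for n :: "nat \<Rightarrow> nat" and N
  define RB where "RB n N = spin_ratio ?rB beta (Suc N) (N - n N)" for n :: "nat \<Rightarrow> nat" and N
  have R_pos: "RA n N > 0" "RB n N > 0" for n N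
    unfolding RA_def RB_def using cpos A B by (auto intro: spin_ratio_pos)
  define rho where "rho x = Q A (nuv x) / Q B (nuv x)" for x
  \<comment> \<open>Bounds the normalising sum, so the conditional probability of \<open>B\<close>
    stays above \<open>1 / M\<close> and the limiting quotient \<open>rho\<close> is
    meaningful.\<close>
  define M where "M = (\<Sum>X\<in>P. real (card X) * exp beta)"
  have M: "M > 0" unfolding M_def using A fin cpos by (intro sum_pos) auto
  \<comment> \<open>Under the assumed Gibbs property the limit is the same for every sequence of
    counts with fraction \<open>x\<close>; at \<open>x = 1\<close> this allows all sites to be put
    into \<open>A\<close>.\<close>
  have L: "(\<lambda>N. RA n N / RB n N) \<longlonglongrightarrow> rho x \<and> Q B (nuv x) \<noteq> 0"
    if n: "\<And>N. n N \<le> N" "(\<lambda>N. real (n N) / real N) \<longlonglongrightarrow> x" and x: "0 \<le> x" "x \<le> 1" for n x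
  proof -
    define etas where "etas N = replicate (n N) A @ replicate (N - n N) B" for N
    have len: "length (etas N) = N" "set (etas N) \<subseteq> P" for N
      using n(1)[of N] A B by (auto simp: etas_def)
    have cnt: "count_list (etas N) X = (if X = A then n N else if X = B then N - n N else 0)" for N X
      using B(2) by (auto simp: etas_def count_list_replicate)
    have emp: "(\<lambda>N. emp (etas N) X) \<longlonglongrightarrow> nuv x X" for X
    proof -
      consider "X = A" | "X = B" | "X \<noteq> A" "X \<noteq> B" by blast
      then show ?thesis
      proof cases
        case 1
        then show ?thesis using n(2) by (simp add: emp_count cnt len nuv_def)
      next
        case 2
        have "(\<lambda>N. 1 - real (n N) / real N) \<longlonglongrightarrow> 1 - x" by (intro tendsto_intros n(2))
        moreover have "eventually (\<lambda>N. 1 - real (n N) / real N = emp (etas N) X) sequentially"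
          using eventually_gt_at_top[of 0]
          by eventually_elim (use 2 B n(1) in \<open>simp add: emp_count cnt len of_nat_diff field_simps\<close>)
        ultimately show ?thesis using 2 B by (auto simp: nuv_def dest: Lim_transform_eventually)
      next
        case 3
        then show ?thesis by (simp add: emp_count cnt nuv_def)
      qed
    qed
    have lim: "(\<lambda>N. fuzzy_cond beta q z P X (etas N)) \<longlonglongrightarrow> Q X (nuv x)" if "X \<in> P" for X
      using Qlim[OF nuv[OF x], of etas X] len emp that by blast
    define T where "T N = (\<Sum>X\<in>P. spin_ratio (card X) beta (Suc N) (count_list (etas N) X))" for N
    have T: "0 < T N" "T N \<le> M" for N
    proof -
      show "0 < T N" unfolding T_def using A fin cpos by (intro sum_pos spin_ratio_pos) auto
      have "count_list (etas N) X < Suc N" for X using count_le_length[of "etas N" X] len by simp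
      then show "T N \<le> M" unfolding T_def M_def using cpos beta0 by (intro sum_mono spin_ratio_le) auto
    qed
    have cA: "fuzzy_cond beta q z P A (etas N) = RA n N / T N" for N
      using fuzzy_cond_eq[OF P len(2) A, of beta N] by (simp add: RA_def T_def len(1) cnt)
    have cB: "fuzzy_cond beta q z P B (etas N) = RB n N / T N" for N
      using fuzzy_cond_eq[OF P len(2) B(1), of beta N] B(2) by (simp add: RB_def T_def len(1) cnt)
    have "1 / M \<le> fuzzy_cond beta q z P B (etas N)" for N
    proof -
      have "1 \<le> real ?rB" using cpos[OF B(1)] by simp
      also have "\<dots> \<le> RB n N" unfolding RB_def using cpos[OF B(1)] beta0 by (intro spin_ratio_ge) auto
      finally show ?thesis unfolding cB using T[of N] by (intro frac_le) auto
    qed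
    then have "1 / M \<le> Q B (nuv x)" using LIMSEQ_le_const[OF lim[OF B(1)]] by blast
    moreover have "0 < 1 / M" using M by simp
    ultimately have ne: "Q B (nuv x) \<noteq> 0" by linarith
    have "(\<lambda>N. fuzzy_cond beta q z P A (etas N) / fuzzy_cond beta q z P B (etas N)) \<longlonglongrightarrow> rho x"
      unfolding rho_def by (intro tendsto_divide lim A B ne)
    moreover have "fuzzy_cond beta q z P A (etas N) / fuzzy_cond beta q z P B (etas N) = RA n N / RB n N" for N
      unfolding cA cB using T(1)[of N] by simp
    ultimately show ?thesis using ne by simp
  qed
  define fl where "fl x N = nat \<lfloor>x * real N\<rfloor>" for x :: real and N :: nat
  have fl: "fl x N \<le> N" "(\<lambda>N. real (fl x N) / real N) \<longlonglongrightarrow> x" if "0 \<le> x" "x \<le> 1" for x N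
  proof -
    have "x * real N \<le> real N" using that by (simp add: mult_left_le_one_le)
    then have "\<lfloor>x * real N\<rfloor> \<le> \<lfloor>real N\<rfloor>" by (rule floor_mono)
    then show "fl x N \<le> N" unfolding fl_def by simp
    show "(\<lambda>N. real (fl x N) / real N) \<longlonglongrightarrow> x" unfolding fl_def by (rule tendsto_floor_fraction[OF that(1)])
  qed
  have rho_nonneg: "0 \<le> rho x" if x: "0 \<le> x" "x \<le> 1" for x
    using LIMSEQ_le_const[OF conjunct1[OF L[OF fl[OF x] x]]] R_pos by (meson divide_nonneg_nonneg less_imp_le)
  have rho_cont: "(\<lambda>k. rho (xs k)) \<longlonglongrightarrow> rho x"
    if xs: "\<And>k. 0 \<le> xs k" "\<And>k. xs k \<le> 1" "xs \<longlonglongrightarrow> x" and x: "0 \<le> x" "x \<le> 1" for xs x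
  proof -
    have "(\<lambda>k. nuv (xs k) X) \<longlonglongrightarrow> nuv x X" for X
      unfolding nuv_def using xs(3) by (auto intro!: tendsto_intros)
    then have "(\<lambda>k. Q X (nuv (xs k))) \<longlonglongrightarrow> Q X (nuv x)" if "X \<in> P" for X
      using Qcont[OF that nuv[OF x], of "\<lambda>k. nuv (xs k)"] nuv xs(1,2) by blast
    then show ?thesis unfolding rho_def using L[OF fl[OF x] x] A B by (intro tendsto_divide) auto
  qed
  have A_frac: "(\<lambda>N. real (n N) / real (Suc N)) \<longlonglongrightarrow> x" and B_frac: "(\<lambda>N. real (N - n N) / real (Suc N)) \<longlonglongrightarrow> 1 - x"
    if n: "\<And>N. n N \<le> N" "(\<lambda>N. real (n N) / real N) \<longlonglongrightarrow> x" for n x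
  proof -
    show l: "(\<lambda>N. real (n N) / real (Suc N)) \<longlonglongrightarrow> x" by (rule tendsto_over_Suc[OF n(2,1)])
    have "(\<lambda>N. 1 - 1 / real (Suc N) - real (n N) / real (Suc N)) \<longlonglongrightarrow> 1 - 0 - x"
      by (intro tendsto_intros LIMSEQ_Suc lim_1_over_n l)
    moreover have "1 - 1 / real (Suc N) - real (n N) / real (Suc N) = real (N - n N) / real (Suc N)" for N
    proof -
      have "real (N - n N) / real (Suc N) = (real (Suc N) - 1 - real (n N)) / real (Suc N)"
        using n(1)[of N] by (simp add: of_nat_diff)
      then show ?thesis by (simp only: diff_divide_distrib divide_self_if) simp
    qed
    ultimately show "(\<lambda>N. real (N - n N) / real (Suc N)) \<longlonglongrightarrow> 1 - x" by simp
  qed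
  \<comment> \<open>Stated in product form and with bounds over all maximizers, so that it applies
    even where one of the spin ratios does not converge. The choice of \<open>e\<close> absorbs the
    errors of both ratios.\<close>
  have rho_upper: "rho x * t \<le> s"
    if x: "0 \<le> x" "x \<le> 1"
      and s: "\<And>m. m \<in> maximizers ?rA (beta * x powr (z - 1)) \<Longrightarrow> field_sum ?rA (beta * x powr (z - 1)) m \<le> s"
      and t: "\<And>m. m \<in> maximizers ?rB (beta * (1 - x) powr (z - 1)) \<Longrightarrow> t \<le> field_sum ?rB (beta * (1 - x) powr (z - 1)) m"
    for x s t
  proof (rule field_le_epsilon)
    fix e' :: real assume e': "0 < e'"
    define e where "e = e' / (1 + rho x)"
    have e: "e > 0" using e' rho_nonneg[OF x] by (simp add: e_def)
    have "eventually (\<lambda>N. RA (fl x) N < s + e) sequentially"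
      unfolding RA_def using cpos[OF A] beta0 e s fl(1)[OF x]
      by (intro spin_ratio_upper[OF _ filterlim_Suc A_frac[OF fl[OF x]]]) (auto simp: le_imp_less_Suc)
    moreover have "eventually (\<lambda>N. t - e < RB (fl x) N) sequentially"
      unfolding RB_def using cpos[OF B(1)] beta0 e t
      by (intro spin_ratio_lower[OF _ filterlim_Suc B_frac[OF fl[OF x]]]) auto
    ultimately have "eventually (\<lambda>N. RA (fl x) N / RB (fl x) N * (t - e) \<le> s + e) sequentially"
    proof eventually_elim
      case (elim N)
      have "RA (fl x) N / RB (fl x) N * (t - e) \<le> RA (fl x) N / RB (fl x) N * RB (fl x) N"
        using elim R_pos[of "fl x" N] by (intro mult_left_mono) auto
      then show ?case using elim R_pos[of "fl x" N] by simp
    qed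
    moreover have "(\<lambda>N. RA (fl x) N / RB (fl x) N * (t - e)) \<longlonglongrightarrow> rho x * (t - e)"
      using L[OF fl[OF x] x] by (intro tendsto_intros) auto
    ultimately have "rho x * (t - e) \<le> s + e"
      by (intro tendsto_upperbound[where F = sequentially]) auto
    then have "rho x * t \<le> s + e * (1 + rho x)" by (simp add: algebra_simps)
    also have "e * (1 + rho x) = e'" using rho_nonneg[OF x] by (simp add: e_def)
    finally show "rho x * t \<le> s + e'" .
  qed
  have rho_lower: "s \<le> rho x * t"
    if x: "0 \<le> x" "x \<le> 1" and n: "\<And>N. n N \<le> N" "(\<lambda>N. real (n N) / real N) \<longlonglongrightarrow> x"
      and s: "\<And>e. 0 < e \<Longrightarrow> eventually (\<lambda>N. s - e < RA n N) sequentially"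
      and t: "\<And>m. m \<in> maximizers ?rB (beta * (1 - x) powr (z - 1)) \<Longrightarrow> field_sum ?rB (beta * (1 - x) powr (z - 1)) m \<le> t"
    for x s t n
  proof (rule field_le_epsilon)
    fix e' :: real assume e': "0 < e'"
    define e where "e = e' / (1 + rho x)"
    have e: "e > 0" using e' rho_nonneg[OF x] by (simp add: e_def)
    have "eventually (\<lambda>N. RB n N < t + e) sequentially"
      unfolding RB_def using cpos[OF B(1)] beta0 e t
      by (intro spin_ratio_upper[OF _ filterlim_Suc B_frac[OF n]]) auto
    with s[OF e] have "eventually (\<lambda>N. s - e \<le> RA n N / RB n N * (t + e)) sequentially"
    proof eventually_elim
      case (elim N)
      have "RA n N / RB n N * RB n N \<le> RA n N / RB n N * (t + e)"
        using elim R_pos[of n N] by (intro mult_left_mono) auto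
      then show ?case using elim R_pos[of n N] by simp
    qed
    moreover have "(\<lambda>N. RA n N / RB n N * (t + e)) \<longlonglongrightarrow> rho x * (t + e)"
      using L[OF n x] by (intro tendsto_intros) auto
    ultimately have "s - e \<le> rho x * (t + e)"
      by (intro tendsto_lowerbound[where F = sequentially]) auto
    then have "s \<le> rho x * t + e * (1 + rho x)" by (simp add: algebra_simps)
    also have "e * (1 + rho x) = e'" using rho_nonneg[OF x] by (simp add: e_def)
    finally show "s \<le> rho x * t + e'" .
  qed
  \<comment> \<open>The fraction at which the effective inverse temperature of \<open>A\<close>
    equals its critical value; it is at most 1 because \<open>beta_c \<le> beta\<close>.\<close>
  define nc where "nc = (?bc / beta) powr (1 / (z - 1))"
  have nc: "0 < nc" "nc \<le> 1"
    using bc beta beta0 z_gt_2 by (auto simp: nc_def intro!: powr_le1)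
  have nc_eq: "beta * nc powr (z - 1) = ?bc"
    using bc beta0 z_gt_2 by (simp add: nc_def powr_powr)
  have mono: "beta * x powr (z - 1) < beta * y powr (z - 1)" if "0 \<le> x" "x < y" for x y
    using that beta0 z_gt_2 by (intro mult_strict_left_mono powr_less_mono2) auto
  define S0 where "S0 = field_sum ?rA ?bc (uniform ?rA)"
  let ?bB = "beta * (1 - nc) powr (z - 1)"
  obtain mB where mB: "mB \<in> maximizers ?rB ?bB" using maximizers_nonempty[OF cpos[OF B(1)]] .
  \<comment> \<open>Any maximizer for \<open>B\<close> at the critical fraction will do: by
    monotonicity \<open>tB\<close> is a lower bound for the field sum of \<open>B\<close> to the
    left of \<open>nc\<close> and an upper bound to the right.\<close>
  define tB where "tB = field_sum ?rB ?bB mB"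
  have low: "rho nc * tB \<le> S0"
  proof -
    have below: "rho x * tB \<le> S0" if x: "0 \<le> x" "x < nc" for x
    proof (rule rho_upper)
      fix m assume m: "m \<in> maximizers ?rA (beta * x powr (z - 1))"
      have less: "beta * x powr (z - 1) < ?bc" using mono[OF x] nc_eq by simp
      have "field_sum ?rA (beta * x powr (z - 1)) m = field_sum ?rA (beta * x powr (z - 1)) (uniform ?rA)"
        unfolding field_sum_def uniform_def
        using maximizers_disordered[OF disordered_below_beta_c[OF rA less] m] by (intro sum.cong) auto
      also have "\<dots> \<le> S0"
        unfolding S0_def field_sum_def using less
        by (intro sum_mono) (auto intro: mult_right_mono)
      finally show "field_sum ?rA (beta * x powr (z - 1)) m \<le> S0" .
    next
      fix m assume m: "m \<in> maximizers ?rB (beta * (1 - x) powr (z - 1))"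
      show "tB \<le> field_sum ?rB (beta * (1 - x) powr (z - 1)) m"
        unfolding tB_def using x nc beta0 by (intro maximizers_field_sum_mono[OF _ _ mB m] mono) auto
    qed (use x nc in auto)
    define xs where "xs k = nc - nc * inverse (real (Suc k))" for k
    have inv: "0 < inverse (real (Suc k))" "inverse (real (Suc k)) \<le> 1" for k by (auto simp: inverse_le_1_iff)
    have xs: "0 \<le> xs k" "xs k < nc" "xs k \<le> 1" for k
    proof -
      show "0 \<le> xs k" "xs k < nc" using nc inv[of k] by (auto simp: xs_def mult_left_le)
      then show "xs k \<le> 1" using nc(2) by simp
    qed
    have "xs \<longlonglongrightarrow> nc - nc * 0" unfolding xs_def by (intro tendsto_intros LIMSEQ_inverse_real_of_nat)
    then have "(\<lambda>k. rho (xs k) * tB) \<longlonglongrightarrow> rho nc * tB"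
      using xs nc by (intro tendsto_intros rho_cont) auto
    then show ?thesis using below xs by (intro LIMSEQ_le_const2) auto
  qed
  \<comment> \<open>If \<open>beta\<close> exceeds the critical value, \<open>nc\<close> is
    approached from the right, where \<open>A\<close> is ordered. If they are equal,
    \<open>nc = 1\<close> leaves no room on the right, and the ordered share at the endpoint itself
    supplies the gap.\<close>
  have high: "\<exists>s>S0. s \<le> rho nc * tB"
  proof (cases "beta = ?bc")
    case True
    have nc1: "nc = 1" using True beta0 by (simp add: nc_def)
    obtain c where c: "c > 0" "eventually (\<lambda>N. S0 + c < spin_ratio ?rA ?bc (Suc N) N) sequentially"
      using spin_ratio_critical[OF adm] unfolding S0_def by blast
    \<comment> \<open>All conditioning sites are in \<open>A\<close>, while \<open>B\<close> has
      fraction 0 and hence a field sum equal to its size.\<close>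
    have "S0 + c \<le> rho 1 * tB"
    proof (rule rho_lower[where n = "\<lambda>N. N"])
      have "eventually (\<lambda>N. real N / real N = 1) sequentially"
        using eventually_gt_at_top[of 0] by eventually_elim simp
      then show "(\<lambda>N. real N / real N) \<longlonglongrightarrow> 1" by (rule tendsto_eventually)
      show "eventually (\<lambda>N. S0 + c - e < RA (\<lambda>N. N) N) sequentially" if "0 < e" for e
        using c(2) by eventually_elim (use that True in \<open>simp add: RA_def\<close>)
      show "field_sum ?rB (beta * (1 - 1) powr (z - 1)) m \<le> tB" for m
        by (simp add: tB_def nc1 field_sum_0)
    qed auto
    then show ?thesis using c(1) nc1 by (intro exI[of _ "S0 + c"]) auto
  next
    case False
    then have gt: "?bc < beta" using beta by simp
    have nc1: "nc < 1"
      unfolding nc_def using gt bc beta0 z_gt_2 powr_less_mono2[of "1 / (z - 1)" "?bc / beta" 1] by simp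
    obtain x0 m1 where x0: "1 / ?rA < x0" and m1: "m1 \<in> maximizers ?rA ?bc" "\<exists>i<?rA. x0 \<le> m1 i"
      using first_order_transition[OF adm] by blast
    define S1 where "S1 = field_sum ?rA ?bc m1"
    have "power_sum ?rA (uniform ?rA) < power_sum ?rA m1"
      using power_sum_uniform_less[OF maximizersD(1)[OF m1(1)]] m1(2) x0 by force
    moreover have "F ?rA ?bc m1 = F ?rA ?bc (uniform ?rA)"
      using m1(1) uniform_maximizer_beta_c[OF rA] by (auto simp: maximizers_def intro: order_antisym)
    ultimately have "S0 < S1"
      using maximizer_field_sum[OF m1(1)] maximizer_field_sum[OF uniform_maximizer_beta_c[OF rA]] bc z_gt_2
      by (simp add: S0_def S1_def)
    have above: "S1 \<le> rho x * tB" if x: "nc < x" "x \<le> 1" for x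
    proof -
      have x0: "0 \<le> x" using x nc by simp
      show ?thesis
      proof (rule rho_lower[OF x0 x(2) fl[OF x0 x(2)]])
        fix e :: real assume e: "0 < e"
        show "eventually (\<lambda>N. S1 - e < RA (fl x) N) sequentially"
          unfolding RA_def
        proof (rule spin_ratio_lower[OF _ filterlim_Suc A_frac[OF fl[OF x0 x(2)]]])
          fix m assume m: "m \<in> maximizers ?rA (beta * x powr (z - 1))"
          show "S1 \<le> field_sum ?rA (beta * x powr (z - 1)) m"
            unfolding S1_def using x nc bc mono[of nc x]
            by (intro maximizers_field_sum_mono[OF _ _ m1(1) m]) (auto simp: nc_eq)
        qed (use e beta0 cpos[OF A] fl(1)[OF x0 x(2)] in \<open>auto simp: le_imp_less_Suc\<close>)
      next
        fix m assume m: "m \<in> maximizers ?rB (beta * (1 - x) powr (z - 1))"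
        show "field_sum ?rB (beta * (1 - x) powr (z - 1)) m \<le> tB"
          unfolding tB_def using x nc beta0 by (intro maximizers_field_sum_mono[OF _ _ m mB] mono) auto
      qed
    qed
    define xs where "xs k = nc + (1 - nc) * inverse (real (Suc k))" for k
    have inv: "0 < inverse (real (Suc k))" "inverse (real (Suc k)) \<le> 1" for k by (auto simp: inverse_le_1_iff)
    have xs: "nc < xs k" "xs k \<le> 1" "0 \<le> xs k" for k
    proof -
      show "nc < xs k" using nc1 inv(1)[of k] by (simp add: xs_def)
      then show "0 \<le> xs k" using nc(1) by simp
      have "(1 - nc) * inverse (real (Suc k)) \<le> (1 - nc) * 1" using nc1 inv(2)[of k] by (intro mult_left_mono) auto
      then show "xs k \<le> 1" by (simp add: xs_def)
    qed
    have "xs \<longlonglongrightarrow> nc + (1 - nc) * 0" unfolding xs_def by (intro tendsto_intros LIMSEQ_inverse_real_of_nat)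
    then have "(\<lambda>k. rho (xs k) * tB) \<longlonglongrightarrow> rho nc * tB"
      using xs nc by (intro tendsto_intros rho_cont) auto
    then have "S1 \<le> rho nc * tB" using above xs by (intro LIMSEQ_le_const) auto
    then show ?thesis using \<open>S0 < S1\<close> by blast
  qed
  show False using low high by linarith
qed

section \<open>Thresholds along the collapsing scheme\<close>

lemma r_star_admissible:
  assumes "finite P" "\<exists>A\<in>P. admissible_rz (card A) z"
  shows "\<exists>A\<in>P. card A = r_star P z \<and> admissible_rz (card A) z"
    and "A \<in> P \<Longrightarrow> admissible_rz (card A) z \<Longrightarrow> r_star P z \<le> card A"
proof -
  let ?S = "{card A | A. A \<in> P \<and> admissible_rz (card A) z}"
  have fin: "finite ?S" using assms(1) by simp
  have "Min ?S \<in> ?S" using fin assms(2) by (intro Min_in) auto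
  then show "\<exists>A\<in>P. card A = r_star P z \<and> admissible_rz (card A) z" by (auto simp: r_star_def)
  show "A \<in> P \<Longrightarrow> admissible_rz (card A) z \<Longrightarrow> r_star P z \<le> card A"
    unfolding r_star_def using fin by (intro Min_le) auto
qed

text \<open>A non-admissible class has one element, or two with \<open>z \<le> 4\<close>, and has no
  jump at any temperature. Among admissible classes the smallest has the lowest critical value.
  Nontriviality of \<open>P\<close> supplies the second class against which the jump becomes
  visible.\<close>

lemma fuzzy_gibbs_iff:
  assumes P: "partition_on {1..q} P" and ne: "P \<noteq> {{1..q}}" and beta: "0 \<le> beta"
    and adm: "\<exists>A\<in>P. admissible_rz (card A) z"
  shows "fuzzy_gibbs beta q z P \<longleftrightarrow> beta < beta_c (r_star P z) z"
proof
  note rs = r_star_admissible[OF finite_partition_classes(1)[OF P] adm]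
  obtain A where A: "A \<in> P" "card A = r_star P z" "admissible_rz (card A) z" using rs(1) by blast
  show "beta < beta_c (r_star P z) z" if "fuzzy_gibbs beta q z P"
  proof (rule ccontr)
    assume "\<not> ?thesis"
    moreover have "\<exists>B\<in>P. B \<noteq> A"
    proof (rule ccontr)
      assume "\<not> ?thesis"
      then have "P = {A}" using A(1) by blast
      then show False using partition_onD1[OF P] ne by simp
    qed
    ultimately show False using not_fuzzy_gibbs[OF P A(1) _ _ A(3)] that A(2) by (auto simp: not_less)
  qed
  show "fuzzy_gibbs beta q z P" if less: "beta < beta_c (r_star P z) z"
  proof (rule fuzzy_gibbs_if_unique_field[OF P beta])
    fix B assume B: "B \<in> P"
    have "card B > 0"
      using finite_partition_classes(2)[OF P B] partition_onD3[OF P] B by (auto simp: card_gt_0_iff)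
    then consider "admissible_rz (card B) z" | "card B = 1" | "card B = 2" "z \<le> 4"
      using z_gt_2 by (force simp: admissible_rz_def)
    then show "unique_field (card B) beta"
    proof cases
      case 1
      have "2 \<le> r_star P z" using A by (simp add: admissible_rz_def)
      then have "beta_c (r_star P z) z \<le> beta_c (card B) z" using rs(2)[OF B 1] by (rule beta_c_mono)
      then show ?thesis using less 1 by (intro unique_field_disordered) (auto simp: admissible_rz_def)
    next
      case 2
      then show ?thesis using unique_field_one by metis
    next
      case 3
      then show ?thesis by (simp add: unique_field_two)
    qed
  qed
qed

end

text \<open>The one-class partition has no strict coarsening, so it can occur only at the last
  stage.\<close>

lemma collapsing_scheme_nontrivial:
  assumes "collapsing_scheme q As T" "t < T"
  shows "As t \<noteq> {{1..q}}"
proof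
  assume eq: "As t = {{1..q}}"
  have P: "partition_on {1..q} (As (Suc t))" and c: "coarser (As (Suc t)) (As t)" "As (Suc t) \<noteq> As t"
    using assms by (auto simp: collapsing_scheme_def)
  obtain B where B: "B \<in> As (Suc t)" "{1..q} \<subseteq> B" using c(1) eq by (auto simp: coarser_def)
  then have "B = {1..q}" using partition_onD1[OF P] by blast
  moreover have "C = B" if "C \<in> As (Suc t)" for C
  proof (rule ccontr)
    assume "C \<noteq> B"
    then have "C \<inter> B = {}" using disjointD[OF partition_onD2[OF P] that B(1)] by blast
    moreover have "C \<subseteq> B" using partition_onD1[OF P] that B(2) by blast
    ultimately have "C = {}" by blast
    then show False using partition_onD3[OF P] that by simp
  qed
  ultimately have "As (Suc t) = {{1..q}}" using B(1) by blast
  then show False using c(2) eq by simp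
qed

theorem theorem4p3:
  fixes q T :: nat and z beta :: real and As :: "nat \<Rightarrow> nat set set"
  assumes "2 \<le> q" and "z > 2" and "beta > 0"
    and "regular_scheme q z As T"
  shows "((\<forall>t\<in>{1..T}. fuzzy_gibbs beta q z (As t))
           \<longleftrightarrow> beta < beta_c (r_star (As 1) z) z)
       \<and> ((\<forall>t\<in>{1..T-1}. \<not> fuzzy_gibbs beta q z (As t))
           \<longleftrightarrow> beta_c (r_star (As (T-1)) z) z \<le> beta)
       \<and> (beta_c (r_star (As 1) z) z \<le> beta \<and> beta < beta_c (r_star (As (T-1)) z) z
           \<longrightarrow> (\<exists>tG\<in>{2..T-1}. (\<forall>t\<in>{1..<tG}. \<not> fuzzy_gibbs beta q z (As t))
                              \<and> (\<forall>t\<in>{tG..T}. fuzzy_gibbs beta q z (As t))))"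
proof -
  interpret potts_exponent z by unfold_locales (rule assms(2))
  have scheme: "collapsing_scheme q As T" and T: "2 \<le> T"
    and adm: "\<And>t. 1 \<le> t \<Longrightarrow> t \<le> T - 1 \<Longrightarrow> \<exists>A\<in>As t. admissible_rz (card A) z"
    and mono: "\<And>s t. 1 \<le> s \<Longrightarrow> s \<le> t \<Longrightarrow> t \<le> T - 1 \<Longrightarrow> r_star (As s) z \<le> r_star (As t) z"
    using assms(4) by (auto simp: regular_scheme_def)
  have part: "partition_on {1..q} (As t)" if "t \<le> T" for t
    using scheme that by (simp add: collapsing_scheme_def)
  define c where "c t = beta_c (r_star (As t) z) z" for t
  \<comment> \<open>The stages up to \<open>T - 1\<close> are governed by thresholds
    \<open>c t\<close>, increasing in the weak sense by regularity; the one-class stage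
    \<open>T\<close> is Gibbs at every \<open>beta\<close> and is handled apart.\<close>
  have iff: "fuzzy_gibbs beta q z (As t) \<longleftrightarrow> beta < c t" if "1 \<le> t" "t \<le> T - 1" for t
    unfolding c_def using that T assms(3)
    by (intro fuzzy_gibbs_iff part collapsing_scheme_nontrivial[OF scheme] adm) auto
  have last: "fuzzy_gibbs beta q z (As T)"
    using fuzzy_gibbs_singleton[of q] scheme assms(1) by (simp add: collapsing_scheme_def)
  have c_mono: "c s \<le> c t" if "1 \<le> s" "s \<le> t" "t \<le> T - 1" for s t
  proof -
    have "s \<le> T" using that by simp
    then have "2 \<le> r_star (As s) z"
      using r_star_admissible(1)[OF finite_partition_classes(1)[OF part[of s]] adm[of s]] that T
      by (auto simp: admissible_rz_def)
    then show ?thesis unfolding c_def using mono[OF that] by (rule beta_c_mono)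
  qed
  have "(\<forall>t\<in>{1..T}. fuzzy_gibbs beta q z (As t)) \<longleftrightarrow> beta < c 1"
  proof
    assume "\<forall>t\<in>{1..T}. fuzzy_gibbs beta q z (As t)"
    then show "beta < c 1" using iff[of 1] T by auto
  next
    assume lt: "beta < c 1"
    show "\<forall>t\<in>{1..T}. fuzzy_gibbs beta q z (As t)"
    proof
      fix t assume t: "t \<in> {1..T}"
      show "fuzzy_gibbs beta q z (As t)"
      proof (cases "t = T")
        case False
        then have "1 \<le> t" "t \<le> T - 1" using t by auto
        then show ?thesis using iff[of t] c_mono[of 1 t] lt by simp
      qed (use last in simp)
    qed
  qed
  moreover have "(\<forall>t\<in>{1..T-1}. \<not> fuzzy_gibbs beta q z (As t)) \<longleftrightarrow> c (T - 1) \<le> beta"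
  proof
    assume "\<forall>t\<in>{1..T-1}. \<not> fuzzy_gibbs beta q z (As t)"
    moreover have "1 \<le> T - 1" using T by simp
    ultimately show "c (T - 1) \<le> beta" using iff[of "T - 1"] by (auto simp: not_less)
  next
    assume le: "c (T - 1) \<le> beta"
    show "\<forall>t\<in>{1..T-1}. \<not> fuzzy_gibbs beta q z (As t)"
    proof
      fix t assume "t \<in> {1..T-1}"
      then have "1 \<le> t" "t \<le> T - 1" by auto
      then show "\<not> fuzzy_gibbs beta q z (As t)" using iff[of t] c_mono[of t "T - 1"] le by simp
    qed
  qed
  moreover have "\<exists>tG\<in>{2..T-1}. (\<forall>t\<in>{1..<tG}. \<not> fuzzy_gibbs beta q z (As t))
      \<and> (\<forall>t\<in>{tG..T}. fuzzy_gibbs beta q z (As t))" if h: "c 1 \<le> beta" "beta < c (T - 1)"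
  proof -
    \<comment> \<open>The first stage whose threshold exceeds \<open>beta\<close>. The lower bound
      on \<open>beta\<close> excludes stage 1, the upper bound makes \<open>T - 1\<close> a
      candidate, and monotone thresholds keep all later stages Gibbs.\<close>
    define tG where "tG = (LEAST t. 1 \<le> t \<and> beta < c t)"
    have ex: "1 \<le> T - 1 \<and> beta < c (T - 1)" using h(2) T by auto
    have tG: "1 \<le> tG" "beta < c tG" using LeastI[of "\<lambda>t. 1 \<le> t \<and> beta < c t", OF ex] by (auto simp: tG_def)
    have tG_le: "tG \<le> T - 1" unfolding tG_def using ex by (rule Least_le)
    have "tG \<noteq> 1" using tG(2) h(1) by auto
    then have mem: "tG \<in> {2..T - 1}" using tG(1) tG_le by auto
    have "\<not> fuzzy_gibbs beta q z (As t)" if "t \<in> {1..<tG}" for t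
    proof -
      have "\<not> (1 \<le> t \<and> beta < c t)" using that not_less_Least[of t] unfolding tG_def by auto
      then show ?thesis using that iff[of t] tG_le by auto
    qed
    moreover have "fuzzy_gibbs beta q z (As t)" if t: "t \<in> {tG..T}" for t
    proof (cases "t = T")
      case False
      then have "tG \<le> t" "t \<le> T - 1" using t by auto
      then show ?thesis using iff[of t] c_mono[of tG t] tG by simp
    qed (use last in simp)
    ultimately show ?thesis using mem by blast
  qed
  ultimately show ?thesis by (simp add: c_def)
qed

end
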